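(* Let $1\le p<\infty$ and $r,s\in\mathbb{N}$ with $s\le 2r$, and let $f\in L_p(\mathbb{R}^d)$. Suppose $G_\sigma$, $\sigma>0$, satisfies assumptions $(A_1)$ and $(A_3)$ (with this $s$). Then $$\|f-G_\sigma f\|_p\le \kappa_1\|f_{\gamma/\sigma,r}-f\|_{\ell_p(X_\sigma)}+C_1\,\omega_s(f,\sigma^{-1})_p .$$ If, additionally, $f\in\ell_p(X_\sigma)$ and $(A_2)$ holds, then $$\kappa_2\|f_{\gamma/\sigma,r}-f\|_{\ell_p(X_\sigma)}-C_2\,\omega_s(f,\sigma^{-1})_p\le \|f-G_\sigma f\|_p .$$ Here $C_1,C_2$ are positive constants independent of $f$ and $\sigma$.
   Context: $L_p(\mathbb{R}^d)$, $1\le p<\infty$, is the space of finite-valued measurable $f:\mathbb{R}^d\to\mathbb{R}$ with $\|f\|_p=(\int_{\mathbb{R}^d}|f|^p)^{1/p}<\infty$; functions equal almost everywhere are NOT identified (each function has a definite value at each point). $|f|_{W_p^s}=\sum_{|\alpha|_1=s}\|D^\alpha f\|_p$. Sampling points: for each $\sigma>0$, $X_\sigma\subset\mathbb{R}^d$ is a finite or infinite set with $\min_{\xi\ne\xi'\in X_\sigma}|\xi-\xi'|>2\gamma/\sigma$, where $\gamma\in(0,1]$ is independent of $\sigma$. $\|f\|_{\ell_p(X_\sigma)}=\big(\sigma^{-d}\sum_{\xi\in X_\sigma}|f(\xi)|^p\big)^{1/p}$, and $f\in\ell_p(X_\sigma)$ means this is finite. Band-limited functions: $\mathcal{B}_p^\sigma(\mathbb{R}^d)=\{\varphi\in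 L_p(\mathbb{R}^d)\cap L_1(\mathbb{R}^d):\operatorname{supp}\widehat\varphi\subset[-\sigma,\sigma]^d\}$, with $\widehat\varphi(x)=\int_{\mathbb{R}^d}\varphi(y)e^{-2\pi i(x,y)}dy$. Sampling operator: $G_\sigma f(x)=\sum_{\xi\in X_\sigma}f(\xi)\psi_{\xi,\sigma}(x)$ with given kernel functions $\psi_{\xi,\sigma}$. Assumptions, with positive constants $\kappa_i$ independent of $\sigma$ and of the function: $(A_1)$ $\|G_\sigma f\|_p\le\kappa_1\|f\|_{\ell_p(X_\sigma)}$ for all $f\in L_p(\mathbb{R}^d)\cap\ell_p(X_\sigma)$; $(A_2)$ $\kappa_2\|f\|_{\ell_p(X_\sigma)}\le\|G_\sigma f\|_p$ for all $f\in L_p(\mathbb{R}^d)\cap\ell_p(X_\sigma)$; $(A_3)$ for the given $s\in\mathbb{N}$ there is $\lambda\in(0,1]$ (independent of $\sigma$) such that $\|g-G_\sigma g\|_p\le\kappa_3\sigma^{-s}|g|_{W_p^s}$ for all $g\in\mathcal{B}_p^{\lambda\sigma}(\mathbb{R}^d)$. Modulus of smoothness: $\omega_s(f,\delta)_p=\sup_{|h|<\delta}\|\Delta_h^sf\|_p$, $\Delta_h^sf(x)=\sum_{\nu=0}^s\binom{s}{\nu}(-1)^\nu f(x+(s-\nu)h)$. Averaged operator: $f_{\delta,r}(x)=-\frac{2}{\binom{2r}{r}}\sum_{j=1}^r(-1)^j\binom{2r}{r-j}f_{\delta j/r}(x)$, where $f_\delta(x)=\frac1{|B_\delta|}\int_{B_\delta(x)}f(y)\,dy$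 and $B_\delta(x)$ is the open Euclidean ball of radius $\delta$ centred at $x$, $B_\delta=B_\delta(0)$. In the first inequality, if $f\notin\ell_p(X_\sigma)$ the right-hand side is $+\infty$ and the inequality is understood to hold trivially. *)

theory Defs
  imports "HOL-Analysis.Analysis"
begin

section \<open>Function and sequence spaces\<close>

text \<open>All (quasi-)norms take values in \<^typ>\<open>ennreal\<close>, so that an infinite norm is \<open>\<infinity>\<close>.\<close>

definition enn_root :: "real \<Rightarrow> ennreal \<Rightarrow> ennreal" where
  "enn_root p a = (if a = \<infinity> then \<infinity> else ennreal (enn2real a powr (1 / p)))"

definition Lp_norm :: "real \<Rightarrow> (real ^ 'n \<Rightarrow> real) \<Rightarrow> ennreal" where
  "Lp_norm p f = enn_root p (\<integral>\<^sup>+ x. ennreal (\<bar>f x\<bar> powr p) \<partial>lebesgue)"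

text \<open>Genuine functions, not classes modulo equality almost everywhere.\<close>

definition Lp :: "real \<Rightarrow> (real ^ 'n \<Rightarrow> real) set" where
  "Lp p = {f \<in> borel_measurable lebesgue. Lp_norm p f < \<infinity>}"

definition lp_norm :: "real \<Rightarrow> real \<Rightarrow> (real ^ 'n) set \<Rightarrow> (real ^ 'n \<Rightarrow> real) \<Rightarrow> ennreal" where
  "lp_norm p \<sigma> X f =
     enn_root p (ennreal (1 / \<sigma> ^ CARD('n)) * (\<Sum>\<^sub>\<infinity>\<xi>\<in>X. ennreal (\<bar>f \<xi>\<bar> powr p)))"

definition lp :: "real \<Rightarrow> real \<Rightarrow> (real ^ 'n) set \<Rightarrow> (real ^ 'n \<Rightarrow> real) set" where
  "lp p \<sigma> X = {f. lp_norm p \<sigma> X f < \<infinity>}"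


section \<open>Derivatives and the Sobolev seminorm\<close>

definition partial_deriv :: "'n \<Rightarrow> (real ^ 'n \<Rightarrow> real) \<Rightarrow> real ^ 'n \<Rightarrow> real" where
  "partial_deriv i f x = deriv (\<lambda>t. f (x + t *\<^sub>R axis i 1)) 0"

text \<open>
  The classical derivative for the multi-index \<open>\<alpha>\<close>: differentiate \<open>\<alpha> i\<close> times in each
  coordinate \<open>i\<close>. Since the index type carries no order, the order of differentiation is
  chosen arbitrarily; it is immaterial for the band-limited functions below, which are smooth.
\<close>

definition multi_deriv :: "('n \<Rightarrow> nat) \<Rightarrow> (real ^ 'n \<Rightarrow> real) \<Rightarrow> real ^ 'n \<Rightarrow> real" where
  "multi_deriv \<alpha> f = fold partial_deriv (SOME is. \<forall>i. count_list is i = \<alpha> i) f"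

definition sobolev_seminorm :: "real \<Rightarrow> nat \<Rightarrow> (real ^ 'n \<Rightarrow> real) \<Rightarrow> ennreal" where
  "sobolev_seminorm p s f = (\<Sum>\<alpha> | (\<Sum>i\<in>UNIV. \<alpha> i) = s. Lp_norm p (multi_deriv \<alpha> f))"


section \<open>Band-limited functions\<close>

definition fourier :: "(real ^ 'n \<Rightarrow> real) \<Rightarrow> real ^ 'n \<Rightarrow> complex" where
  "fourier \<phi> x =
     (LINT y|lebesgue. of_real (\<phi> y) * exp (- 2 * of_real pi * \<i> * of_real (x \<bullet> y)))"

text \<open>
  An integrable function with compactly supported Fourier transform agrees almost everywhere
  with exactly one continuous function, which is the restriction of an entire function. As
  functions are not identified almost everywhere and are sampled pointwise, continuity selects
  this representative. Without it, the space would contain every null function, and the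
  approximation property \<open>sampling_A3\<close> below (with derivatives read modulo null sets) could
  never hold.
\<close>

definition bandlimited :: "real \<Rightarrow> real \<Rightarrow> (real ^ 'n \<Rightarrow> real) set" where
  "bandlimited p \<sigma> = {\<phi> \<in> Lp p \<inter> Lp 1.
     continuous_on UNIV \<phi> \<and> closure {x. fourier \<phi> x \<noteq> 0} \<subseteq> {x. \<forall>i. x $ i \<in> {-\<sigma>..\<sigma>}}}"


section \<open>Modulus of smoothness and averages\<close>

definition fin_diff :: "nat \<Rightarrow> real ^ 'n \<Rightarrow> (real ^ 'n \<Rightarrow> real) \<Rightarrow> real ^ 'n \<Rightarrow> real" where
  "fin_diff s h f x =
     (\<Sum>\<nu>=0..s. real (s choose \<nu>) * (-1) ^ \<nu> * f (x + real (s - \<nu>) *\<^sub>R h))"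

definition modulus :: "real \<Rightarrow> nat \<Rightarrow> (real ^ 'n \<Rightarrow> real) \<Rightarrow> real \<Rightarrow> ennreal" where
  "modulus p s f \<delta> = (SUP h\<in>{h. norm h < \<delta>}. Lp_norm p (fin_diff s h f))"

definition ball_avg :: "real \<Rightarrow> (real ^ 'n \<Rightarrow> real) \<Rightarrow> real ^ 'n \<Rightarrow> real" where
  "ball_avg \<delta> f x =
     1 / measure lebesgue (ball (0 :: real ^ 'n) \<delta>) * (LINT y:ball x \<delta>|lebesgue. f y)"

definition averaged :: "real \<Rightarrow> nat \<Rightarrow> (real ^ 'n \<Rightarrow> real) \<Rightarrow> real ^ 'n \<Rightarrow> real" where
  "averaged \<delta> r f x = - 2 / real ((2 * r) choose r) *
     (\<Sum>j=1..r. (-1) ^ j * real ((2 * r) choose (r - j)) * ball_avg (\<delta> * real j / real r) f x)"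


section \<open>Sampling operators\<close>

definition separated :: "real \<Rightarrow> (real \<Rightarrow> (real ^ 'n) set) \<Rightarrow> bool" where
  "separated \<gamma> X \<longleftrightarrow>
     (\<forall>\<sigma>>0. \<forall>\<xi>\<in>X \<sigma>. \<forall>\<xi>'\<in>X \<sigma>. \<xi> \<noteq> \<xi>' \<longrightarrow> norm (\<xi> - \<xi>') > 2 * \<gamma> / \<sigma>)"

text \<open>
  \<open>X \<sigma>\<close> is the set of sampling points and \<open>\<psi> \<sigma> \<xi>\<close> the kernel function belonging to \<open>\<xi> \<in> X \<sigma>\<close>.
\<close>

definition sampling_op ::
  "(real \<Rightarrow> (real ^ 'n) set) \<Rightarrow> (real \<Rightarrow> real ^ 'n \<Rightarrow> real ^ 'n \<Rightarrow> real) \<Rightarrow>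
   real \<Rightarrow> (real ^ 'n \<Rightarrow> real) \<Rightarrow> real ^ 'n \<Rightarrow> real" where
  "sampling_op X \<psi> \<sigma> f x = (\<Sum>\<^sub>\<infinity>\<xi>\<in>X \<sigma>. f \<xi> * \<psi> \<sigma> \<xi> x)"

text \<open>
  The meaningfulness of \<open>\<parallel>G\<^sub>\<sigma> f\<parallel>\<^sub>p\<close> for \<open>f \<in> L\<^sub>p \<inter> \<ell>\<^sub>p(X\<^sub>\<sigma>)\<close>: the series converges almost everywhere
  (unconditionally, as \<open>X\<^sub>\<sigma>\<close> is unordered) and its sum is in \<open>L\<^sub>p\<close>. This has to be said because
  \<^const>\<open>infsum\<close> is \<open>0\<close> where the series diverges.
\<close>

definition sampling_well_defined ::
  "real \<Rightarrow> (real \<Rightarrow> (real ^ 'n) set) \<Rightarrow> (real \<Rightarrow> real ^ 'n \<Rightarrow> real ^ 'n \<Rightarrow> real) \<Rightarrow> bool" where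
  "sampling_well_defined p X \<psi> \<longleftrightarrow>
     (\<forall>\<sigma>>0. \<forall>f \<in> Lp p \<inter> lp p \<sigma> (X \<sigma>).
        (AE x in lebesgue. (\<lambda>\<xi>. f \<xi> * \<psi> \<sigma> \<xi> x) summable_on X \<sigma>) \<and>
        sampling_op X \<psi> \<sigma> f \<in> Lp p)"

definition sampling_A1 ::
  "real \<Rightarrow> (real \<Rightarrow> (real ^ 'n) set) \<Rightarrow> (real \<Rightarrow> real ^ 'n \<Rightarrow> real ^ 'n \<Rightarrow> real) \<Rightarrow> real \<Rightarrow> bool" where
  "sampling_A1 p X \<psi> \<kappa>\<^sub>1 \<longleftrightarrow>
     (\<forall>\<sigma>>0. \<forall>f \<in> Lp p \<inter> lp p \<sigma> (X \<sigma>).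
        Lp_norm p (sampling_op X \<psi> \<sigma> f) \<le> ennreal \<kappa>\<^sub>1 * lp_norm p \<sigma> (X \<sigma>) f)"

definition sampling_A2 ::
  "real \<Rightarrow> (real \<Rightarrow> (real ^ 'n) set) \<Rightarrow> (real \<Rightarrow> real ^ 'n \<Rightarrow> real ^ 'n \<Rightarrow> real) \<Rightarrow> real \<Rightarrow> bool" where
  "sampling_A2 p X \<psi> \<kappa>\<^sub>2 \<longleftrightarrow>
     (\<forall>\<sigma>>0. \<forall>f \<in> Lp p \<inter> lp p \<sigma> (X \<sigma>).
        ennreal \<kappa>\<^sub>2 * lp_norm p \<sigma> (X \<sigma>) f \<le> Lp_norm p (sampling_op X \<psi> \<sigma> f))"

definition sampling_A3 ::
  "real \<Rightarrow> nat \<Rightarrow> (real \<Rightarrow> (real ^ 'n) set) \<Rightarrow> (real \<Rightarrow> real ^ 'n \<Rightarrow> real ^ 'n \<Rightarrow> real) \<Rightarrow>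
   real \<Rightarrow> bool" where
  "sampling_A3 p s X \<psi> \<kappa>\<^sub>3 \<longleftrightarrow>
     (\<exists>l\<in>{0<..1}. \<forall>\<sigma>>0. \<forall>g \<in> bandlimited p (l * \<sigma>).
        Lp_norm p (\<lambda>x. g x - sampling_op X \<psi> \<sigma> g x)
          \<le> ennreal (\<kappa>\<^sub>3 * (1 / \<sigma> ^ s)) * sobolev_seminorm p s g)"

end

theory Submission
  imports Defs "HOL-Probability.Probability" "HOL-Complex_Analysis.Complex_Analysis"
begin

text \<open>
  Write \<open>F\<^sup>*\<close> for the average \<open>F\<^sub>\<delta>\<^sub>,\<^sub>r\<close> with \<open>\<delta> = \<gamma>/\<sigma>\<close>, and \<open>\<omega> = \<omega>\<^sub>s(f, 1/\<sigma>)\<^sub>p\<close>. Everything rests on a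
  band-limited \<open>g\<close> with \<open>\<parallel>f - g\<parallel>\<^sub>p \<lesssim> \<omega>\<close>, \<open>|g|\<^sub>W \<lesssim> \<sigma>\<^sup>s \<omega>\<close> and \<open>\<parallel>g\<^sup>* - g\<parallel> \<lesssim> \<omega>\<close> in \<open>\<ell>\<^sub>p(X\<^sub>\<sigma>)\<close>.
  Given such a \<open>g\<close>, split \<open>f - G f = (f - g) + (g - G g) + G (g - f)\<close>; on the sampling points
  \<open>g - f = (f\<^sup>* - f) - (f - g)\<^sup>* - (g\<^sup>* - g)\<close>, where \<open>(f - g)\<^sup>*\<close> is controlled by \<open>\<parallel>f - g\<parallel>\<^sub>p\<close> because
  the balls of radius \<open>\<delta>\<close> about the sampling points are disjoint.

  To obtain \<open>g\<close>, apply twice an operator \<open>F \<mapsto> \<Sum>\<^sub>k (-1)\<^sup>k\<^sup>+\<^sup>1 (s choose k) \<integral> F(x + k h w) dP(w)\<close>, which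
  differs from the identity by \<open>(-1)\<^sup>s \<integral> \<Delta>\<^sup>s\<^sub>h\<^sub>w F dP(w)\<close>. The first \<open>P\<close> has a density with compactly
  supported Fourier transform. The second is the law of \<open>u + \<Sum>\<^sub>j t\<^sub>j e\<^sub>j\<close> with \<open>u\<close> uniform in the unit ball,
  \<open>t\<^sub>j\<close> uniform in \<open>[0, 1]\<close> and each coordinate vector occurring \<open>s\<close> times among the \<open>e\<^sub>j\<close>: averaging over
  \<open>u\<close> bounds samples by \<open>L\<^sub>p\<close> norms, averaging over \<open>t\<^sub>j\<close> turns derivatives into difference quotients.
  Band-limited functions must be integrable, so \<open>f\<close> is first cut off to a ball, at the cost of an
  arbitrarily small error.
\<close>

section \<open>Norms on a measure space\<close>

text \<open>The second operator does the work of inequalities of Bernstein and Plancherel-Polya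
  type, which bound derivatives and samples of a band-limited function. It can, because averages
  multiply Fourier transforms, hence keep the band created by the first operator, and commute with
  differences, hence keep the modulus up to a factor \<open>2 ^ s\<close>. Two obstacles shape the
  argument. Derivatives turn into differences with several distinct steps, while the modulus only
  knows one repeated step; an identity of Kemperman expresses the former by the latter. And a
  density with compactly supported Fourier transform has unbounded support, so steps longer than
  \<open>1 / \<sigma>\<close> occur; they cost a factor growing like the \<open>s\<close>-th power
  of their length, which decides how many moments the density must have. All scales are fixed
  multiples of \<open>1 / \<sigma>\<close>, so that powers of \<open>\<sigma>\<close> cancel. The
  values of \<open>f\<close> at sampling points enter the estimates only through the average minus
  \<open>f\<close>. The condition \<open>s \<le> 2 * r\<close> enters since, for \<open>g\<close>,
  the average minus the function is an integral of differences of order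
  \<open>2 * r\<close>.\<close>

lemma enn_root_le_iff:
  assumes "0 < p" "0 \<le> c"
  shows "enn_root p a \<le> ennreal c \<longleftrightarrow> a \<le> ennreal (c powr p)"
proof (cases a)
  case (real x)
  have "x powr (1 / p) \<le> c \<longleftrightarrow> x \<le> c powr p"
  proof
    assume "x powr (1 / p) \<le> c"
    then have "(x powr (1 / p)) powr p \<le> c powr p"
      using assms by (intro powr_mono2) auto
    then show "x \<le> c powr p" using assms real by (simp add: powr_powr)
  next
    assume "x \<le> c powr p"
    then have "x powr (1 / p) \<le> (c powr p) powr (1 / p)"
      using assms real by (intro powr_mono2) auto
    then show "x powr (1 / p) \<le> c" using assms by (simp add: powr_powr)
  qed
  then show ?thesis using real assms by (simp add: enn_root_def ennreal_le_iff)
next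
  case top
  then show ?thesis using assms by (auto simp: enn_root_def top_unique)
qed

lemma enn_root_top_iff: "enn_root p a < \<infinity> \<longleftrightarrow> a < \<infinity>"
  by (auto simp: enn_root_def less_top)

lemma ennreal_le_real_boundI:
  fixes a b :: ennreal
  assumes "\<And>c. 0 \<le> c \<Longrightarrow> b \<le> ennreal c \<Longrightarrow> a \<le> ennreal c"
  shows "a \<le> b"
proof (cases b)
  case (real r)
  then show ?thesis using assms by auto
qed auto

lemma enn_root_mono: "0 < p \<Longrightarrow> a \<le> b \<Longrightarrow> enn_root p a \<le> enn_root p b"
  by (rule ennreal_le_real_boundI) (auto simp: enn_root_le_iff intro: order_trans)

text \<open>The measure is a parameter so that the same inequalities serve Lebesgue measure and the
  weighted counting measure on sampling points.\<close>

definition nrm :: "real \<Rightarrow> 'a measure \<Rightarrow> ('a \<Rightarrow> real) \<Rightarrow> ennreal" where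
  "nrm p M f = enn_root p (\<integral>\<^sup>+ x. ennreal (\<bar>f x\<bar> powr p) \<partial>M)"

text \<open>Most estimates below compare a norm with a real bound: the root then disappears and only
  an integral of \<open>p\<close>-th powers is left to estimate.\<close>

lemma nrm_le_iff:
  assumes "0 < p" "0 \<le> c"
  shows "nrm p M f \<le> ennreal c \<longleftrightarrow> (\<integral>\<^sup>+ x. ennreal (\<bar>f x\<bar> powr p) \<partial>M) \<le> ennreal (c powr p)"
  unfolding nrm_def by (rule enn_root_le_iff[OF assms])

text \<open>\<open>powr_convex\<close> covers positive arguments. A zero endpoint is settled by
  \<open>u powr p \<le> u\<close> for \<open>0 < u < 1\<close>, signed arguments by the triangle
  inequality.\<close>

lemma convex_on_abs_powr:
  assumes p: "1 \<le> p"
  shows "convex_on UNIV (\<lambda>x::real. \<bar>x\<bar> powr p)"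
proof (rule convex_onI)
  fix t x y :: real
  assume t: "0 < t" "t < 1"
  have small: "(u * z) powr p \<le> u * z powr p" if "0 < u" "u < 1" "0 \<le> z" for u z :: real
  proof -
    have "u powr p \<le> u powr 1" using that p by (intro powr_mono') auto
    then show ?thesis using that by (simp add: powr_mult mult_right_mono)
  qed
  have pos: "((1 - t) * a + t * b) powr p \<le> (1 - t) * a powr p + t * b powr p"
    if "0 \<le> a" "0 \<le> b" for a b
  proof (cases "a = 0 \<or> b = 0")
    case True
    then show ?thesis using small[of t b] small[of "1 - t" a] t that p by auto
  next
    case False
    then have "a \<in> {0<..}" "b \<in> {0<..}" using that by auto
    then show ?thesis using convex_onD[OF powr_convex[OF p], of t a b] t by simp
  qed
  have "\<bar>(1 - t) *\<^sub>R x + t *\<^sub>R y\<bar> \<le> (1 - t) * \<bar>x\<bar> + t * \<bar>y\<bar>"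
    using t abs_triangle_ineq[of "(1 - t) * x" "t * y"] by (simp add: abs_mult)
  then have "\<bar>(1 - t) *\<^sub>R x + t *\<^sub>R y\<bar> powr p \<le> ((1 - t) * \<bar>x\<bar> + t * \<bar>y\<bar>) powr p"
    using p by (intro powr_mono2) auto
  also have "\<dots> \<le> (1 - t) * \<bar>x\<bar> powr p + t * \<bar>y\<bar> powr p" by (rule pos) auto
  finally show "\<bar>(1 - t) *\<^sub>R x + t *\<^sub>R y\<bar> powr p \<le> (1 - t) * \<bar>x\<bar> powr p + t * \<bar>y\<bar> powr p" .
qed auto

text \<open>Minkowski's inequality from convexity: \<open>u + v\<close> is \<open>a + b\<close>
  times the convex combination of \<open>u / a\<close> and \<open>v / b\<close> with weights
  \<open>a / (a + b)\<close> and \<open>b / (a + b)\<close>. The bounds are divided by and hence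
  positive; \<open>nrm_add\<close> enlarges both norms by \<open>e / 2\<close> to achieve
  this.\<close>

lemma nrm_add_real:
  assumes p: "1 \<le> p" and [measurable]: "f \<in> borel_measurable M" "g \<in> borel_measurable M"
    and a: "0 < a" "nrm p M f \<le> ennreal a" and b: "0 < b" "nrm p M g \<le> ennreal b"
  shows "nrm p M (\<lambda>x. f x + g x) \<le> ennreal (a + b)"
proof -
  define t where "t = b / (a + b)"
  have t: "0 < t" "t < 1" "1 - t = a / (a + b)" using a b by (auto simp: t_def field_simps)
  define A B where "A = (a + b) powr p * ((1 - t) / a powr p)" and "B = (a + b) powr p * (t / b powr p)"
  have pw: "\<bar>u + v\<bar> powr p \<le> A * \<bar>u\<bar> powr p
      + B * \<bar>v\<bar> powr p" for u v :: real
  proof -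
    have eq: "u + v = (a + b) * ((1 - t) * (u / a) + t * (v / b))"
    proof -
      have "(a + b) * (1 - t) = a" "(a + b) * t = b" using a b by (auto simp: t(3), auto simp: t_def)
      then have "(a + b) * ((1 - t) * (u / a) + t * (v / b)) = a * (u / a) + b * (v / b)"
        by (metis distrib_left mult.assoc)
      then show ?thesis using a b by simp
    qed
    have "\<bar>(1 - t) * (u / a) + t * (v / b)\<bar> powr p \<le> (1 - t) * \<bar>u / a\<bar> powr p + t * \<bar>v / b\<bar> powr p"
      using convex_onD[OF convex_on_abs_powr[OF p], of t "u / a" "v / b"] t by simp
    moreover have "\<bar>u + v\<bar> powr p = (a + b) powr p * \<bar>(1 - t) * (u / a) + t * (v / b)\<bar> powr p"
      unfolding eq abs_mult using a b by (simp add: powr_mult)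
    ultimately have "\<bar>u + v\<bar> powr p \<le> (a + b) powr p * ((1 - t) * \<bar>u / a\<bar> powr p + t * \<bar>v / b\<bar> powr p)"
      by (simp add: mult_left_mono)
    then show ?thesis using a b by (simp add: powr_divide field_simps A_def B_def)
  qed
  have nn: "0 \<le> A" "0 \<le> B" using t(1,2) by (auto simp: A_def B_def)
  have "(\<integral>\<^sup>+ x. ennreal (\<bar>f x + g x\<bar> powr p) \<partial>M)
      \<le> (\<integral>\<^sup>+ x. ennreal A * ennreal (\<bar>f x\<bar> powr p) + ennreal B * ennreal (\<bar>g x\<bar> powr p) \<partial>M)"
    using pw nn by (intro nn_integral_mono) (simp flip: ennreal_mult ennreal_plus add: ennreal_leI)
  also have "\<dots> = ennreal A * (\<integral>\<^sup>+ x. ennreal (\<bar>f x\<bar> powr p) \<partial>M)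
      + ennreal B * (\<integral>\<^sup>+ x. ennreal (\<bar>g x\<bar> powr p) \<partial>M)"
    by (simp add: nn_integral_add nn_integral_cmult)
  also have "\<dots> \<le> ennreal A * ennreal (a powr p) + ennreal B * ennreal (b powr p)"
    using a b p by (intro add_mono mult_left_mono) (auto simp: nrm_le_iff)
  also have "\<dots> = ennreal (A * a powr p + B * b powr p)"
    using nn by (simp flip: ennreal_mult ennreal_plus)
  also have "A * a powr p + B * b powr p = (a + b) powr p"
    using a b by (simp add: A_def B_def distrib_left[symmetric])
  finally show ?thesis using p a b by (subst nrm_le_iff) auto
qed

lemma nrm_add:
  assumes p: "1 \<le> p" and [measurable]: "f \<in> borel_measurable M" "g \<in> borel_measurable M"
  shows "nrm p M (\<lambda>x. f x + g x) \<le> nrm p M f + nrm p M g"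
proof (cases "nrm p M f = \<infinity> \<or> nrm p M g = \<infinity>")
  case False
  then obtain a b where ab: "0 \<le> a" "nrm p M f = ennreal a" "0 \<le> b" "nrm p M g = ennreal b"
    by (metis ennreal_cases infinity_ennreal_def)
  show ?thesis
  proof (rule ennreal_le_epsilon)
    fix e :: real assume e: "0 < e"
    have "nrm p M (\<lambda>x. f x + g x) \<le> ennreal ((a + e / 2) + (b + e / 2))"
      using ab e by (intro nrm_add_real[OF p]) (auto intro: ennreal_leI)
    also have "\<dots> = nrm p M f + nrm p M g + ennreal e"
      using ab e by (simp add: ennreal_plus[symmetric] del: ennreal_plus)
    finally show "nrm p M (\<lambda>x. f x + g x) \<le> nrm p M f + nrm p M g + ennreal e" .
  qed
qed auto

lemma nrm_cong: "(\<And>x. x \<in> space M \<Longrightarrow> \<bar>f x\<bar> = \<bar>g x\<bar>) \<Longrightarrow> nrm p M f = nrm p M g"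
  unfolding nrm_def by (metis (no_types, lifting) nn_integral_cong)

lemma nrm_cong_AE: "AE x in M. \<bar>f x\<bar> = \<bar>g x\<bar> \<Longrightarrow> nrm p M f = nrm p M g"
  unfolding nrm_def by (subst nn_integral_cong_AE[of _ "\<lambda>x. ennreal (\<bar>g x\<bar> powr p)"]) auto

lemma nrm_cmult:
  assumes p: "0 < p" and [measurable]: "f \<in> borel_measurable M"
  shows "nrm p M (\<lambda>x. c * f x) = ennreal \<bar>c\<bar> * nrm p M f"
proof -
  have "(\<integral>\<^sup>+ x. ennreal (\<bar>c * f x\<bar> powr p) \<partial>M)
     = ennreal (\<bar>c\<bar> powr p) * (\<integral>\<^sup>+ x. ennreal (\<bar>f x\<bar> powr p) \<partial>M)"
    by (simp add: abs_mult powr_mult ennreal_mult nn_integral_cmult)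
  moreover have "enn_root p (ennreal (b powr p) * a) = ennreal b * enn_root p a" if "0 \<le> b" for a b
  proof (cases "b = 0")
    case True
    then show ?thesis using p by (simp add: enn_root_def)
  next
    case False
    then have b: "0 < b" using that by simp
    show ?thesis
    proof (cases a)
      case (real x)
      then show ?thesis using b p
        by (simp add: enn_root_def powr_mult powr_powr ennreal_mult flip: ennreal_mult)
    next
      case top
      then show ?thesis using b p by (simp add: enn_root_def ennreal_mult_top)
    qed
  qed
  ultimately show ?thesis unfolding nrm_def by simp
qed

lemma nrm_zero [simp]: "0 < p \<Longrightarrow> nrm p M (\<lambda>x. 0) = 0"
  by (simp add: nrm_def enn_root_def)

lemma nrm_minus [simp]: "nrm p M (\<lambda>x. - f x) = nrm p M f"
  by (simp add: nrm_def)

lemma nrm_diff: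
  assumes p: "1 \<le> p" and [measurable]: "f \<in> borel_measurable M" "g \<in> borel_measurable M"
  shows "nrm p M (\<lambda>x. f x - g x) \<le> nrm p M f + nrm p M g"
  using nrm_add[OF p, of f M "\<lambda>x. - g x"] by simp

lemma nrm_sum:
  assumes p: "1 \<le> p" and "\<And>i. i \<in> I \<Longrightarrow> f i \<in> borel_measurable M"
  shows "nrm p M (\<lambda>x. \<Sum>i\<in>I. f i x) \<le> (\<Sum>i\<in>I. nrm p M (f i))"
  using assms(2)
proof (induction I rule: infinite_finite_induct)
  case (insert i I)
  then have "nrm p M (\<lambda>x. f i x + (\<Sum>i\<in>I. f i x)) \<le> nrm p M (f i) + nrm p M (\<lambda>x. \<Sum>i\<in>I. f i x)"
    by (intro nrm_add[OF p]) auto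
  also have "\<dots> \<le> nrm p M (f i) + (\<Sum>i\<in>I. nrm p M (f i))"
    using insert by (intro add_left_mono) auto
  finally show ?case using insert by simp
qed (use p in auto)

lemma nrm_sum_le:
  assumes p: "1 \<le> p" and "\<And>i. i \<in> I \<Longrightarrow> f i \<in> borel_measurable M"
    and "\<And>i. i \<in> I \<Longrightarrow> nrm p M (f i) \<le> ennreal (w i)" "\<And>i. i \<in> I \<Longrightarrow> 0 \<le> w i"
  shows "nrm p M (\<lambda>x. \<Sum>i\<in>I. f i x) \<le> ennreal (\<Sum>i\<in>I. w i)"
proof -
  have "nrm p M (\<lambda>x. \<Sum>i\<in>I. f i x) \<le> (\<Sum>i\<in>I. nrm p M (f i))" using assms by (intro nrm_sum) auto
  also have "\<dots> \<le> (\<Sum>i\<in>I. ennreal (w i))" using assms by (intro sum_mono) auto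
  also have "\<dots> = ennreal (\<Sum>i\<in>I. w i)" using assms by (intro sum_ennreal) auto
  finally show ?thesis .
qed

lemma nrm_cmult_le:
  assumes p: "1 \<le> p" and "f \<in> borel_measurable M" "nrm p M f \<le> ennreal w"
  shows "nrm p M (\<lambda>x. c * f x) \<le> ennreal (\<bar>c\<bar> * w)"
proof -
  have "nrm p M (\<lambda>x. c * f x) \<le> ennreal \<bar>c\<bar> * ennreal w"
    using assms by (subst nrm_cmult) (auto intro: mult_left_mono)
  then show ?thesis by (simp add: ennreal_mult')
qed

text \<open>Jensen's inequality. If \<open>h\<close> is not integrable, the Bochner integral has the
  default value 0; if the right-hand side is infinite, there is nothing to show.\<close>

lemma (in prob_space) abs_integral_powr_le:
  fixes h :: "'a \<Rightarrow> real"
  assumes p: "1 \<le> p" and [measurable]: "h \<in> borel_measurable M"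
  shows "ennreal (\<bar>\<integral>x. h x \<partial>M\<bar> powr p) \<le> (\<integral>\<^sup>+ x. ennreal (\<bar>h x\<bar> powr p) \<partial>M)"
proof (cases "integrable M h \<and> (\<integral>\<^sup>+ x. ennreal (\<bar>h x\<bar> powr p) \<partial>M) < \<infinity>")
  case True
  then have i: "integrable M (\<lambda>x. \<bar>h x\<bar> powr p)" by (intro integrableI_nonneg) auto
  have "\<bar>expectation h\<bar> powr p \<le> expectation (\<lambda>x. \<bar>h x\<bar> powr p)"
    using True i convex_on_abs_powr[OF p] by (intro jensens_inequality[where I=UNIV]) auto
  then show ?thesis using i by (subst nn_integral_eq_integral) (auto intro: ennreal_leI)
next
  case False
  then show ?thesis using p by (auto simp: not_integrable_integral_eq not_less top_unique)
qed

text \<open>Stands in for Minkowski's integral inequality: Jensen in \<open>u\<close>, then Tonelli.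
  The outcome is the \<open>p\<close>-th power mean of the bounds \<open>w u\<close> instead of
  their mean, which is good enough for constants that need not be sharp.\<close>

lemma nrm_integral_le:
  assumes p: "1 \<le> p" and P: "prob_space P" and M: "sigma_finite_measure M"
    and [measurable]: "case_prod H \<in> borel_measurable (M \<Otimes>\<^sub>M P)"
    and w: "\<And>u. u \<in> space P \<Longrightarrow> 0 \<le> w u" "AE u in P. nrm p M (\<lambda>x. H x u) \<le> ennreal (w u)"
    and c: "0 \<le> c" "(\<integral>\<^sup>+ u. ennreal (w u powr p) \<partial>P) \<le> ennreal (c powr p)"
  shows "nrm p M (\<lambda>x. \<integral>u. H x u \<partial>P) \<le> ennreal c"
proof -
  interpret P: prob_space P by fact
  interpret M: sigma_finite_measure M by fact
  interpret PM: pair_sigma_finite M P ..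
  have "(\<integral>\<^sup>+ x. ennreal (\<bar>\<integral>u. H x u \<partial>P\<bar> powr p) \<partial>M)
      \<le> (\<integral>\<^sup>+ x. (\<integral>\<^sup>+ u. ennreal (\<bar>H x u\<bar> powr p) \<partial>P) \<partial>M)"
    by (intro nn_integral_mono P.abs_integral_powr_le[OF p]) auto
  also have "\<dots> = (\<integral>\<^sup>+ u. (\<integral>\<^sup>+ x. ennreal (\<bar>H x u\<bar> powr p) \<partial>M) \<partial>P)"
    using PM.Fubini[of "\<lambda>(x, u). ennreal (\<bar>H x u\<bar> powr p)"] by simp
  also have "\<dots> \<le> (\<integral>\<^sup>+ u. ennreal (w u powr p) \<partial>P)"
    using w p by (intro nn_integral_mono_AE) (auto simp: nrm_le_iff)
  also have "\<dots> \<le> ennreal (c powr p)" by fact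
  finally show ?thesis using p c by (subst nrm_le_iff) auto
qed

section \<open>Translations and finite differences\<close>

lemma
  fixes f :: "'a::euclidean_space \<Rightarrow> 'b::{banach, second_countable_topology}"
  assumes c: "c \<noteq> 0" and [measurable]: "f \<in> borel_measurable borel"
  shows integral_lborel_affine: "\<bar>c\<bar> ^ DIM('a) *\<^sub>R (\<integral>x. f (t + c *\<^sub>R x) \<partial>lborel) = (\<integral>x. f x \<partial>lborel)"
    and integrable_lborel_affine: "integrable lborel f \<Longrightarrow> integrable lborel (\<lambda>x. f (t + c *\<^sub>R x))"
proof -
  have "(\<integral>x. f x \<partial>lborel) = (\<integral>x. f x \<partial>density (distr lborel borel (\<lambda>x. t + c *\<^sub>R x)) (\<lambda>_. ennreal (\<bar>c\<bar> ^ DIM('a))))"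
    by (subst lborel_affine[OF c, of t]) simp
  also have "\<dots> = \<bar>c\<bar> ^ DIM('a) *\<^sub>R (\<integral>x. f (t + c *\<^sub>R x) \<partial>lborel)"
    by (subst integral_density) (simp_all add: integral_distr)
  finally show "\<bar>c\<bar> ^ DIM('a) *\<^sub>R (\<integral>x. f (t + c *\<^sub>R x) \<partial>lborel) = (\<integral>x. f x \<partial>lborel)" by simp
  assume "integrable lborel f"
  then have "integrable (density (distr lborel borel (\<lambda>x. t + c *\<^sub>R x)) (\<lambda>_. ennreal (\<bar>c\<bar> ^ DIM('a)))) f"
    by (subst (asm) lborel_affine[OF c, of t]) simp
  then have i: "integrable lborel (\<lambda>x. \<bar>c\<bar> ^ DIM('a) *\<^sub>R f (t + c *\<^sub>R x))"
    by (subst (asm) integrable_density) (simp_all add: integrable_distr_eq)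
  have "integrable lborel (\<lambda>x. (1 / \<bar>c\<bar> ^ DIM('a)) *\<^sub>R (\<bar>c\<bar> ^ DIM('a) *\<^sub>R f (t + c *\<^sub>R x)))"
    by (rule integrable_scaleR_right) (rule i)
  moreover have "1 / \<bar>c\<bar> ^ DIM('a) * \<bar>c\<bar> ^ DIM('a) = 1" using c by simp
  ultimately show "integrable lborel (\<lambda>x. f (t + c *\<^sub>R x))" by (simp only: scaleR_scaleR scaleR_one)
qed

lemma nn_integral_lborel_affine:
  fixes f :: "'a::euclidean_space \<Rightarrow> ennreal"
  assumes c: "c \<noteq> 0" and [measurable]: "f \<in> borel_measurable borel"
  shows "ennreal (\<bar>c\<bar> ^ DIM('a)) * (\<integral>\<^sup>+x. f (t + c *\<^sub>R x) \<partial>lborel) = (\<integral>\<^sup>+x. f x \<partial>lborel)"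
proof -
  have "(\<integral>\<^sup>+x. f x \<partial>lborel) = (\<integral>\<^sup>+x. f x \<partial>density (distr lborel borel (\<lambda>x. t + c *\<^sub>R x)) (\<lambda>_. ennreal (\<bar>c\<bar> ^ DIM('a))))"
    by (subst lborel_affine[OF c, of t]) simp
  also have "\<dots> = ennreal (\<bar>c\<bar> ^ DIM('a)) * (\<integral>\<^sup>+x. f (t + c *\<^sub>R x) \<partial>lborel)"
    by (simp add: nn_integral_density nn_integral_distr nn_integral_cmult)
  finally show ?thesis by simp
qed

lemma integral_lborel_translate:
  fixes f :: "'a::euclidean_space \<Rightarrow> 'b::{banach, second_countable_topology}"
  assumes "f \<in> borel_measurable borel"
  shows "(\<integral>x. f (x + v) \<partial>lborel) = (\<integral>x. f x \<partial>lborel)"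
  using integral_lborel_affine[of 1 f v] assms by (simp add: add.commute)

lemma nn_integral_lborel_translate:
  fixes f :: "'a::euclidean_space \<Rightarrow> ennreal"
  assumes "f \<in> borel_measurable borel"
  shows "(\<integral>\<^sup>+x. f (x + v) \<partial>lborel) = (\<integral>\<^sup>+x. f x \<partial>lborel)"
  using nn_integral_lborel_affine[of 1 f v] assms by (simp add: add.commute)

lemma nrm_translate:
  fixes f :: "'a::euclidean_space \<Rightarrow> real"
  assumes [measurable]: "f \<in> borel_measurable borel"
  shows "nrm p lborel (\<lambda>x. f (x + v)) = nrm p lborel f"
  unfolding nrm_def by (subst nn_integral_lborel_translate[of "\<lambda>x. ennreal (\<bar>f x\<bar> powr p)"]) auto

text \<open>A single step, so that differences with equal steps (\<open>fin_diff\<close>) and with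
  varying steps (\<open>mixed_diff\<close>) arise by iteration and inherit commutation rules by
  induction.\<close>

definition dif :: "'a::real_vector \<Rightarrow> ('a \<Rightarrow> real) \<Rightarrow> 'a \<Rightarrow> real" where
  "dif h f x = f (x + h) - f x"

lemma borel_measurable_dif [measurable]:
  fixes f :: "'a::euclidean_space \<Rightarrow> real"
  assumes [measurable]: "f \<in> borel_measurable borel"
  shows "dif h f \<in> borel_measurable borel"
  unfolding dif_def by measurable

lemma borel_measurable_dif_funpow [measurable]:
  fixes f :: "'a::euclidean_space \<Rightarrow> real"
  assumes [measurable]: "f \<in> borel_measurable borel"
  shows "(dif h ^^ n) f \<in> borel_measurable borel"
  by (induction n) auto

lemma borel_measurable_fin_diff [measurable]:
  assumes [measurable]: "f \<in> borel_measurable borel"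
  shows "fin_diff s h f \<in> borel_measurable borel"
  unfolding fin_diff_def by measurable

lemma dif_commute: "dif u (dif v f) = dif v (dif u f)"
  by (auto simp: dif_def add_ac)

lemma dif_funpow_commute: "dif u ((dif v ^^ n) f) = (dif v ^^ n) (dif u f)"
  by (induction n) (auto simp: dif_commute[of u v])

lemma fin_diff_Suc: "fin_diff (Suc s) h f x = fin_diff s h f (x + h) - fin_diff s h f x"
proof -
  define a where "a \<nu> = (-1) ^ \<nu> * f (x + real (Suc s - \<nu>) *\<^sub>R h)" for \<nu>
  have e1: "fin_diff s h f (x + h) = (\<Sum>\<nu>=0..s. real (s choose \<nu>) * a \<nu>)"
    unfolding fin_diff_def
  proof (intro sum.cong refl)
    fix \<nu> assume "\<nu> \<in> {0..s}"
    then have "real (Suc s - \<nu>) = 1 + real (s - \<nu>)" by auto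
    then have "x + h + real (s - \<nu>) *\<^sub>R h = x + real (Suc s - \<nu>) *\<^sub>R h"
      by (simp add: scaleR_left.add)
    then show "real (s choose \<nu>) * (- 1) ^ \<nu> * f (x + h + real (s - \<nu>) *\<^sub>R h) = real (s choose \<nu>) * a \<nu>"
      unfolding a_def by (simp only: mult.assoc)
  qed
  have e2: "- fin_diff s h f x = (\<Sum>\<nu>=0..s. real (s choose \<nu>) * a (Suc \<nu>))"
    unfolding fin_diff_def a_def by (simp add: sum_negf[symmetric] mult_ac)
  have e3: "(\<Sum>\<nu>=0..s. real (s choose \<nu>) * a \<nu>) = a 0 + (\<Sum>\<nu>=0..s. real (s choose Suc \<nu>) * a (Suc \<nu>))"
  proof -
    have "(\<Sum>\<nu>=0..s. real (s choose \<nu>) * a \<nu>) = (\<Sum>\<nu>=0..Suc s. real (s choose \<nu>) * a \<nu>)" by simp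
    also have "\<dots> = a 0 + (\<Sum>\<nu>=0..s. real (s choose Suc \<nu>) * a (Suc \<nu>))"
      by (subst sum.atLeast0_atMost_Suc_shift) simp
    finally show ?thesis .
  qed
  have "fin_diff (Suc s) h f x = (\<Sum>\<nu>=0..Suc s. real (Suc s choose \<nu>) * a \<nu>)"
    unfolding fin_diff_def a_def by (simp add: mult_ac)
  also have "\<dots> = a 0 + (\<Sum>\<nu>=0..s. real (Suc s choose Suc \<nu>) * a (Suc \<nu>))"
    by (subst sum.atLeast0_atMost_Suc_shift) simp
  also have "\<dots> = (a 0 + (\<Sum>\<nu>=0..s. real (s choose Suc \<nu>) * a (Suc \<nu>))) + (\<Sum>\<nu>=0..s. real (s choose \<nu>) * a (Suc \<nu>))"
    by (simp add: sum.distrib[symmetric] distrib_right add_ac)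
  finally show ?thesis unfolding e1 e3[symmetric] e2[symmetric] by simp
qed

lemma fin_diff_eq_funpow: "fin_diff s h f = (dif h ^^ s) f"
proof (induction s)
  case 0
  then show ?case by (simp add: fin_diff_def fun_eq_iff)
next
  case (Suc s)
  then show ?case by (simp add: fun_eq_iff fin_diff_Suc dif_def)
qed

lemma nrm_dif_le:
  fixes f :: "'a::euclidean_space \<Rightarrow> real"
  assumes p: "1 \<le> p" and [measurable]: "f \<in> borel_measurable borel" and w: "nrm p lborel f \<le> ennreal w" "0 \<le> w"
  shows "nrm p lborel (dif h f) \<le> ennreal (2 * w)"
proof -
  have "nrm p lborel (dif h f) \<le> nrm p lborel (\<lambda>x. f (x + h)) + nrm p lborel f"
    unfolding dif_def by (rule nrm_diff[OF p]) auto
  also have "\<dots> \<le> ennreal w + ennreal w"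
    using w by (intro add_mono) (auto simp: nrm_translate)
  also have "\<dots> = ennreal (2 * w)" using w by (simp flip: ennreal_plus)
  finally show ?thesis .
qed

text \<open>Each further difference costs a factor 2. This serves to raise the order from
  \<open>s\<close> to \<open>2 * r\<close>, which is where \<open>s \<le> 2 * r\<close> enters, and,
  from order 0, to bound a difference by the norm.\<close>

lemma nrm_fin_diff_add_le:
  assumes p: "1 \<le> p" and [measurable]: "f \<in> borel_measurable borel"
    and w: "nrm p lborel (fin_diff s h f) \<le> ennreal w" "0 \<le> w"
  shows "nrm p lborel (fin_diff (n + s) h f) \<le> ennreal (2 ^ n * w)"
proof (induction n)
  case (Suc n)
  then show ?case
    using nrm_dif_le[OF p, of "fin_diff (n + s) h f" "2 ^ n * w" h] w
    by (simp add: fin_diff_eq_funpow mult_ac)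
qed (use w in auto)

lemma dif_of_nat: "dif (real n *\<^sub>R h) f x = (\<Sum>j<n. dif h f (x + real j *\<^sub>R h))"
proof (induction n)
  case (Suc n)
  have "dif (real (Suc n) *\<^sub>R h) f x = dif (real n *\<^sub>R h) f x + dif h f (x + real n *\<^sub>R h)"
    by (simp add: dif_def scaleR_left.add add_ac)
  then show ?case using Suc by simp
qed (simp add: dif_def)

lemma nrm_dif_of_nat_le:
  fixes f :: "'a::euclidean_space \<Rightarrow> real"
  assumes p: "1 \<le> p" and [measurable]: "f \<in> borel_measurable borel"
  shows "nrm p lborel (dif (real n *\<^sub>R h) f) \<le> ennreal (real n) * nrm p lborel (dif h f)"
proof -
  have "nrm p lborel (dif (real n *\<^sub>R h) f) = nrm p lborel (\<lambda>x. \<Sum>j<n. dif h f (x + real j *\<^sub>R h))"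
    by (simp add: dif_of_nat[abs_def])
  also have "\<dots> \<le> (\<Sum>j<n. nrm p lborel (\<lambda>x. dif h f (x + real j *\<^sub>R h)))"
    by (rule nrm_sum[OF p]) auto
  also have "\<dots> = ennreal (real n) * nrm p lborel (dif h f)"
    by (simp add: nrm_translate ennreal_of_nat_eq_real_of_nat)
  finally show ?thesis .
qed

lemma nrm_fin_diff_of_nat_le:
  assumes p: "1 \<le> p" and "f \<in> borel_measurable borel"
  shows "nrm p lborel (fin_diff s (real n *\<^sub>R h) f) \<le> ennreal (real n ^ s) * nrm p lborel (fin_diff s h f)"
  using assms(2)
proof (induction s arbitrary: f)
  case 0
  then show ?case by (simp add: fin_diff_eq_funpow)
next
  case (Suc s)
  note [measurable] = \<open>f \<in> borel_measurable borel\<close>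
  have "nrm p lborel (fin_diff (Suc s) (real n *\<^sub>R h) f) = nrm p lborel (fin_diff s (real n *\<^sub>R h) (dif (real n *\<^sub>R h) f))"
    by (simp add: fin_diff_eq_funpow dif_funpow_commute)
  also have "\<dots> \<le> ennreal (real n ^ s) * nrm p lborel (fin_diff s h (dif (real n *\<^sub>R h) f))"
    by (rule Suc.IH) auto
  also have "fin_diff s h (dif (real n *\<^sub>R h) f) = dif (real n *\<^sub>R h) (fin_diff s h f)"
    by (simp add: fin_diff_eq_funpow dif_funpow_commute)
  also have "ennreal (real n ^ s) * nrm p lborel (dif (real n *\<^sub>R h) (fin_diff s h f))
      \<le> ennreal (real n ^ s) * (ennreal (real n) * nrm p lborel (dif h (fin_diff s h f)))"
    by (intro mult_left_mono nrm_dif_of_nat_le p) auto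
  also have "\<dots> = ennreal (real n ^ Suc s) * nrm p lborel (fin_diff (Suc s) h f)"
    by (simp add: fin_diff_eq_funpow ennreal_mult mult_ac)
  finally show ?case .
qed

text \<open>A long step is cut into \<open>n\<close> equal steps inside the range of the modulus, at
  the cost \<open>n ^ s\<close>. Such steps occur because the band-limiting kernel has unbounded
  support.\<close>

lemma nrm_fin_diff_scale_le:
  assumes p: "1 \<le> p" and f: "f \<in> borel_measurable borel" and sg: "0 < \<sigma>" and w: "0 \<le> w"
    and small: "\<And>v. norm v < 1 / \<sigma> \<Longrightarrow> nrm p lborel (fin_diff s v f) \<le> ennreal w"
  shows "nrm p lborel (fin_diff s v f) \<le> ennreal ((1 + norm v * \<sigma>) ^ s * w)"
proof -
  \<comment> \<open>Floor plus one instead of the ceiling: \<open>norm v * \<sigma> < real n\<close>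
    has to be strict, as \<open>small\<close> covers an open ball, and \<open>n\<close> has to be
    positive also for \<open>v = 0\<close>.\<close>
  define n where "n = nat \<lfloor>norm v * \<sigma>\<rfloor> + 1"
  have n: "norm v * \<sigma> < real n" "real n \<le> 1 + norm v * \<sigma>"
  proof -
    have "0 \<le> norm v * \<sigma>" using sg by simp
    then show "norm v * \<sigma> < real n" "real n \<le> 1 + norm v * \<sigma>"
      unfolding n_def by (auto simp: of_nat_nat le_floor_iff) linarith+
  qed
  have n0: "0 < real n" by (simp add: n_def)
  define u where "u = (1 / real n) *\<^sub>R v"
  have "norm u < 1 / \<sigma>" using n n0 sg by (simp add: u_def field_simps)
  have "v = real n *\<^sub>R u" using n0 by (simp add: u_def)
  then have "nrm p lborel (fin_diff s v f) \<le> ennreal (real n ^ s) * nrm p lborel (fin_diff s u f)"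
    using nrm_fin_diff_of_nat_le[OF p f, of s n u] by simp
  also have "\<dots> \<le> ennreal (real n ^ s) * ennreal w"
    using small[OF \<open>norm u < 1 / \<sigma>\<close>] by (intro mult_left_mono) auto
  also have "\<dots> \<le> ennreal ((1 + norm v * \<sigma>) ^ s * w)"
    using n n0 w by (auto simp flip: ennreal_mult intro!: ennreal_leI mult_right_mono power_mono)
  finally show ?thesis .
qed

section \<open>Differences with varying steps\<close>

fun mixed_diff :: "(nat \<Rightarrow> 'a::real_vector) \<Rightarrow> nat \<Rightarrow> ('a \<Rightarrow> real) \<Rightarrow> 'a \<Rightarrow> real" where
  "mixed_diff V 0 f = f"
| "mixed_diff V (Suc s) f = dif (V s) (mixed_diff V s f)"

lemma mixed_diff_eq_0: "i < s \<Longrightarrow> V i = 0 \<Longrightarrow> mixed_diff V s f x = 0"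
  by (induction s arbitrary: x) (auto simp: dif_def less_Suc_eq)

lemma mixed_diff_expand:
  "mixed_diff V s f x = (-1) ^ s * (\<Sum>D\<in>Pow {..<s}. (-1) ^ card D * f (x + (\<Sum>j\<in>D. V j)))"
proof (induction s arbitrary: x)
  case (Suc s)
  have fin: "finite D" if "D \<in> Pow {..<s}" for D using that finite_subset by auto
  have inj: "inj_on (insert s) (Pow {..<s})" by (auto simp: inj_on_def)
  have "(\<Sum>D\<in>Pow {..<Suc s}. (-1) ^ card D * f (x + (\<Sum>j\<in>D. V j)))
     = (\<Sum>D\<in>Pow {..<s}. (-1) ^ card D * f (x + (\<Sum>j\<in>D. V j)))
     + (\<Sum>D\<in>insert s ` Pow {..<s}. (-1) ^ card D * f (x + (\<Sum>j\<in>D. V j)))"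
    unfolding lessThan_Suc Pow_insert by (rule sum.union_disjoint) auto
  also have "(\<Sum>D\<in>insert s ` Pow {..<s}. (-1) ^ card D * f (x + (\<Sum>j\<in>D. V j)))
     = - (\<Sum>D\<in>Pow {..<s}. (-1) ^ card D * f (x + V s + (\<Sum>j\<in>D. V j)))"
  proof (subst sum.reindex[OF inj], unfold sum_negf[symmetric] o_def, intro sum.cong refl)
    fix D assume D: "D \<in> Pow {..<s}"
    then have "s \<notin> D" by auto
    then show "(-1) ^ card (insert s D) * f (x + (\<Sum>j\<in>insert s D. V j))
       = - ((-1) ^ card D * f (x + V s + (\<Sum>j\<in>D. V j)))"
      using fin[OF D] by (simp add: add_ac)
  qed
  finally have eq: "(\<Sum>D\<in>Pow {..<Suc s}. (-1) ^ card D * f (x + (\<Sum>j\<in>D. V j)))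
     = (\<Sum>D\<in>Pow {..<s}. (-1) ^ card D * f (x + (\<Sum>j\<in>D. V j)))
     - (\<Sum>D\<in>Pow {..<s}. (-1) ^ card D * f (x + V s + (\<Sum>j\<in>D. V j)))"
    by simp
  show ?case unfolding mixed_diff.simps dif_def Suc.IH eq by (simp add: algebra_simps)
qed simp

text \<open>Kemperman's identity. Expand \<open>\<Sum>\<^sub>k (-1)\<^sup>k (s choose k) \<Prod>\<^sub>j (1 - T ((1 - k / j) h\<^sub>j))\<close> for the
  translations \<open>T\<close>; the \<open>k\<close>-th product vanishes for \<open>1 \<le> k \<le> s\<close> since its factor \<open>j = k\<close> does.\<close>

lemma mixed_diff_eq_sum_fin_diff:
  fixes V :: "nat \<Rightarrow> real ^ 'n"
  shows "mixed_diff V s f x = (\<Sum>D\<in>Pow {..<s}. (-1) ^ card D *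
    fin_diff s (- (\<Sum>j\<in>D. (1 / real (Suc j)) *\<^sub>R V j)) f (x + (\<Sum>j\<in>D. V j)))"
proof -
  \<comment> \<open>The index \<open>\<nu>\<close> of \<open>fin_diff\<close> corresponds to
    \<open>k = s - \<nu>\<close>, and \<open>Suc j\<close> numbers the factors from one:
    \<open>W s\<close> is \<open>V\<close>, while for \<open>\<nu> < s\<close> the factor at
    position \<open>s - \<nu> - 1\<close> vanishes.\<close>
  define W where "W \<nu> j = (1 - real (s - \<nu>) / real (Suc j)) *\<^sub>R V j" for \<nu> j
  have van: "mixed_diff (W \<nu>) s f x = 0" if "\<nu> < s" for \<nu>
  proof (rule mixed_diff_eq_0)
    show "s - \<nu> - 1 < s" using that by simp
    show "W \<nu> (s - \<nu> - 1) = 0" using that by (simp add: W_def of_nat_diff Suc_diff_Suc)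
  qed
  have top: "W s = V" by (simp add: W_def fun_eq_iff)
  have "(\<Sum>\<nu>=0..s. real (s choose \<nu>) * (-1) ^ \<nu> * ((-1) ^ s * mixed_diff (W \<nu>) s f x))
      = (\<Sum>\<nu>\<in>{s}. real (s choose \<nu>) * (-1) ^ \<nu> * ((-1) ^ s * mixed_diff (W \<nu>) s f x))"
    by (rule sum.mono_neutral_right) (auto simp: van)
  also have "\<dots> = mixed_diff V s f x" by (simp add: top flip: power_add)
  finally have "mixed_diff V s f x = (\<Sum>\<nu>=0..s. real (s choose \<nu>) * (-1) ^ \<nu> * ((-1) ^ s * mixed_diff (W \<nu>) s f x))"
    by simp
  also have "\<dots> = (\<Sum>\<nu>=0..s. real (s choose \<nu>) * (-1) ^ \<nu> *
      (\<Sum>D\<in>Pow {..<s}. (-1) ^ card D * f (x + (\<Sum>j\<in>D. W \<nu> j))))"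
    by (simp add: mixed_diff_expand flip: power_add mult.assoc)
  also have "\<dots> = (\<Sum>D\<in>Pow {..<s}. (-1) ^ card D *
      (\<Sum>\<nu>=0..s. real (s choose \<nu>) * (-1) ^ \<nu> * f (x + (\<Sum>j\<in>D. W \<nu> j))))"
    unfolding sum_distrib_left by (subst sum.swap) (simp add: mult_ac)
  also have "\<dots> = (\<Sum>D\<in>Pow {..<s}. (-1) ^ card D *
    fin_diff s (- (\<Sum>j\<in>D. (1 / real (Suc j)) *\<^sub>R V j)) f (x + (\<Sum>j\<in>D. V j)))"
  proof -
    have "(\<Sum>j\<in>D. W \<nu> j) = (\<Sum>j\<in>D. V j) + real (s - \<nu>) *\<^sub>R (- (\<Sum>j\<in>D. (1 / real (Suc j)) *\<^sub>R V j))" for D \<nu>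
      by (simp add: W_def scaleR_sum_right sum_subtractf scaleR_left_diff_distrib)
    then show ?thesis by (simp only: fin_diff_def add.assoc)
  qed
  finally show ?thesis .
qed

text \<open>The steps in Kemperman's identity are sums of at most \<open>s\<close> vectors
  \<open>V j / (j + 1)\<close>, hence no longer than \<open>s * \<eta>\<close>, and translations
  keep the norm. The factor \<open>2 ^ s\<close> counts the summands.\<close>

lemma nrm_mixed_diff_le:
  fixes V :: "nat \<Rightarrow> real ^ 'n"
  assumes p: "1 \<le> p" and [measurable]: "f \<in> borel_measurable borel" and sg: "0 < \<sigma>" and w: "0 \<le> w"
    and small: "\<And>v. norm v < 1 / \<sigma> \<Longrightarrow> nrm p lborel (fin_diff s v f) \<le> ennreal w"
    and V: "\<And>j. j < s \<Longrightarrow> norm (V j) \<le> \<eta>"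
  shows "nrm p lborel (mixed_diff V s f) \<le> ennreal (2 ^ s * (1 + real s * \<eta> * \<sigma>) ^ s * w)"
proof -
  let ?u = "\<lambda>D. - (\<Sum>j\<in>D. (1 / real (Suc j)) *\<^sub>R V j)"
  have u: "norm (?u D) \<le> real s * \<eta>" if "D \<in> Pow {..<s}" for D
  proof (cases "s = 0")
    case True
    then show ?thesis using that by simp
  next
    case False
    then have eta: "0 \<le> \<eta>" using V[of 0] norm_ge_zero[of "V 0"] by linarith
    have "norm (?u D) \<le> (\<Sum>j\<in>D. norm ((1 / real (Suc j)) *\<^sub>R V j))"
      unfolding norm_minus_cancel by (rule norm_sum)
    also have "\<dots> \<le> (\<Sum>j\<in>D. \<eta>)"
    proof (rule sum_mono)
      fix j assume "j \<in> D"
      then have "norm (V j) \<le> \<eta>" using that V by auto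
      then have "(1 / real (Suc j)) * norm (V j) \<le> 1 * \<eta>"
        by (intro mult_mono) auto
      then show "norm ((1 / real (Suc j)) *\<^sub>R V j) \<le> \<eta>" by simp
    qed
    also have "\<dots> \<le> real s * \<eta>"
      using that eta card_mono[of "{..<s}" D] by (auto intro!: mult_right_mono)
    finally show ?thesis .
  qed
  have "nrm p lborel (mixed_diff V s f) = nrm p lborel (\<lambda>x. \<Sum>D\<in>Pow {..<s}. (-1) ^ card D *
      fin_diff s (?u D) f (x + (\<Sum>j\<in>D. V j)))"
    by (simp add: mixed_diff_eq_sum_fin_diff[abs_def])
  also have "\<dots> \<le> ennreal (\<Sum>D\<in>Pow {..<s}. \<bar>(-1) ^ card D\<bar> * ((1 + real s * \<eta> * \<sigma>) ^ s * w))"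
  proof (intro nrm_sum_le nrm_cmult_le p)
    fix D assume D: "D \<in> Pow {..<s}"
    have "nrm p lborel (\<lambda>x. fin_diff s (?u D) f (x + (\<Sum>j\<in>D. V j))) = nrm p lborel (fin_diff s (?u D) f)"
      by (rule nrm_translate) auto
    also have "\<dots> \<le> ennreal ((1 + norm (?u D) * \<sigma>) ^ s * w)"
      by (rule nrm_fin_diff_scale_le[OF p _ sg w small]) auto
    also have "\<dots> \<le> ennreal ((1 + real s * \<eta> * \<sigma>) ^ s * w)"
    proof (intro ennreal_leI mult_right_mono power_mono add_left_mono)
      show "norm (?u D) \<le> real s * \<eta>" by (rule u[OF D])
    qed (use sg w in auto)
    finally show "nrm p lborel (\<lambda>x. fin_diff s (?u D) f (x + (\<Sum>j\<in>D. V j))) \<le> ennreal ((1 + real s * \<eta> * \<sigma>) ^ s * w)" .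
    have "0 \<le> norm (?u D) * \<sigma>" using sg by simp
    also have "\<dots> \<le> real s * \<eta> * \<sigma>" using u[OF D] sg by (intro mult_right_mono) auto
    finally show "0 \<le> \<bar>(- 1) ^ card D\<bar> * ((1 + real s * \<eta> * \<sigma>) ^ s * w)"
      using w by auto
  qed auto
  also have "(\<Sum>D\<in>Pow {..<s}. \<bar>(-1) ^ card D\<bar> * ((1 + real s * \<eta> * \<sigma>) ^ s * w)) = 2 ^ s * (1 + real s * \<eta> * \<sigma>) ^ s * w"
    by (simp add: power_abs card_Pow)
  finally show ?thesis .
qed

section \<open>Averages with respect to a probability measure\<close>

definition borel_prob :: "'a::euclidean_space measure \<Rightarrow> bool" where
  "borel_prob P \<longleftrightarrow> prob_space P \<and> sets P = sets borel"

text \<open>Convolution with the law of \<open>- c w\<close>. With this sign the averages involve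
  the values of \<open>F\<close> at the nodes \<open>x + k h w\<close> of a difference.\<close>

definition conv :: "'a::euclidean_space measure \<Rightarrow> real \<Rightarrow> ('a \<Rightarrow> real) \<Rightarrow> 'a \<Rightarrow> real" where
  "conv P c F x = (\<integral>w. F (x + c *\<^sub>R w) \<partial>P)"

text \<open>Required at every \<open>x\<close>: identities such as \<open>dif_conv\<close> have to
  hold at each sampling point, not merely up to null sets.\<close>

definition conv_integrable :: "'a::euclidean_space measure \<Rightarrow> real \<Rightarrow> ('a \<Rightarrow> real) \<Rightarrow> bool" where
  "conv_integrable P c F \<longleftrightarrow> (\<forall>x. integrable P (\<lambda>w. F (x + c *\<^sub>R w)))"

lemma borel_probD:
  assumes "borel_prob P"
  shows "prob_space P" "sigma_finite_measure P" "sets P = sets borel" "space P = UNIV"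
proof -
  show P: "prob_space P" "sets P = sets borel" using assms by (auto simp: borel_prob_def)
  then show "space P = UNIV" using sets_eq_imp_space_eq[of P borel] by simp
  show "sigma_finite_measure P"
    using P(1) by (simp add: prob_space_imp_sigma_finite)
qed

lemma borel_measurable_conv [measurable]:
  assumes P: "borel_prob P" and [measurable]: "F \<in> borel_measurable borel"
  shows "conv P c F \<in> borel_measurable borel"
proof -
  note [measurable_cong] = borel_probD(3)[OF P]
  interpret sigma_finite_measure P by (rule borel_probD[OF P])
  show ?thesis unfolding conv_def by measurable
qed

lemma nrm_conv_le:
  fixes F :: "'a::euclidean_space \<Rightarrow> real"
  assumes p: "1 \<le> p" and P: "borel_prob P" and [measurable]: "F \<in> borel_measurable borel"
    and w: "nrm p lborel F \<le> ennreal w" "0 \<le> w"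
  shows "nrm p lborel (conv P c F) \<le> ennreal w"
proof -
  note [measurable_cong] = borel_probD(3)[OF P]
  interpret P: prob_space P by (rule borel_probD[OF P])
  show ?thesis unfolding conv_def
  proof (rule nrm_integral_le[OF p borel_probD(1)[OF P]])
    show "AE u in P. nrm p lborel (\<lambda>x. F (x + c *\<^sub>R u)) \<le> ennreal w"
      using w by (simp add: nrm_translate)
    show "(\<integral>\<^sup>+ u. ennreal (w powr p) \<partial>P) \<le> ennreal (w powr p)"
      by (simp add: P.emeasure_space_1)
  qed (use w in \<open>auto intro: lborel.sigma_finite_measure_axioms\<close>)
qed

lemma conv_integrable_dif: "conv_integrable P c F \<Longrightarrow> conv_integrable P c (dif h F)"
  unfolding conv_integrable_def dif_def
proof (intro allI Bochner_Integration.integrable_diff)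
  fix x assume "\<forall>x. integrable P (\<lambda>w. F (x + c *\<^sub>R w))"
  then have "integrable P (\<lambda>w. F ((x + h) + c *\<^sub>R w))" by blast
  then show "integrable P (\<lambda>w. F (x + c *\<^sub>R w + h))" by (simp add: add_ac)
qed auto

lemma conv_integrable_dif_funpow: "conv_integrable P c F \<Longrightarrow> conv_integrable P c ((dif h ^^ n) F)"
  by (induction n) (auto intro: conv_integrable_dif)

lemma dif_conv:
  assumes "conv_integrable P c F"
  shows "dif h (conv P c F) = conv P c (dif h F)"
proof
  fix x
  have i: "integrable P (\<lambda>w. F ((x + h) + c *\<^sub>R w))" "integrable P (\<lambda>w. F (x + c *\<^sub>R w))"
    using assms unfolding conv_integrable_def by blast+
  have "conv P c (dif h F) x = (\<integral>w. F ((x + h) + c *\<^sub>R w) - F (x + c *\<^sub>R w) \<partial>P)"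
    by (simp add: conv_def dif_def add_ac)
  also have "\<dots> = dif h (conv P c F) x" using i by (simp add: conv_def dif_def)
  finally show "dif h (conv P c F) x = conv P c (dif h F) x" by simp
qed

lemma fin_diff_conv:
  assumes "conv_integrable P c F"
  shows "fin_diff n h (conv P c F) = conv P c (fin_diff n h F)"
  unfolding fin_diff_eq_funpow
  by (induction n) (simp_all add: dif_conv[OF conv_integrable_dif_funpow[OF assms]])

definition jackson :: "'a::euclidean_space measure \<Rightarrow> real \<Rightarrow> nat \<Rightarrow> ('a \<Rightarrow> real) \<Rightarrow> 'a \<Rightarrow> real" where
  "jackson P h s F x = (\<Sum>k=1..s. (-1) ^ Suc k * real (s choose k) * conv P (real k * h) F x)"

lemma borel_measurable_jackson [measurable]:
  assumes P: "borel_prob P" and [measurable]: "F \<in> borel_measurable borel"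
  shows "jackson P h s F \<in> borel_measurable borel"
  using borel_measurable_conv[OF P] unfolding jackson_def by measurable

lemma sum_abs_binomial_le: "(\<Sum>k=1..s. \<bar>(-1) ^ Suc k * real (s choose k)\<bar>) \<le> 2 ^ s"
proof -
  have "(\<Sum>k=1..s. \<bar>(-1) ^ Suc k * real (s choose k)\<bar>) \<le> (\<Sum>k\<le>s. real (s choose k))"
    by (subst abs_mult) (auto simp: power_abs intro!: sum_mono2)
  also have "\<dots> = 2 ^ s" using choose_row_sum[of s] by (metis of_nat_numeral of_nat_power of_nat_sum)
  finally show ?thesis .
qed

lemma nrm_jackson_le:
  assumes p: "1 \<le> p" and P: "borel_prob P" and [measurable]: "F \<in> borel_measurable borel"
    and w: "nrm p lborel F \<le> ennreal w" "0 \<le> w"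
  shows "nrm p lborel (jackson P h s F) \<le> ennreal (2 ^ s * w)"
proof -
  note [measurable] = borel_measurable_conv[OF P]
  have "nrm p lborel (jackson P h s F) \<le> ennreal (\<Sum>k=1..s. \<bar>(-1) ^ Suc k * real (s choose k)\<bar> * w)"
    unfolding jackson_def using w
    by (intro nrm_sum_le nrm_cmult_le nrm_conv_le p P) auto
  also have "\<dots> \<le> ennreal (2 ^ s * w)"
    unfolding sum_distrib_right[symmetric] using w by (intro ennreal_leI mult_right_mono sum_abs_binomial_le)
  finally show ?thesis .
qed

text \<open>Commutation transfers a bound on the modulus from \<open>F\<close> to its image, with
  the factor \<open>2 ^ s\<close> of \<open>nrm_jackson_le\<close>; thus a second operator can be
  applied to the output of the first.\<close>

lemma fin_diff_jackson:
  assumes c: "\<And>k. k \<in> {1..s} \<Longrightarrow> conv_integrable P (real k * h) F"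
  shows "fin_diff n v (jackson P h s F) = jackson P h s (fin_diff n v F)"
proof
  fix x
  have "fin_diff n v (jackson P h s F) x
      = (\<Sum>k=1..s. (-1) ^ Suc k * real (s choose k) * fin_diff n v (conv P (real k * h) F) x)"
    unfolding fin_diff_def jackson_def sum_distrib_left
    by (subst sum.swap) (simp add: mult_ac)
  also have "\<dots> = jackson P h s (fin_diff n v F) x"
    unfolding jackson_def by (intro sum.cong refl) (simp add: fin_diff_conv[OF c])
  finally show "fin_diff n v (jackson P h s F) x = jackson P h s (fin_diff n v F) x" .
qed

lemma fin_diff_alt: "(-1) ^ s * fin_diff s v f x = (\<Sum>k=0..s. (-1) ^ k * real (s choose k) * f (x + real k *\<^sub>R v))"
proof -
  have "(-1) ^ s * fin_diff s v f x = (\<Sum>k=0..s. (-1) ^ s * (real (s choose (s - k)) * (-1) ^ (s - k) * f (x + real (s - (s - k)) *\<^sub>R v)))"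
    unfolding fin_diff_def sum_distrib_left by (subst sum.atLeastAtMost_rev) simp
  also have "\<dots> = (\<Sum>k=0..s. (-1) ^ k * real (s choose k) * f (x + real k *\<^sub>R v))"
  proof (intro sum.cong refl)
    fix k assume k: "k \<in> {0..s}"
    then obtain m where m: "s = k + m" using le_Suc_ex by auto
    have e1: "(-1::real) ^ s * (-1) ^ (s - k) = (-1) ^ k"
      by (simp add: m power_add flip: mult.assoc power_mult_distrib)
    have e2: "s choose (s - k) = s choose k" using k by (intro binomial_symmetric[symmetric]) auto
    have e3: "s - (s - k) = k" using k by auto
    show "(- 1) ^ s * (real (s choose (s - k)) * (- 1) ^ (s - k) * f (x + real (s - (s - k)) *\<^sub>R v))
        = (- 1) ^ k * real (s choose k) * f (x + real k *\<^sub>R v)"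
      unfolding e2 e3 e1[symmetric] by (simp only: mult_ac)
  qed
  finally show ?thesis .
qed

text \<open>The term \<open>k = 0\<close> of the difference integrates to \<open>F x\<close> because
  \<open>P\<close> has mass one; the other terms make up \<open>jackson\<close>.\<close>

lemma diff_jackson_eq:
  assumes P: "borel_prob P" and c: "\<And>k. k \<in> {1..s} \<Longrightarrow> conv_integrable P (real k * h) F"
  shows "F x - jackson P h s F x = (\<integral>w. (-1) ^ s * fin_diff s (h *\<^sub>R w) F x \<partial>P)"
proof -
  interpret P: prob_space P by (rule borel_probD[OF P])
  have i: "integrable P (\<lambda>w. F (x + (real k * h) *\<^sub>R w))" if "k \<in> {0..s}" for k
    using c[of k] that by (cases "k = 0") (auto simp: conv_integrable_def)
  have "(\<integral>w. (-1) ^ s * fin_diff s (h *\<^sub>R w) F x \<partial>P)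
      = (\<integral>w. (\<Sum>k=0..s. (-1) ^ k * real (s choose k) * F (x + (real k * h) *\<^sub>R w)) \<partial>P)"
    by (simp add: fin_diff_alt)
  also have "\<dots> = (\<Sum>k=0..s. (-1) ^ k * real (s choose k) * conv P (real k * h) F x)"
    unfolding conv_def using i by (subst Bochner_Integration.integral_sum) auto
  also have "\<dots> = conv P 0 F x + (\<Sum>k=1..s. (-1) ^ k * real (s choose k) * conv P (real k * h) F x)"
    by (subst sum.atLeast_Suc_atMost) auto
  also have "conv P 0 F x = F x" by (simp add: conv_def P.prob_space)
  finally show ?thesis by (simp add: jackson_def sum_negf)
qed

text \<open>\<open>M\<close> bounds the growth factor of \<open>nrm_fin_diff_scale_le\<close> in the
  \<open>p\<close>-th power mean over \<open>P\<close>. That mean depends on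
  \<open>h * \<sigma>\<close> only, which is constant when \<open>h\<close> is a fixed multiple of
  \<open>1 / \<sigma>\<close>.\<close>

lemma nrm_diff_jackson_le:
  fixes F :: "real ^ 'b \<Rightarrow> real"
  assumes p: "1 \<le> p" and P: "borel_prob P" and [measurable]: "F \<in> borel_measurable borel"
    and c: "\<And>k. k \<in> {1..s} \<Longrightarrow> conv_integrable P (real k * h) F"
    and h: "0 < h" and sg: "0 < \<sigma>" and w: "0 \<le> w"
    and small: "\<And>v. norm v < 1 / \<sigma> \<Longrightarrow> nrm p lborel (fin_diff s v F) \<le> ennreal w"
    and M: "0 \<le> M" "(\<integral>\<^sup>+ u. ennreal (((1 + norm u * (h * \<sigma>)) ^ s) powr p) \<partial>P) \<le> ennreal (M powr p)"
  shows "nrm p lborel (\<lambda>x. F x - jackson P h s F x) \<le> ennreal (M * w)"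
proof -
  note [measurable_cong] = borel_probD(3)[OF P]
  have eq: "F x - jackson P h s F x = (\<integral>w. (-1) ^ s * fin_diff s (h *\<^sub>R w) F x \<partial>P)" for x
    by (rule diff_jackson_eq[OF P]) (rule c)
  show ?thesis unfolding eq
  proof (rule nrm_integral_le[OF p borel_probD(1)[OF P], where w="\<lambda>u. (1 + norm u * (h * \<sigma>)) ^ s * w"])
    show "AE u in P. nrm p lborel (\<lambda>x. (-1) ^ s * fin_diff s (h *\<^sub>R u) F x) \<le> ennreal ((1 + norm u * (h * \<sigma>)) ^ s * w)"
    proof (rule AE_I2)
      fix u
      have "nrm p lborel (\<lambda>x. (-1) ^ s * fin_diff s (h *\<^sub>R u) F x) = nrm p lborel (fin_diff s (h *\<^sub>R u) F)"
        by (rule nrm_cong) (simp add: abs_mult power_abs)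
      also have "\<dots> \<le> ennreal ((1 + norm (h *\<^sub>R u) * \<sigma>) ^ s * w)"
        by (rule nrm_fin_diff_scale_le[OF p _ sg w small]) auto
      finally show "nrm p lborel (\<lambda>x. (-1) ^ s * fin_diff s (h *\<^sub>R u) F x) \<le> ennreal ((1 + norm u * (h * \<sigma>)) ^ s * w)"
        using h by (simp add: mult_ac)
    qed
    have "(\<integral>\<^sup>+ u. ennreal (((1 + norm u * (h * \<sigma>)) ^ s * w) powr p) \<partial>P)
        = (\<integral>\<^sup>+ u. ennreal (((1 + norm u * (h * \<sigma>)) ^ s) powr p) * ennreal (w powr p) \<partial>P)"
      using w h sg by (simp add: powr_mult ennreal_mult)
    also have "\<dots> = (\<integral>\<^sup>+ u. ennreal (((1 + norm u * (h * \<sigma>)) ^ s) powr p) \<partial>P) * ennreal (w powr p)"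
      by (rule nn_integral_multc) auto
    also have "\<dots> \<le> ennreal (M powr p) * ennreal (w powr p)"
      by (intro mult_right_mono M) auto
    also have "\<dots> = ennreal ((M * w) powr p)" using M w by (simp add: powr_mult ennreal_mult)
    finally show "(\<integral>\<^sup>+ u. ennreal (((1 + norm u * (h * \<sigma>)) ^ s * w) powr p) \<partial>P) \<le> ennreal ((M * w) powr p)" .
    show "(\<lambda>(x, u). (- 1) ^ s * fin_diff s (h *\<^sub>R u) F x) \<in> borel_measurable (lborel \<Otimes>\<^sub>M P)"
    proof -
      have "(\<lambda>z. F (fst z + a *\<^sub>R (h *\<^sub>R snd z))) \<in> borel_measurable (lborel \<Otimes>\<^sub>M P)" for a
        by measurable
      then show ?thesis
        unfolding fin_diff_def case_prod_beta by (intro borel_measurable_times borel_measurable_sum borel_measurable_const)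
    qed
    show "sigma_finite_measure lborel" by (rule lborel.sigma_finite_measure_axioms)
    show "0 \<le> (1 + norm u * (h * \<sigma>)) ^ s * w" for u :: "real ^ 'b"
      using w h sg by simp
    show "0 \<le> M * w" using M(1) w by simp
  qed
qed

section \<open>Fourier transforms of averages\<close>

definition chf :: "'a::euclidean_space measure \<Rightarrow> 'a \<Rightarrow> complex" where
  "chf P y = (\<integral>w. exp (2 * of_real pi * \<i> * of_real (y \<bullet> w)) \<partial>P)"

lemma fourier_lborel:
  assumes [measurable]: "F \<in> borel_measurable borel"
  shows "fourier F x = (\<integral>y. of_real (F y) * exp (- 2 * of_real pi * \<i> * of_real (x \<bullet> y)) \<partial>lborel)"
  unfolding fourier_def by (rule integral_completion) measurable

lemma norm_exp_imaginary: "norm (exp (- 2 * of_real pi * \<i> * of_real t)) = 1"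
  "norm (exp (2 * of_real pi * \<i> * of_real t)) = 1"
  by (simp_all add: norm_exp_eq_Re)

lemma nn_integral_conv_prod:
  fixes F :: "'a::euclidean_space \<Rightarrow> real"
  assumes P: "borel_prob P" and F[measurable]: "F \<in> borel_measurable borel"
  shows "(\<integral>\<^sup>+ z. ennreal (norm (case z of (y, w) \<Rightarrow> F (y + c *\<^sub>R w))) \<partial>(lborel \<Otimes>\<^sub>M P)) = (\<integral>\<^sup>+ y. ennreal \<bar>F y\<bar> \<partial>lborel)"
proof -
  note [measurable_cong] = borel_probD(3)[OF P]
  interpret P: prob_space P by (rule borel_probD[OF P])
  interpret LP: pair_sigma_finite lborel P ..
  have "(\<integral>\<^sup>+ z. ennreal (norm (case z of (y, w) \<Rightarrow> F (y + c *\<^sub>R w))) \<partial>(lborel \<Otimes>\<^sub>M P))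
     = (\<integral>\<^sup>+ w. \<integral>\<^sup>+ y. ennreal \<bar>F (y + c *\<^sub>R w)\<bar> \<partial>lborel \<partial>P)"
    by (subst LP.nn_integral_snd[symmetric]) auto
  also have "\<dots> = (\<integral>\<^sup>+ w. \<integral>\<^sup>+ y. ennreal \<bar>F y\<bar> \<partial>lborel \<partial>P)"
    by (subst nn_integral_lborel_translate) auto
  finally show ?thesis by (simp add: P.emeasure_space_1)
qed

lemma integrable_conv_prod:
  fixes F :: "'a::euclidean_space \<Rightarrow> real"
  assumes P: "borel_prob P" and F: "integrable lborel F"
  shows "integrable (lborel \<Otimes>\<^sub>M P) (\<lambda>(y, w). F (y + c *\<^sub>R w))"
proof -
  note [measurable_cong] = borel_probD(3)[OF P]
  have [measurable]: "F \<in> borel_measurable borel" using F by (simp add: borel_measurable_integrable)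
  show ?thesis
  proof (rule integrableI_bounded)
    show "(\<lambda>(y, w). F (y + c *\<^sub>R w)) \<in> borel_measurable (lborel \<Otimes>\<^sub>M P)" by measurable
    show "(\<integral>\<^sup>+ z. ennreal (norm (case z of (y, w) \<Rightarrow> F (y + c *\<^sub>R w))) \<partial>(lborel \<Otimes>\<^sub>M P)) < \<infinity>"
      using F by (subst nn_integral_conv_prod[OF P]) (auto simp: integrable_iff_bounded)
  qed
qed

lemma integrable_conv:
  assumes P: "borel_prob P" and F: "integrable lborel F"
  shows "integrable lborel (conv P c F)"
proof -
  interpret P: prob_space P by (rule borel_probD[OF P])
  interpret LP: pair_sigma_finite lborel P ..
  show ?thesis using LP.integrable_fst[OF integrable_conv_prod[OF P F, of c]] by (simp add: conv_def[abs_def])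
qed

lemma integrable_jackson:
  assumes P: "borel_prob P" and F: "integrable lborel F"
  shows "integrable lborel (jackson P h s F)"
  unfolding jackson_def[abs_def] using integrable_conv[OF P F] by auto

text \<open>Fubini and a translation. An average therefore keeps the zeros of the Fourier transform,
  and adds new ones where \<open>chf\<close> vanishes. The positive exponent in \<open>chf\<close>
  comes from the plus sign in \<open>conv\<close>.\<close>

lemma fourier_conv:
  fixes F :: "real ^ 'n \<Rightarrow> real"
  assumes P: "borel_prob P" and F: "integrable lborel F"
  shows "fourier (conv P c F) x = fourier F x * chf P (c *\<^sub>R x)"
proof -
  note [measurable_cong] = borel_probD(3)[OF P]
  have [measurable]: "F \<in> borel_measurable borel" using F by (simp add: borel_measurable_integrable)
  note [measurable] = borel_measurable_conv[OF P]
  interpret P: prob_space P by (rule borel_probD[OF P])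
  interpret LP: pair_sigma_finite lborel P ..
  let ?e = "\<lambda>y. exp (- 2 * of_real pi * \<i> * of_real (x \<bullet> y)) :: complex"
  have int: "integrable (lborel \<Otimes>\<^sub>M P) (\<lambda>(y, w). of_real (F (y + c *\<^sub>R w)) * ?e y)"
    by (rule Bochner_Integration.integrable_bound[OF integrable_conv_prod[OF P F, of c]])
       (auto simp: norm_mult norm_exp_imaginary)
  have "fourier (conv P c F) x = (\<integral>y. (\<integral>w. of_real (F (y + c *\<^sub>R w)) * ?e y \<partial>P) \<partial>lborel)"
    by (simp add: fourier_lborel conv_def)
  also have "\<dots> = (\<integral>w. (\<integral>y. of_real (F (y + c *\<^sub>R w)) * ?e y \<partial>lborel) \<partial>P)"
    using LP.Fubini_integral[OF int] by simp
  also have "\<dots> = (\<integral>w. fourier F x * exp (2 * of_real pi * \<i> * of_real ((c *\<^sub>R x) \<bullet> w)) \<partial>P)"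
  proof (rule Bochner_Integration.integral_cong[OF refl])
    fix w
    have "(\<integral>y. of_real (F (y + c *\<^sub>R w)) * ?e y \<partial>lborel)
       = (\<integral>y. (\<lambda>y. of_real (F y) * ?e (y - c *\<^sub>R w)) (y + c *\<^sub>R w) \<partial>lborel)" by simp
    also have "\<dots> = (\<integral>y. of_real (F y) * ?e (y - c *\<^sub>R w) \<partial>lborel)"
      by (rule integral_lborel_translate) measurable
    also have "(\<lambda>y. of_real (F y) * ?e (y - c *\<^sub>R w))
        = (\<lambda>y. of_real (F y) * ?e y * exp (2 * of_real pi * \<i> * of_real ((c *\<^sub>R x) \<bullet> w)))"
      by (auto simp: fun_eq_iff inner_diff_right algebra_simps exp_diff exp_minus divide_inverse simp flip: exp_add)
    also have "(\<integral>y. of_real (F y) * ?e y * exp (2 * of_real pi * \<i> * of_real ((c *\<^sub>R x) \<bullet> w)) \<partial>lborel)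
        = fourier F x * exp (2 * of_real pi * \<i> * of_real ((c *\<^sub>R x) \<bullet> w))"
      by (simp add: fourier_lborel)
    finally show "(\<integral>y. of_real (F (y + c *\<^sub>R w)) * ?e y \<partial>lborel)
        = fourier F x * exp (2 * of_real pi * \<i> * of_real ((c *\<^sub>R x) \<bullet> w))" .
  qed
  also have "\<dots> = fourier F x * chf P (c *\<^sub>R x)" by (simp add: chf_def)
  finally show ?thesis .
qed

lemma fourier_jackson:
  fixes F :: "real ^ 'n \<Rightarrow> real"
  assumes P: "borel_prob P" and F: "integrable lborel F"
  shows "fourier (jackson P h s F) x
    = (\<Sum>k=1..s. of_real ((-1) ^ Suc k * real (s choose k)) * (fourier F x * chf P ((real k * h) *\<^sub>R x)))"
proof -
  have FM: "F \<in> borel_measurable borel" using F by (simp add: borel_measurable_integrable)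
  note [measurable] = FM borel_measurable_conv[OF P FM] borel_measurable_jackson[OF P FM]
  let ?e = "\<lambda>y. exp (- 2 * of_real pi * \<i> * of_real (x \<bullet> y)) :: complex"
  let ?a = "\<lambda>k. (-1) ^ Suc k * real (s choose k)"
  have int: "integrable lborel (\<lambda>y. of_real (conv P c F y) * ?e y)" for c
    by (rule Bochner_Integration.integrable_bound[OF integrable_conv[OF P F, of c]])
       (auto simp: norm_mult norm_exp_imaginary)
  have "fourier (jackson P h s F) x = (\<integral>y. (\<Sum>k=1..s. of_real (?a k) * (of_real (conv P (real k * h) F y) * ?e y)) \<partial>lborel)"
    unfolding fourier_lborel[OF borel_measurable_jackson[OF P FM]]
    by (simp only: jackson_def of_real_sum sum_distrib_right of_real_mult mult.assoc)
  also have "\<dots> = (\<Sum>k=1..s. of_real (?a k) * fourier (conv P (real k * h) F) x)"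
    using int by (subst Bochner_Integration.integral_sum) (auto simp: fourier_lborel)
  finally show ?thesis by (simp add: fourier_conv[OF P F])
qed

text \<open>Such functions are integrable against every Borel probability measure, and averages and
  differences stay in the class. From the output of the first operator on, this settles all side
  conditions on integrability of averages.\<close>

definition bdd_cont :: "('a::euclidean_space \<Rightarrow> real) \<Rightarrow> bool" where
  "bdd_cont F \<longleftrightarrow> continuous_on UNIV F \<and> (\<exists>B. \<forall>x. \<bar>F x\<bar> \<le> B)"

lemma bdd_cont_measurable: "bdd_cont F \<Longrightarrow> F \<in> borel_measurable borel"
  by (simp add: bdd_cont_def borel_measurable_continuous_onI)

lemma bdd_cont_conv_integrable:
  assumes P: "borel_prob P" and F: "bdd_cont F"
  shows "conv_integrable P c F"
proof -
  note [measurable] = bdd_cont_measurable[OF F]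
  note [measurable_cong] = borel_probD(3)[OF P]
  interpret P: prob_space P by (rule borel_probD[OF P])
  obtain B where "\<And>x. \<bar>F x\<bar> \<le> B" using F by (auto simp: bdd_cont_def)
  then show ?thesis unfolding conv_integrable_def by (intro allI P.integrable_const_bound[of _ B]) auto
qed

lemma bdd_cont_conv:
  assumes P: "borel_prob P" and F: "bdd_cont F"
  shows "bdd_cont (conv P c F)"
proof -
  note [measurable] = bdd_cont_measurable[OF F]
  note [measurable_cong] = borel_probD(3)[OF P]
  interpret P: prob_space P by (rule borel_probD[OF P])
  obtain B where B: "\<And>x. \<bar>F x\<bar> \<le> B" using F by (auto simp: bdd_cont_def)
  have "continuous_on UNIV (conv P c F)"
  proof (rule continuous_on_sequentiallyI)
    fix u :: "nat \<Rightarrow> 'a" and a assume u: "u \<longlonglongrightarrow> a"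
    show "(\<lambda>n. conv P c F (u n)) \<longlonglongrightarrow> conv P c F a"
      unfolding conv_def
    proof (rule integral_dominated_convergence[where w="\<lambda>_. B"])
      show "AE w in P. (\<lambda>n. F (u n + c *\<^sub>R w)) \<longlonglongrightarrow> F (a + c *\<^sub>R w)"
      proof (rule AE_I2)
        fix w
        have "isCont F (a + c *\<^sub>R w)" using F by (simp add: bdd_cont_def continuous_on_eq_continuous_at)
        moreover have "(\<lambda>n. u n + c *\<^sub>R w) \<longlonglongrightarrow> a + c *\<^sub>R w" by (intro tendsto_intros u)
        ultimately show "(\<lambda>n. F (u n + c *\<^sub>R w)) \<longlonglongrightarrow> F (a + c *\<^sub>R w)"
          using isCont_tendsto_compose by blast
      qed
    qed (use B in auto)
  qed
  moreover have "\<bar>conv P c F x\<bar> \<le> B" for x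
  proof -
    have "\<bar>conv P c F x\<bar> \<le> (\<integral>w. \<bar>F (x + c *\<^sub>R w)\<bar> \<partial>P)" unfolding conv_def by (rule integral_abs_bound)
    also have "\<dots> \<le> (\<integral>w. B \<partial>P)"
      using bdd_cont_conv_integrable[OF P F, of c] B by (intro integral_mono) (auto simp: conv_integrable_def)
    finally show ?thesis by (simp add: P.prob_space)
  qed
  ultimately show ?thesis unfolding bdd_cont_def by blast
qed

lemma bdd_cont_add: "bdd_cont F \<Longrightarrow> bdd_cont G \<Longrightarrow> bdd_cont (\<lambda>x. F x + G x)"
  unfolding bdd_cont_def by (auto intro!: continuous_intros) (meson abs_triangle_ineq add_mono order_trans)

lemma bdd_cont_cmult: "bdd_cont F \<Longrightarrow> bdd_cont (\<lambda>x. a * F x)"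
  unfolding bdd_cont_def by (auto intro!: continuous_intros simp: abs_mult) (meson abs_ge_zero mult_left_mono)

lemma bdd_cont_translate: "bdd_cont F \<Longrightarrow> bdd_cont (\<lambda>x. F (x + h))"
  unfolding bdd_cont_def
  by (elim conjE exE, intro conjI exI, rule continuous_on_compose2[of UNIV F]) (auto intro!: continuous_intros)

lemma bdd_cont_dif: "bdd_cont F \<Longrightarrow> bdd_cont (dif h F)"
  using bdd_cont_add[OF bdd_cont_translate[of F h] bdd_cont_cmult[of F "-1"]] by (simp add: dif_def[abs_def])

lemma bdd_cont_sum: "(\<And>i. i \<in> I \<Longrightarrow> bdd_cont (f i)) \<Longrightarrow> bdd_cont (\<lambda>x. \<Sum>i\<in>I. f i x)"
proof (induction I rule: infinite_finite_induct)
  case (insert i I)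
  then show ?case using bdd_cont_add[of "f i" "\<lambda>x. \<Sum>i\<in>I. f i x"] by simp
qed (auto simp: bdd_cont_def)

lemma bdd_cont_fin_diff: "bdd_cont F \<Longrightarrow> bdd_cont (fin_diff n h F)"
  unfolding fin_diff_eq_funpow by (induction n) (auto intro: bdd_cont_dif)

lemma bdd_cont_jackson: "borel_prob P \<Longrightarrow> bdd_cont F \<Longrightarrow> bdd_cont (jackson P h s F)"
  unfolding jackson_def[abs_def] by (intro bdd_cont_sum bdd_cont_cmult bdd_cont_conv)

section \<open>A kernel with compactly supported Fourier transform\<close>

definition rsinc :: "real \<Rightarrow> real" where
  "rsinc t = (if t = 0 then 1 else sin t / t)"

lemma borel_measurable_rsinc [measurable]: "rsinc \<in> borel_measurable borel"
  unfolding rsinc_def[abs_def] by measurable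

lemma continuous_on_rsinc: "continuous_on S rsinc"
  using continuous_on_sinc[OF continuous_on_id] by (simp add: rsinc_def[abs_def])

lemma rsinc_power_nonneg: "0 \<le> rsinc t ^ (2 * n)"
  by (rule zero_le_even_power) simp

definition csinc :: "complex \<Rightarrow> complex" where
  "csinc z = (if z = 0 then 1 else sin z / z)"

text \<open>The function is the difference quotient of \<open>sin\<close> at 0 with the derivative
  filled in, so the singularity is removable.\<close>

lemma holomorphic_csinc: "csinc holomorphic_on UNIV"
proof -
  have "deriv sin (0::complex) = 1" by (rule DERIV_imp_deriv) (use DERIV_sin[of 0] in simp)
  then have "csinc = (\<lambda>z. if z = 0 then deriv sin 0 else (sin z - sin 0) / (z - 0))"
    by (auto simp: csinc_def fun_eq_iff)
  then show ?thesis using pole_lemma[of sin UNIV 0] by (simp add: holomorphic_on_sin holomorphic_on_ident)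
qed

lemma norm_sin_le_exp: 
  assumes "0 \<le> Im z"
  shows "norm (sin z) \<le> exp (Im z)"
proof -
  have "norm (sin z) = norm (exp (\<i> * z) - exp (- (\<i> * z))) / 2"
    by (simp add: sin_exp_eq norm_divide norm_mult)
  also have "\<dots> \<le> (norm (exp (\<i> * z)) + norm (exp (- (\<i> * z)))) / 2"
    by (intro divide_right_mono norm_triangle_ineq4) simp
  also have "\<dots> = (exp (- Im z) + exp (Im z)) / 2" by (simp add: norm_exp_eq_Re)
  also have "\<dots> \<le> exp (Im z)" using assms by simp
  finally show ?thesis .
qed

lemma csinc_of_real: "csinc (of_real t) = of_real (rsinc t)"
  by (simp add: csinc_def rsinc_def sin_of_real)

text \<open>On the upper half of the circle of radius \<open>R\<close> the entire function \<open>csinc z ^ (2n) * exp (i \<omega> z)\<close> is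
  bounded by \<open>R ^ (-2n)\<close>, because \<open>csinc z ^ (2n)\<close> has exponential type \<open>2n \<le> \<omega>\<close>.\<close>

lemma norm_integral_sinc_power_le:
  fixes n :: nat and \<omega> R :: real
  assumes n: "1 \<le> n" and \<omega>: "real (2 * n) \<le> \<omega>" and R: "1 \<le> R"
  shows "norm (integral {-R..R} (\<lambda>t. of_real (rsinc t ^ (2 * n)) * exp (\<i> * of_real (\<omega> * t)))) \<le> pi / R"
proof -
  define f where "f z = csinc z ^ (2 * n) * exp (\<i> * of_real \<omega> * z)" for z
  have hol: "f holomorphic_on UNIV" unfolding f_def[abs_def]
    by (intro holomorphic_intros holomorphic_csinc)
  have cont: "continuous_on S f" for S using hol holomorphic_on_imp_continuous_on holomorphic_on_subset by blast
  define l a where "l = linepath (- of_real R) (of_real R :: complex)" and "a = part_circlepath 0 R 0 pi"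
  have "contour_integral (l +++ a) f = 0"
    by (rule contour_integral_unique, rule Cauchy_theorem_convex_simple[OF hol])
       (auto simp: l_def a_def exp_Euler)
  moreover have "f contour_integrable_on l" "f contour_integrable_on a"
    unfolding l_def a_def
    by (auto intro!: contour_integrable_continuous_linepath contour_integrable_continuous_part_circlepath cont)
  ultimately have eq: "contour_integral l f = - contour_integral a f"
    by (subst (asm) contour_integral_join) (auto simp: l_def a_def eq_neg_iff_add_eq_0)
  have bd: "norm (f z) \<le> 1 / R ^ 2" if z: "z \<in> path_image a" for z
  proof -
    obtain t where t: "0 \<le> t" "t \<le> pi" "z = of_real R * exp (\<i> * of_real t)"
      using z unfolding a_def path_image_part_circlepath'[of 0 R 0 pi] closed_segment_eq_real_ivl by (auto simp: exp_Euler cis_conv_exp)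
    have nz: "norm z = R" using t R by (simp add: norm_mult)
    then have z0: "z \<noteq> 0" using R by auto
    have im: "0 \<le> Im z" using t R sin_ge_zero[of t] by (simp add: Im_exp)
    have "norm (csinc z) \<le> exp (Im z) / R"
      using norm_sin_le_exp[OF im] nz z0 R by (simp add: csinc_def norm_divide divide_right_mono)
    then have "norm (csinc z) ^ (2 * n) \<le> (exp (Im z) / R) ^ (2 * n)" by (rule power_mono) simp
    also have "\<dots> = exp (real (2 * n) * Im z) / R ^ (2 * n)" by (simp only: power_divide exp_of_nat_mult)
    finally have 1: "norm (csinc z) ^ (2 * n) \<le> exp (real (2 * n) * Im z) / R ^ (2 * n)" .
    have "norm (f z) = norm (csinc z) ^ (2 * n) * exp (- (\<omega> * Im z))"
      by (simp add: f_def norm_mult norm_power norm_exp_eq_Re)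
    also have "\<dots> \<le> (exp (real (2 * n) * Im z) / R ^ (2 * n)) * exp (- (\<omega> * Im z))"
      using 1 by (rule mult_right_mono) simp
    also have "\<dots> = exp ((real (2 * n) - \<omega>) * Im z) / R ^ (2 * n)"
      by (simp add: exp_add[symmetric] left_diff_distrib)
    also have "\<dots> \<le> 1 / R ^ (2 * n)"
    proof (rule divide_right_mono)
      show "exp ((real (2 * n) - \<omega>) * Im z) \<le> 1" using \<omega> im by (simp add: mult_nonpos_nonneg)
    qed (use R in simp)
    \<comment> \<open>One factor \<open>1 / R\<close> must survive multiplication by the arc length
      \<open>pi * R\<close>; the exponent 2, available since \<open>n \<ge> 1\<close>, achieves
      this.\<close>
    also have "\<dots> \<le> 1 / R ^ 2"
      using R n by (intro divide_left_mono power_increasing) auto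
    finally show ?thesis .
  qed
  have "norm (contour_integral a f) \<le> (1 / R ^ 2) * R * (pi - 0)"
    using bd R unfolding a_def
    by (intro has_contour_integral_bound_part_circlepath[OF has_contour_integral_integral[OF \<open>f contour_integrable_on a\<close>[unfolded a_def]]]) auto
  also have "\<dots> = pi / R" using R by (simp add: power2_eq_square)
  finally have "norm (contour_integral l f) \<le> pi / R" by (simp add: eq)
  moreover have "contour_integral l f = integral {-R..R} (\<lambda>t. f (of_real t))"
    unfolding l_def using R by (subst contour_integral_linepath_Reals_eq) auto
  moreover have "f (of_real t) = of_real (rsinc t ^ (2 * n)) * exp (\<i> * of_real (\<omega> * t))" for t
    by (simp only: f_def csinc_of_real of_real_power of_real_mult mult.assoc)
  ultimately show ?thesis by simp
qed

lemma abs_sinc_le: "\<bar>rsinc t\<bar> \<le> 1" "t \<noteq> 0 \<Longrightarrow> \<bar>rsinc t\<bar> \<le> 1 / \<bar>t\<bar>"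
  using abs_sin_x_le_abs_x[of t] abs_sin_le_one[of t]
  by (auto simp: rsinc_def abs_divide divide_le_eq_1 divide_right_mono)

lemma integrable_inverse_one_plus_sq: "integrable lborel (\<lambda>t::real. 1 / (1 + t\<^sup>2))"
  using integrable_inverse_1_plus_square
  by (simp add: set_integrable_def einterval_def inverse_eq_divide)

text \<open>The exponent is even, which makes the kernel nonnegative, and exceeds \<open>q\<close>
  by at least two, so that a weight of degree \<open>q\<close> still leaves quadratic decay.\<close>

lemma weighted_sinc_power_le:
  fixes q :: nat
  shows "(1 + \<bar>t\<bar>) ^ q * rsinc t ^ (2 * Suc q) \<le> 2 * 2 ^ q * (1 / (1 + t\<^sup>2))"
proof (cases "\<bar>t\<bar> \<le> 1")
  case True
  have "(1 + \<bar>t\<bar>) ^ q \<le> 2 ^ q" using True by (intro power_mono) auto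
  moreover have "\<bar>rsinc t\<bar> ^ (2 * Suc q) \<le> 1" by (rule power_le_one) (use abs_sinc_le in auto)
  then have "rsinc t ^ (2 * Suc q) \<le> 1" by (simp add: power_abs[symmetric] power_even_abs)
  ultimately have "(1 + \<bar>t\<bar>) ^ q * rsinc t ^ (2 * Suc q) \<le> 2 ^ q * 1"
    by (intro mult_mono rsinc_power_nonneg) auto
  also have "\<dots> \<le> 2 * 2 ^ q * (1 / (1 + t\<^sup>2))"
  proof -
    have "t\<^sup>2 \<le> 1" using True by (simp add: abs_square_le_1)
    then have "1 / 2 \<le> 1 / (1 + t\<^sup>2)" by (intro divide_left_mono) (auto simp: add_pos_nonneg)
    then have "2 * 2 ^ q * (1 / 2) \<le> 2 * 2 ^ q * (1 / (1 + t\<^sup>2))" by (intro mult_left_mono) auto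
    then show ?thesis by simp
  qed
  finally show ?thesis .
next
  case False
  then have t: "1 < \<bar>t\<bar>" "t \<noteq> 0" by auto
  have "(1 + \<bar>t\<bar>) ^ q \<le> (2 * \<bar>t\<bar>) ^ q" using t by (intro power_mono) auto
  moreover have "\<bar>rsinc t\<bar> ^ (2 * Suc q) \<le> (1 / \<bar>t\<bar>) ^ (2 * Suc q)"
    by (rule power_mono) (use abs_sinc_le(2)[OF t(2)] in auto)
  then have "rsinc t ^ (2 * Suc q) \<le> (1 / \<bar>t\<bar>) ^ (2 * Suc q)" by (simp add: power_abs[symmetric] power_even_abs)
  ultimately have "(1 + \<bar>t\<bar>) ^ q * rsinc t ^ (2 * Suc q) \<le> (2 * \<bar>t\<bar>) ^ q * (1 / \<bar>t\<bar>) ^ (2 * Suc q)"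
    by (intro mult_mono rsinc_power_nonneg) auto
  also have "\<dots> = 2 ^ q * ((1 / \<bar>t\<bar>) ^ q * (1 / t\<^sup>2))"
  proof -
    have "2 * Suc q = q + q + 2" by simp
    then have "(1 / \<bar>t\<bar>) ^ (2 * Suc q) = (1 / \<bar>t\<bar>) ^ q * (1 / \<bar>t\<bar>) ^ q * (1 / \<bar>t\<bar>) ^ 2"
      by (simp only: power_add)
    moreover have "\<bar>t\<bar> ^ q * (1 / \<bar>t\<bar>) ^ q = 1" using t by (simp flip: power_mult_distrib)
    moreover have "(1 / \<bar>t\<bar>) ^ 2 = 1 / t\<^sup>2" by (simp add: power_divide)
    ultimately show ?thesis by (simp add: power_mult_distrib mult_ac)
  qed
  also have "\<dots> \<le> 2 ^ q * (1 * (2 / (1 + t\<^sup>2)))"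
  proof (intro mult_left_mono mult_mono)
    show "(1 / \<bar>t\<bar>) ^ q \<le> 1" using t by (intro power_le_one) auto
    have "1 \<le> t\<^sup>2" using t by (metis abs_ge_zero less_imp_le one_le_power power2_abs)
    then show "1 / t\<^sup>2 \<le> 2 / (1 + t\<^sup>2)" using t(2) by (simp add: field_simps add_pos_nonneg)
  qed auto
  also have "\<dots> = 2 * 2 ^ q * (1 / (1 + t\<^sup>2))" by simp
  finally show ?thesis .
qed

lemma integrable_weighted_sinc_power:
  "integrable lborel (\<lambda>t. (1 + \<bar>t\<bar>) ^ q * rsinc t ^ (2 * Suc q))"
proof (rule Bochner_Integration.integrable_bound[OF integrable_mult_right[OF integrable_inverse_one_plus_sq, of "2 * 2 ^ q"]])
  show "AE t in lborel. norm ((1 + \<bar>t\<bar>) ^ q * rsinc t ^ (2 * Suc q)) \<le> norm (2 * 2 ^ q * (1 / (1 + t\<^sup>2)))"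
  proof (rule AE_I2)
    fix t :: real
    have "0 \<le> (1 + \<bar>t\<bar>) ^ q * rsinc t ^ (2 * Suc q)" by (intro mult_nonneg_nonneg rsinc_power_nonneg zero_le_power) auto
    then show "norm ((1 + \<bar>t\<bar>) ^ q * rsinc t ^ (2 * Suc q)) \<le> norm (2 * 2 ^ q * (1 / (1 + t\<^sup>2)))"
      unfolding real_norm_def using weighted_sinc_power_le[of t q] by linarith
  qed
  show "(\<lambda>t. (1 + \<bar>t\<bar>) ^ q * rsinc t ^ (2 * Suc q)) \<in> borel_measurable lborel" by measurable
qed

lemma integrable_sinc_power: "integrable lborel (\<lambda>t. rsinc t ^ (2 * Suc q))"
proof (rule Bochner_Integration.integrable_bound[OF integrable_weighted_sinc_power[of q]])
  show "(\<lambda>t. rsinc t ^ (2 * Suc q)) \<in> borel_measurable lborel" by measurable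
  show "AE t in lborel. norm (rsinc t ^ (2 * Suc q)) \<le> norm ((1 + \<bar>t\<bar>) ^ q * rsinc t ^ (2 * Suc q))"
  proof (rule AE_I2)
    fix t :: real
    have "1 * \<bar>rsinc t ^ (2 * Suc q)\<bar> \<le> (1 + \<bar>t\<bar>) ^ q * \<bar>rsinc t ^ (2 * Suc q)\<bar>"
      by (intro mult_right_mono one_le_power) auto
    then show "norm (rsinc t ^ (2 * Suc q)) \<le> norm ((1 + \<bar>t\<bar>) ^ q * rsinc t ^ (2 * Suc q))"
      by (simp only: real_norm_def abs_mult) (simp add: power_abs)
  qed
qed

text \<open>The integrals over \<open>[-R, R]\<close> are at most \<open>pi / R\<close> by the
  contour estimate and tend to the full integral by dominated convergence. This is the source of the
  compact support of the transform.\<close>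

lemma fourier_sinc_power_eq_0_pos:
  fixes q :: nat and \<omega> :: real
  assumes \<omega>: "real (2 * Suc q) \<le> \<omega>"
  shows "(\<integral>t. of_real (rsinc t ^ (2 * Suc q)) * exp (\<i> * of_real (\<omega> * t)) \<partial>lborel) = 0"
proof -
  define f where "f t = of_real (rsinc t ^ (2 * Suc q)) * exp (\<i> * of_real (\<omega> * t))" for t
  have int: "integrable lborel f"
  proof (rule Bochner_Integration.integrable_bound[OF integrable_sinc_power[of q]])
    show "f \<in> borel_measurable lborel" unfolding f_def[abs_def] by measurable
    show "AE t in lborel. norm (f t) \<le> norm (rsinc t ^ (2 * Suc q))"
      unfolding f_def norm_mult norm_of_real norm_exp_i_times real_norm_def mult_1_right by (rule AE_I2) (rule order_refl)
  qed
  define g where "g k = (\<integral>t. indicator {-real (Suc k)..real (Suc k)} t *\<^sub>R f t \<partial>lborel)" for k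
  have "g \<longlonglongrightarrow> (\<integral>t. f t \<partial>lborel)"
    unfolding g_def
  proof (rule integral_dominated_convergence[where w="\<lambda>t. norm (f t)"])
    show "AE t in lborel. (\<lambda>k. indicator {-real (Suc k)..real (Suc k)} t *\<^sub>R f t) \<longlonglongrightarrow> f t"
    proof (rule AE_I2, rule tendsto_eventually)
      fix t :: real
      obtain N where N: "\<bar>t\<bar> \<le> real N" using real_arch_simple by blast
      show "\<forall>\<^sub>F k in sequentially. indicator {-real (Suc k)..real (Suc k)} t *\<^sub>R f t = f t"
        using eventually_ge_at_top[of N]
      proof eventually_elim
        case (elim k)
        then have "real N \<le> real (Suc k)" by simp
        then show ?case using N by (auto simp: indicator_def abs_le_iff)
      qed
    qed
  qed (use int in \<open>auto simp: indicator_def\<close>)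
  moreover have "g \<longlonglongrightarrow> 0"
  proof (rule Lim_null_comparison)
    show "\<forall>\<^sub>F k in sequentially. norm (g k) \<le> pi / real (Suc k)"
    proof (rule always_eventually, rule allI)
      fix k
      have "set_integrable lborel {-real (Suc k)..real (Suc k)} f"
        unfolding set_integrable_def using int by (intro integrable_mult_indicator) auto
      then have "g k = integral {-real (Suc k)..real (Suc k)} f"
        unfolding g_def by (subst set_borel_integral_eq_integral(2)[symmetric]) (auto simp: set_lebesgue_integral_def)
      also have "norm \<dots> \<le> pi / real (Suc k)"
        unfolding f_def[abs_def] using \<omega> by (intro norm_integral_sinc_power_le) auto
      finally show "norm (g k) \<le> pi / real (Suc k)" .
    qed
    show "(\<lambda>k. pi / real (Suc k)) \<longlonglongrightarrow> 0"
      by (rule LIMSEQ_Suc) (rule lim_const_over_n)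
  qed
  ultimately show ?thesis unfolding f_def using LIMSEQ_unique by blast
qed

text \<open>The kernel is real, so conjugation reverses the sign of \<open>\<omega>\<close>.\<close>

lemma fourier_sinc_power_eq_0:
  fixes q :: nat and \<omega> :: real
  assumes "real (2 * Suc q) \<le> \<bar>\<omega>\<bar>"
  shows "(\<integral>t. of_real (rsinc t ^ (2 * Suc q)) * exp (\<i> * of_real (\<omega> * t)) \<partial>lborel) = 0"
proof (cases "0 \<le> \<omega>")
  case False
  have "(\<integral>t. of_real (rsinc t ^ (2 * Suc q)) * exp (\<i> * of_real (\<omega> * t)) \<partial>lborel)
      = (\<integral>t. cnj (of_real (rsinc t ^ (2 * Suc q)) * exp (\<i> * of_real ((-\<omega>) * t))) \<partial>lborel)"
    by (simp only: complex_cnj_mult complex_cnj_complex_of_real exp_cnj complex_cnj_i) simp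
  also have "\<dots> = cnj (\<integral>t. of_real (rsinc t ^ (2 * Suc q)) * exp (\<i> * of_real ((-\<omega>) * t)) \<partial>lborel)"
    by (rule Bochner_Integration.integral_cnj)
  also have "\<dots> = 0" using fourier_sinc_power_eq_0_pos[of q "-\<omega>"] assms False by (simp only:) simp
  finally show ?thesis .
qed (use assms fourier_sinc_power_eq_0_pos in auto)

lemma integral_sinc_power_pos: "0 < (\<integral>t. rsinc t ^ (2 * Suc q) \<partial>lborel)"
proof -
  have nn: "0 \<le> rsinc t ^ (2 * Suc q)" for t by (rule rsinc_power_nonneg)
  have "(\<integral>t. rsinc t ^ (2 * Suc q) \<partial>lborel) \<noteq> 0"
  proof
    assume "(\<integral>t. rsinc t ^ (2 * Suc q) \<partial>lborel) = 0"
    then have ae: "AE t in lborel. rsinc t ^ (2 * Suc q) = 0"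
      using integral_nonneg_eq_0_iff_AE[OF integrable_sinc_power[of q]] nn by auto
    have "AE t in lborel. t \<notin> {0<..<pi::real}"
      using ae
    proof eventually_elim
      case (elim t)
      show ?case
      proof
        assume "t \<in> {0<..<pi}"
        then have "0 < sin t" "t \<noteq> 0" by (auto intro: sin_gt_zero)
        then show False using elim by (simp add: rsinc_def)
      qed
    qed
    then have "{0<..<pi::real} \<in> null_sets lborel" by (subst AE_iff_null_sets) auto
    then show False by (auto simp: null_sets_def)
  qed
  moreover have "0 \<le> (\<integral>t. rsinc t ^ (2 * Suc q) \<partial>lborel)" by (rule integral_nonneg_AE) (use nn in auto)
  ultimately show ?thesis by linarith
qed

lemma integral_lborel_prod:
  fixes f :: "'a::euclidean_space \<Rightarrow> real \<Rightarrow> complex"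
  assumes int: "\<And>b. b \<in> Basis \<Longrightarrow> integrable lborel (f b)"
  shows "(\<integral>x. (\<Prod>b\<in>Basis. f b (x \<bullet> b)) \<partial>lborel) = (\<Prod>b\<in>Basis. (\<integral>x. f b x \<partial>lborel))"
proof -
  interpret product_sigma_finite "\<lambda>_::'a. lborel :: real measure"
    by (simp add: product_sigma_finite_def lborel.sigma_finite_measure_axioms)
  have [measurable]: "\<And>b. b \<in> Basis \<Longrightarrow> f b \<in> borel_measurable borel"
    using int borel_measurable_integrable by fastforce
  have eq: "(lborel :: 'a measure) = distr (\<Pi>\<^sub>M b\<in>Basis. (lborel :: real measure)) borel (\<lambda>x. \<Sum>b\<in>Basis. x b *\<^sub>R b)"
    by (subst lborel_def) (simp only: lborel_eq_real)
  have "(\<integral>x. (\<Prod>b\<in>Basis. f b (x \<bullet> b)) \<partial>lborel)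
      = (\<integral>x. (\<Prod>b\<in>Basis. f b ((\<Sum>c\<in>Basis. x c *\<^sub>R c) \<bullet> b)) \<partial>(\<Pi>\<^sub>M b\<in>(Basis::'a set). lborel))"
    by (subst eq, subst integral_distr) simp_all
  also have "\<dots> = (\<integral>x. (\<Prod>b\<in>Basis. f b (x b)) \<partial>(\<Pi>\<^sub>M b\<in>(Basis::'a set). lborel))"
    by (intro Bochner_Integration.integral_cong prod.cong refl) (simp add: inner_sum_left_Basis)
  also have "\<dots> = (\<Prod>b\<in>Basis. (\<integral>x. f b x \<partial>lborel))"
    by (rule product_integral_prod) (auto simp: int)
  finally show ?thesis .
qed

text \<open>Bounds \<open>1 + norm u\<close> by a product over the coordinates, so that a moment of
  a product kernel factors into one-dimensional integrals.\<close>

lemma one_plus_sum_le_prod: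
  fixes a :: "'b \<Rightarrow> real"
  assumes "finite I" "\<And>i. i \<in> I \<Longrightarrow> 0 \<le> a i"
  shows "1 + (\<Sum>i\<in>I. a i) \<le> (\<Prod>i\<in>I. 1 + a i)"
  using assms
proof (induction I rule: finite_induct)
  case (insert i I)
  have "1 + (\<Sum>i\<in>insert i I. a i) = a i + (1 + (\<Sum>i\<in>I. a i))" using insert by simp
  also have "\<dots> \<le> a i * (1 + (\<Sum>i\<in>I. a i)) + (1 + (\<Sum>i\<in>I. a i))"
    using insert.prems by (intro add_right_mono) (simp add: distrib_left sum_nonneg)
  also have "\<dots> = (1 + a i) * (1 + (\<Sum>i\<in>I. a i))" by (simp add: algebra_simps)
  also have "\<dots> \<le> (1 + a i) * (\<Prod>i\<in>I. 1 + a i)"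
    using insert by (intro mult_left_mono) auto
  finally show ?case using insert by simp
qed simp

text \<open>A product of normalised sinc powers, one for each coordinate. The transform factors, so
  it vanishes as soon as one coordinate of the frequency is large, in accordance with the cube in
  \<open>bandlimited\<close>. The exponent \<open>2 * Suc q\<close> is dictated by the moment of
  order \<open>q\<close>.\<close>

lemma ex_bandlimited_kernel:
  fixes q :: nat
  obtains P :: "'a::euclidean_space measure" and K :: "'a \<Rightarrow> real" and B m :: real where
    "borel_prob P" "P = density lborel (\<lambda>x. ennreal (K x))" "continuous_on UNIV K"
    "\<And>x. 0 \<le> K x" "\<And>x. K x \<le> B" "0 < m" "(\<integral>\<^sup>+u. ennreal ((1 + norm u) ^ q) \<partial>P) < \<infinity>"
    "\<And>y b. b \<in> Basis \<Longrightarrow> m \<le> \<bar>y \<bullet> b\<bar> \<Longrightarrow> chf P y = 0"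
proof -
  define I where "I = (\<integral>t. rsinc t ^ (2 * Suc q) \<partial>lborel)"
  have I: "0 < I" unfolding I_def by (rule integral_sinc_power_pos)
  define k where "k t = rsinc t ^ (2 * Suc q) / I" for t
  have k0: "0 \<le> k t" for t unfolding k_def using I by (intro divide_nonneg_pos rsinc_power_nonneg) auto
  have k1: "k t \<le> 1 / I" for t
  proof -
    have "\<bar>rsinc t\<bar> ^ (2 * Suc q) \<le> 1" by (rule power_le_one) (use abs_sinc_le in auto)
    then show ?thesis unfolding k_def using I by (simp only: power_even_abs even_mult_iff even_numeral divide_right_mono less_imp_le simp_thms)
  qed
  have kcont: "continuous_on S k" for S unfolding k_def[abs_def]
    by (intro continuous_intros continuous_on_rsinc) (use I in auto)
  have [measurable]: "k \<in> borel_measurable borel" by (rule borel_measurable_continuous_onI[OF kcont])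
  have ik: "integrable lborel k" unfolding k_def[abs_def] using integrable_sinc_power[of q] by (rule integrable_divide)
  have ik1: "(\<integral>t. k t \<partial>lborel) = 1" unfolding k_def using I by (simp add: I_def del: mult_Suc_right)
  have iw: "integrable lborel (\<lambda>t. (1 + \<bar>t\<bar>) ^ q * k t)"
    unfolding k_def[abs_def] times_divide_eq_right using integrable_weighted_sinc_power[of q] by (rule integrable_divide)
  define K where "K x = (\<Prod>b\<in>Basis. k (x \<bullet> b))" for x :: 'a
  have [measurable]: "K \<in> borel_measurable borel" unfolding K_def[abs_def] by measurable
  have K0: "0 \<le> K x" for x unfolding K_def by (intro prod_nonneg) (use k0 in auto)
  have K1: "K x \<le> (1 / I) ^ DIM('a)" for x
    unfolding K_def using prod_mono[of Basis "\<lambda>b. k (x \<bullet> b)" "\<lambda>_. 1 / I"] k0 k1 by simp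
  have Kcont: "continuous_on UNIV K" unfolding K_def[abs_def]
    by (intro continuous_intros continuous_on_compose2[OF kcont[of UNIV]]) auto
  define P where "P = density lborel (\<lambda>x. ennreal (K x))"
  have eP: "emeasure P (space P) = 1"
  proof -
    have "emeasure P (space P) = (\<integral>\<^sup>+x. (\<Prod>b\<in>Basis. ennreal (k (x \<bullet> b))) \<partial>(lborel :: 'a measure))"
      by (simp add: P_def emeasure_density K_def prod_ennreal k0)
    also have "\<dots> = (\<Prod>b\<in>(Basis::'a set). (\<integral>\<^sup>+t. ennreal (k t) \<partial>lborel))"
      using nn_integral_lborel_prod[of "\<lambda>_::'a. k"] k0 by (simp add: prod_ennreal)
    also have "\<dots> = 1" using ik ik1 k0 by (simp add: nn_integral_eq_integral)
    finally show ?thesis .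
  qed
  have bp: "borel_prob P" unfolding borel_prob_def using eP by (auto intro: prob_spaceI simp: P_def)
  have mom: "(\<integral>\<^sup>+u. ennreal ((1 + norm u) ^ q) \<partial>P) < \<infinity>"
  proof -
    have pt: "K u * (1 + norm u) ^ q \<le> (\<Prod>b\<in>Basis. (1 + \<bar>u \<bullet> b\<bar>) ^ q * k (u \<bullet> b))" for u :: 'a
    proof -
      have "1 + norm u \<le> 1 + (\<Sum>b\<in>Basis. \<bar>u \<bullet> b\<bar>)" by (simp add: norm_le_l1)
      also have "\<dots> \<le> (\<Prod>b\<in>Basis. 1 + \<bar>u \<bullet> b\<bar>)" by (rule one_plus_sum_le_prod) auto
      finally have "(1 + norm u) ^ q \<le> (\<Prod>b\<in>Basis. 1 + \<bar>u \<bullet> b\<bar>) ^ q" by (rule power_mono) auto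
      then have "K u * (1 + norm u) ^ q \<le> K u * (\<Prod>b\<in>Basis. 1 + \<bar>u \<bullet> b\<bar>) ^ q"
        by (rule mult_left_mono) (rule K0)
      then show ?thesis by (simp add: K_def prod.distrib prod_power_distrib mult.commute)
    qed
    have "(\<integral>\<^sup>+u. ennreal ((1 + norm u) ^ q) \<partial>P) = (\<integral>\<^sup>+u. ennreal (K u * (1 + norm u) ^ q) \<partial>lborel)"
      by (simp add: P_def nn_integral_density ennreal_mult K0)
    also have "\<dots> \<le> (\<integral>\<^sup>+u. (\<Prod>b\<in>Basis. ennreal ((1 + \<bar>u \<bullet> b\<bar>) ^ q * k (u \<bullet> b))) \<partial>(lborel :: 'a measure))"
      using pt k0 by (intro nn_integral_mono) (simp add: prod_ennreal ennreal_leI)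
    also have "\<dots> = (\<Prod>b\<in>(Basis::'a set). (\<integral>\<^sup>+t. ennreal ((1 + \<bar>t\<bar>) ^ q * k t) \<partial>lborel))"
      using nn_integral_lborel_prod[of "\<lambda>_::'a. \<lambda>t. (1 + \<bar>t\<bar>) ^ q * k t"] k0 by (simp add: prod_ennreal)
    also have "\<dots> < \<infinity>" using iw k0 by (simp add: nn_integral_eq_integral prod_ennreal ennreal_power)
    finally show ?thesis .
  qed
  \<comment> \<open>The one-dimensional factor vanishes from frequency \<open>Suc q / pi\<close> on;
    \<open>Suc q\<close> is a simpler threshold beyond it.\<close>
  have vanish: "chf P y = 0" if b: "b \<in> Basis" and y: "real (Suc q) \<le> \<bar>y \<bullet> b\<bar>" for y b
  proof -
    define f where "f c t = of_real (k t) * exp (\<i> * of_real (2 * pi * (y \<bullet> c) * t))" for c t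
    have int: "integrable lborel (f c)" for c unfolding f_def[abs_def]
      by (rule Bochner_Integration.integrable_bound[OF ik]) (auto simp: norm_mult norm_exp_eq_Re)
    have [measurable]: "(\<lambda>w. exp (2 * of_real pi * \<i> * of_real (y \<bullet> w)) :: complex) \<in> borel_measurable borel" by measurable
    have "chf P y = (\<integral>w. K w *\<^sub>R exp (2 * of_real pi * \<i> * of_real (y \<bullet> w)) \<partial>lborel)"
      unfolding chf_def P_def by (subst integral_density) (auto simp: K0)
    also have "\<dots> = (\<integral>w. (\<Prod>c\<in>Basis. f c (w \<bullet> c)) \<partial>lborel)"
    proof (rule Bochner_Integration.integral_cong[OF refl])
      fix w
      have "2 * of_real pi * \<i> * of_real (y \<bullet> w) = (\<Sum>c\<in>Basis. \<i> * of_real (2 * pi * (y \<bullet> c) * (w \<bullet> c)) :: complex)"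
        by (subst euclidean_inner) (simp add: sum_distrib_left mult_ac)
      then show "K w *\<^sub>R exp (2 * of_real pi * \<i> * of_real (y \<bullet> w)) = (\<Prod>c\<in>Basis. f c (w \<bullet> c))"
        by (simp only: f_def prod.distrib exp_sum finite_Basis scaleR_conv_of_real K_def of_real_prod)
    qed
    also have "\<dots> = (\<Prod>c\<in>Basis. (\<integral>t. f c t \<partial>lborel))" by (rule integral_lborel_prod) (rule int)
    also have "\<dots> = 0"
    proof (rule prod_zero)
      have "real (2 * Suc q) \<le> \<bar>2 * pi * (y \<bullet> b)\<bar>"
      proof -
        have "2 * real (Suc q) \<le> (2 * pi) * \<bar>y \<bullet> b\<bar>" using y pi_gt3 by (intro mult_mono) auto
        then show ?thesis by (simp add: abs_mult)
      qed
      then have "(\<integral>t. of_real (rsinc t ^ (2 * Suc q)) * exp (\<i> * of_real (2 * pi * (y \<bullet> b) * t)) \<partial>lborel) = 0"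
        by (rule fourier_sinc_power_eq_0)
      then have "(\<integral>t. of_real (rsinc t ^ (2 * Suc q)) * exp (\<i> * of_real (2 * pi * (y \<bullet> b) * t)) / of_real I \<partial>lborel) = 0"
        by (subst integral_divide_zero) (simp only: div_0)
      then have "(\<integral>t. f b t \<partial>lborel) = 0"
        by (simp only: f_def k_def of_real_divide times_divide_eq_left)
      then show "\<exists>c\<in>Basis. (\<integral>t. f c t \<partial>lborel) = 0" using b by blast
    qed simp
    finally show ?thesis .
  qed
  show ?thesis
    by (rule that[of P K "(1 / I) ^ DIM('a)" "real (Suc q)"])
       (use bp P_def Kcont K0 K1 mom vanish in auto)
qed

section \<open>Averages over balls and along the axes\<close>

lemma
  fixes F K :: "'a::euclidean_space \<Rightarrow> real"
  assumes P: "P = density lborel (\<lambda>x. ennreal (K x))" and K[measurable]: "K \<in> borel_measurable borel"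
    and K0: "\<And>x. 0 \<le> K x" and KB: "\<And>x. K x \<le> B" and F: "integrable lborel F" and c: "c \<noteq> 0"
  shows conv_integrable_density: "conv_integrable P c F"
    and conv_density: "conv P c F x = (\<integral>y. K ((1 / c) *\<^sub>R (y - x)) * F y \<partial>lborel) / \<bar>c\<bar> ^ DIM('a)"
proof -
  have [measurable]: "F \<in> borel_measurable borel" using F by (simp add: borel_measurable_integrable)
  have "integrable lborel (\<lambda>w. K w *\<^sub>R F (x + c *\<^sub>R w))" for x
  proof (rule Bochner_Integration.integrable_bound)
    show "integrable lborel (\<lambda>w. B * F (x + c *\<^sub>R w))"
      using integrable_lborel_affine[OF c, of F x] F by simp
    show "AE w in lborel. norm (K w *\<^sub>R F (x + c *\<^sub>R w)) \<le> norm (B * F (x + c *\<^sub>R w))"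
    proof (rule AE_I2)
      fix w
      have "\<bar>K w\<bar> \<le> \<bar>B\<bar>" using K0[of w] KB[of w] by linarith
      then show "norm (K w *\<^sub>R F (x + c *\<^sub>R w)) \<le> norm (B * F (x + c *\<^sub>R w))"
        by (simp add: abs_mult mult_right_mono)
    qed
  qed measurable
  then show "conv_integrable P c F" unfolding conv_integrable_def P by (subst integrable_density) (auto simp: K0)
  have "conv P c F x = (\<integral>w. K w *\<^sub>R F (x + c *\<^sub>R w) \<partial>lborel)"
    unfolding conv_def P by (subst integral_density) (auto simp: K0)
  also have "\<dots> = (\<integral>w. (\<lambda>y. K ((1 / c) *\<^sub>R (y - x)) * F y) (x + c *\<^sub>R w) \<partial>lborel)"
    using c by simp
  also have "\<dots> = (\<integral>y. K ((1 / c) *\<^sub>R (y - x)) * F y \<partial>lborel) / \<bar>c\<bar> ^ DIM('a)"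
    using integral_lborel_affine[OF c, of "\<lambda>y. K ((1 / c) *\<^sub>R (y - x)) * F y" x] c
    by (simp add: field_simps)
  finally show "conv P c F x = (\<integral>y. K ((1 / c) *\<^sub>R (y - x)) * F y \<partial>lborel) / \<bar>c\<bar> ^ DIM('a)" .
qed

text \<open>After the substitution of \<open>conv_density\<close> the variable \<open>x\<close> sits
  in the bounded continuous kernel and \<open>B * \<bar>F y\<bar>\<close> dominates, so continuity
  holds for any integrable \<open>F\<close>.\<close>

lemma bdd_cont_conv_density:
  fixes F K :: "'a::euclidean_space \<Rightarrow> real"
  assumes P: "P = density lborel (\<lambda>x. ennreal (K x))" and Kc: "continuous_on UNIV K"
    and K0: "\<And>x. 0 \<le> K x" and KB: "\<And>x. K x \<le> B" and F: "integrable lborel F" and c: "c \<noteq> 0"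
  shows "bdd_cont (conv P c F)"
proof -
  have K[measurable]: "K \<in> borel_measurable borel" by (rule borel_measurable_continuous_onI[OF Kc])
  have [measurable]: "F \<in> borel_measurable borel" using F by (simp add: borel_measurable_integrable)
  have B: "0 \<le> B" using K0[of 0] KB[of 0] by linarith
  have bd: "\<bar>K z * F y\<bar> \<le> B * \<bar>F y\<bar>" for z y
    using K0[of z] KB[of z] by (simp add: abs_mult mult_right_mono)
  have eq: "conv P c F = (\<lambda>x. (\<integral>y. K ((1 / c) *\<^sub>R (y - x)) * F y \<partial>lborel) / \<bar>c\<bar> ^ DIM('a))"
    by (rule ext, rule conv_density[OF P K K0 KB F c])
  have "continuous_on UNIV (\<lambda>x. \<integral>y. K ((1 / c) *\<^sub>R (y - x)) * F y \<partial>lborel)"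
  proof (rule continuous_on_sequentiallyI)
    fix u :: "nat \<Rightarrow> 'a" and a assume u: "u \<longlonglongrightarrow> a"
    show "(\<lambda>n. \<integral>y. K ((1 / c) *\<^sub>R (y - u n)) * F y \<partial>lborel) \<longlonglongrightarrow> (\<integral>y. K ((1 / c) *\<^sub>R (y - a)) * F y \<partial>lborel)"
    proof (rule integral_dominated_convergence[where w="\<lambda>y. B * \<bar>F y\<bar>"])
      show "AE y in lborel. (\<lambda>n. K ((1 / c) *\<^sub>R (y - u n)) * F y) \<longlonglongrightarrow> K ((1 / c) *\<^sub>R (y - a)) * F y"
      proof (rule AE_I2, intro tendsto_intros)
        fix y
        have "isCont K ((1 / c) *\<^sub>R (y - a))" using Kc by (simp add: continuous_on_eq_continuous_at)
        moreover have "(\<lambda>n. (1 / c) *\<^sub>R (y - u n)) \<longlonglongrightarrow> (1 / c) *\<^sub>R (y - a)" by (intro tendsto_intros u)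
        ultimately show "(\<lambda>n. K ((1 / c) *\<^sub>R (y - u n))) \<longlonglongrightarrow> K ((1 / c) *\<^sub>R (y - a))"
          by (rule isCont_tendsto_compose)
      qed
      show "integrable lborel (\<lambda>y. B * \<bar>F y\<bar>)" using F by simp
      show "AE y in lborel. norm (K ((1 / c) *\<^sub>R (y - u n)) * F y) \<le> B * \<bar>F y\<bar>" for n
        using bd by simp
    qed measurable
  qed
  then have "continuous_on UNIV (conv P c F)" unfolding eq by (intro continuous_intros) (use c in auto)
  moreover have "\<bar>conv P c F x\<bar> \<le> (\<integral>y. B * \<bar>F y\<bar> \<partial>lborel) / \<bar>c\<bar> ^ DIM('a)" for x
  proof -
    have "\<bar>\<integral>y. K ((1 / c) *\<^sub>R (y - x)) * F y \<partial>lborel\<bar> \<le> (\<integral>y. B * \<bar>F y\<bar> \<partial>lborel)"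
    proof -
      have "integrable lborel (\<lambda>y. K ((1 / c) *\<^sub>R (y - x)) * F y)"
        by (rule Bochner_Integration.integrable_bound[of lborel "\<lambda>y. B * \<bar>F y\<bar>"]) (use F bd B in auto)
      then have "(\<integral>y. \<bar>K ((1 / c) *\<^sub>R (y - x)) * F y\<bar> \<partial>lborel) \<le> (\<integral>y. B * \<bar>F y\<bar> \<partial>lborel)"
        using F bd by (intro integral_mono) auto
      then show ?thesis
        using integral_abs_bound[of lborel "\<lambda>y. K ((1 / c) *\<^sub>R (y - x)) * F y"] by linarith
    qed
    then show ?thesis unfolding eq abs_divide by (simp add: divide_right_mono)
  qed
  ultimately show ?thesis unfolding bdd_cont_def by blast
qed

lemma ball_borel_measurable [measurable]: "ball (x::'a::euclidean_space) r \<in> sets borel"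
  by simp

definition ball_unif :: "'a::euclidean_space measure" where
  "ball_unif = density lborel (\<lambda>x. ennreal (indicator (ball 0 1) x / measure lborel (ball (0::'a) 1)))"

lemma measure_unit_ball_pos: "0 < measure lborel (ball (0::'a::euclidean_space) 1)"
  using content_ball_pos[of 1 "0::'a"] by simp

lemma borel_prob_ball_unif: "borel_prob (ball_unif :: 'a::euclidean_space measure)"
proof -
  let ?v = "measure lborel (ball (0::'a) 1)"
  have "emeasure (ball_unif :: 'a measure) (space ball_unif) = (\<integral>\<^sup>+x. ennreal (1 / ?v) * indicator (ball (0::'a) 1) x \<partial>lborel)"
    by (simp add: ball_unif_def emeasure_density) (intro nn_integral_cong, auto simp: indicator_def)
  also have "\<dots> = ennreal (1 / ?v) * emeasure lborel (ball (0::'a) 1)"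
    by (simp add: nn_integral_cmult_indicator)
  also have "\<dots> = ennreal (1 / ?v) * ennreal ?v"
    using emeasure_lborel_ball_finite[of "0::'a" 1] by (subst emeasure_eq_ennreal_measure) auto
  also have "\<dots> = 1" using measure_unit_ball_pos[where 'a='a] by (simp flip: ennreal_mult)
  finally show ?thesis by (auto simp: borel_prob_def ball_unif_def intro: prob_spaceI)
qed

lemma AE_ball_unif: "AE w in ball_unif. norm w < 1"
  unfolding ball_unif_def by (subst AE_density) (auto simp: indicator_def)

lemma conv_ball_unif:
  fixes F :: "'a::euclidean_space \<Rightarrow> real"
  assumes [measurable]: "F \<in> borel_measurable borel"
  shows "conv ball_unif c F x = (\<integral>w. indicator (ball 0 1) w * F (x + c *\<^sub>R w) \<partial>lborel) / measure lborel (ball (0::'a) 1)"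
proof -
  have "conv ball_unif c F x = (\<integral>w. (indicator (ball 0 1) w / measure lborel (ball (0::'a) 1)) *\<^sub>R F (x + c *\<^sub>R w) \<partial>lborel)"
    unfolding conv_def ball_unif_def by (subst integral_density) auto
  then show ?thesis by simp
qed

text \<open>The ball is symmetric. In \<open>diff_averaged_eq\<close> this pairs the nodes on either
  side of \<open>x\<close>.\<close>

lemma conv_ball_unif_minus:
  fixes F :: "'a::euclidean_space \<Rightarrow> real"
  assumes [measurable]: "F \<in> borel_measurable borel"
  shows "conv ball_unif (- c) F x = conv ball_unif c F x"
proof -
  have "(\<integral>w. indicator (ball 0 1) w * F (x + c *\<^sub>R w) \<partial>lborel)
      = (\<integral>w. indicator (ball 0 1) (- w) * F (x + c *\<^sub>R (- w)) \<partial>lborel)"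
    using integral_lborel_affine[of "-1" "\<lambda>w. indicator (ball 0 1) w * F (x + c *\<^sub>R w)" 0] by simp
  then show ?thesis by (simp add: conv_ball_unif indicator_def)
qed

lemma ball_avg_eq_conv:
  fixes F :: "real ^ 'n \<Rightarrow> real"
  assumes [measurable]: "F \<in> borel_measurable borel" and d: "0 < \<delta>"
  shows "ball_avg \<delta> F x = conv ball_unif \<delta> F x"
proof -
  have "(LINT y:ball x \<delta>|lebesgue. F y) = (\<integral>y. indicator (ball x \<delta>) y *\<^sub>R F y \<partial>lborel)"
    unfolding set_lebesgue_integral_def by (rule integral_completion) measurable
  also have "\<dots> = \<delta> ^ CARD('n) * (\<integral>w. indicator (ball x \<delta>) (x + \<delta> *\<^sub>R w) *\<^sub>R F (x + \<delta> *\<^sub>R w) \<partial>lborel)"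
    using integral_lborel_affine[of \<delta> "\<lambda>y. indicator (ball x \<delta>) y *\<^sub>R F y" x] d by simp
  also have "(\<lambda>w. indicator (ball x \<delta>) (x + \<delta> *\<^sub>R w) *\<^sub>R F (x + \<delta> *\<^sub>R w)) = (\<lambda>w. indicator (ball 0 1) w * F (x + \<delta> *\<^sub>R w))"
    using d by (auto simp: fun_eq_iff indicator_def dist_norm)
  finally have "ball_avg \<delta> F x = \<delta> ^ CARD('n) / measure lebesgue (ball (0 :: real ^ 'n) \<delta>)
      * (\<integral>w. indicator (ball 0 1) w * F (x + \<delta> *\<^sub>R w) \<partial>lborel)"
    by (simp add: ball_avg_def)
  also have "measure lebesgue (ball (0 :: real ^ 'n) \<delta>) = \<delta> ^ CARD('n) * measure lborel (ball (0 :: real ^ 'n) 1)"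
    using content_ball_conv_unit_ball[of \<delta> "0 :: real ^ 'n"] d by simp
  finally show ?thesis using d by (simp add: conv_ball_unif)
qed

text \<open>Jensen on each ball, after which the disjoint balls add up to at most the integral over
  the whole space. The common shift \<open>z\<close> is carried along because axis averages and
  differences move all sampling points at once.\<close>

lemma conv_ball_unif_sum_le:
  fixes F :: "'a::euclidean_space \<Rightarrow> real"
  assumes p: "1 \<le> p" and [measurable]: "F \<in> borel_measurable borel" and A: "finite A"
    and sep: "\<And>a b. a \<in> A \<Longrightarrow> b \<in> A \<Longrightarrow> a \<noteq> b \<Longrightarrow> 2 * \<rho> < norm (a - b)" and c: "0 < c" "c \<le> \<rho>"
  shows "(\<Sum>a\<in>A. ennreal (\<bar>conv ball_unif c F (a + z)\<bar> powr p))
    \<le> ennreal (1 / (measure lborel (ball (0::'a) 1) * c ^ DIM('a))) * (\<integral>\<^sup>+y. ennreal (\<bar>F y\<bar> powr p) \<partial>lborel)"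
proof -
  define v where "v = measure lborel (ball (0::'a) 1)"
  have v: "0 < v" unfolding v_def by (rule measure_unit_ball_pos)
  define H where "H y = ennreal (\<bar>F y\<bar> powr p)" for y
  have [measurable]: "H \<in> borel_measurable borel" unfolding H_def[abs_def] by measurable
  interpret U: prob_space "ball_unif :: 'a measure" by (rule borel_probD[OF borel_prob_ball_unif])
  note [measurable_cong] = borel_probD(3)[OF borel_prob_ball_unif]
  have one: "ennreal (\<bar>conv ball_unif c F x\<bar> powr p) \<le> ennreal (1 / (v * c ^ DIM('a))) * (\<integral>\<^sup>+y. H y * indicator (ball x c) y \<partial>lborel)" for x
  proof -
    have "ennreal (\<bar>conv ball_unif c F x\<bar> powr p) \<le> (\<integral>\<^sup>+w. H (x + c *\<^sub>R w) \<partial>ball_unif)"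
      unfolding conv_def H_def by (rule U.abs_integral_powr_le[OF p]) measurable
    also have "\<dots> = (\<integral>\<^sup>+w. ennreal (1 / v) * (H (x + c *\<^sub>R w) * indicator (ball x c) (x + c *\<^sub>R w)) \<partial>lborel)"
      unfolding ball_unif_def v_def[symmetric]
      by (subst nn_integral_density) (use c in \<open>auto intro!: nn_integral_cong simp: indicator_def dist_norm\<close>)
    also have "\<dots> = ennreal (1 / v) * (\<integral>\<^sup>+w. H (x + c *\<^sub>R w) * indicator (ball x c) (x + c *\<^sub>R w) \<partial>lborel)"
      by (rule nn_integral_cmult) measurable
    also have "\<dots> = ennreal (1 / (v * c ^ DIM('a))) * (ennreal (\<bar>c\<bar> ^ DIM('a)) * (\<integral>\<^sup>+w. H (x + c *\<^sub>R w) * indicator (ball x c) (x + c *\<^sub>R w) \<partial>lborel))"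
      using c v by (simp add: mult.assoc[symmetric] flip: ennreal_mult)
    also have "ennreal (\<bar>c\<bar> ^ DIM('a)) * (\<integral>\<^sup>+w. H (x + c *\<^sub>R w) * indicator (ball x c) (x + c *\<^sub>R w) \<partial>lborel)
        = (\<integral>\<^sup>+y. H y * indicator (ball x c) y \<partial>lborel)"
      using c by (intro nn_integral_lborel_affine) auto
    finally show ?thesis .
  qed
  have disj: "(\<Sum>a\<in>A. indicator (ball (a + z) c) y) \<le> (1::ennreal)" for y
  proof (cases "\<exists>a\<in>A. y \<in> ball (a + z) c")
    case True
    then obtain a where a: "a \<in> A" "y \<in> ball (a + z) c" by auto
    have "y \<notin> ball (b + z) c" if b: "b \<in> A" "b \<noteq> a" for b
    proof
      assume "y \<in> ball (b + z) c"
      then have "dist (a + z) y + dist y (b + z) < 2 * c" using a by (simp add: dist_commute)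
      moreover have "dist (a + z) (b + z) \<le> dist (a + z) y + dist y (b + z)" by (rule dist_triangle)
      ultimately show False using sep[of a b] a b c by (auto simp: dist_norm)
    qed
    then have "(\<Sum>a\<in>A. indicator (ball (a + z) c) y) = (\<Sum>b\<in>{a}. indicator (ball (b + z) c) y :: ennreal)"
      using A a by (intro sum.mono_neutral_right) (auto simp: indicator_def)
    also have "\<dots> = 1" using a by (simp del: mem_ball)
    finally show ?thesis by (rule eq_refl)
  next
    case False
    then have "(\<Sum>a\<in>A. indicator (ball (a + z) c) y) = (0::ennreal)" by (intro sum.neutral) (auto simp: indicator_def)
    then show ?thesis by simp
  qed
  have "(\<Sum>a\<in>A. ennreal (\<bar>conv ball_unif c F (a + z)\<bar> powr p))
      \<le> (\<Sum>a\<in>A. ennreal (1 / (v * c ^ DIM('a))) * (\<integral>\<^sup>+y. H y * indicator (ball (a + z) c) y \<partial>lborel))"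
    by (intro sum_mono one)
  also have "\<dots> = ennreal (1 / (v * c ^ DIM('a))) * (\<integral>\<^sup>+y. H y * (\<Sum>a\<in>A. indicator (ball (a + z) c) y) \<partial>lborel)"
    by (simp add: sum_distrib_left nn_integral_sum)
  also have "\<dots> \<le> ennreal (1 / (v * c ^ DIM('a))) * (\<integral>\<^sup>+y. H y * 1 \<partial>lborel)"
    by (intro mult_left_mono nn_integral_mono disj) auto
  finally show ?thesis by (simp add: H_def v_def)
qed

section \<open>Averages along the coordinate axes\<close>

definition seg_unif :: "real measure" where
  "seg_unif = density lborel (\<lambda>t. ennreal (indicator {0..1} t))"

lemma borel_prob_seg_unif: "borel_prob seg_unif"
proof -
  have "emeasure seg_unif (space seg_unif) = emeasure lborel {0..1::real}"
    by (simp add: seg_unif_def emeasure_density ennreal_indicator)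
  then show ?thesis by (auto simp: borel_prob_def seg_unif_def intro: prob_spaceI)
qed

lemma AE_seg_unif: "AE t in seg_unif. t \<in> {0..1}"
  unfolding seg_unif_def by (subst AE_density) (auto simp: indicator_def)

lemma integral_seg_unif:
  fixes f :: "real \<Rightarrow> real"
  assumes f: "continuous_on UNIV f"
  shows "(\<integral>t. f t \<partial>seg_unif) = integral {0..1} f"
proof -
  have [measurable]: "f \<in> borel_measurable borel" by (rule borel_measurable_continuous_onI[OF f])
  have si: "set_integrable lborel {0..1} f"
    by (rule borel_integrable_atLeastAtMost') (rule continuous_on_subset[OF f], simp)
  have "(\<integral>t. f t \<partial>seg_unif) = (\<integral>t. indicator {0..1} t *\<^sub>R f t \<partial>lborel)"
    unfolding seg_unif_def by (subst integral_density) auto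
  also have "\<dots> = integral {0..1} f"
    using set_borel_integral_eq_integral(2)[OF si] by (simp add: set_lebesgue_integral_def)
  finally show ?thesis .
qed

text \<open>Recursion over a list lets one axis average be split off at a time;
  \<open>conv_axes_law_remove1\<close> shows that the order of the list does not affect the averages
  of bounded continuous functions.\<close>

primrec axes_law :: "'n::finite list \<Rightarrow> (real ^ 'n) measure" where
  "axes_law [] = ball_unif"
| "axes_law (i # L) = distr (seg_unif \<Otimes>\<^sub>M axes_law L) borel (\<lambda>(t, w). t *\<^sub>R axis i 1 + w)"

lemma borel_prob_axes_law: "borel_prob (axes_law L)"
proof (induction L)
  case (Cons i L)
  note [measurable_cong] = borel_probD(3)[OF Cons.IH] borel_probD(3)[OF borel_prob_seg_unif]
  interpret U: prob_space seg_unif by (rule borel_probD[OF borel_prob_seg_unif])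
  interpret L: prob_space "axes_law L" by (rule borel_probD[OF Cons.IH])
  interpret UL: pair_prob_space seg_unif "axes_law L" ..
  have "prob_space (axes_law (i # L))" unfolding axes_law.simps by (rule UL.prob_space_distr) measurable
  then show ?case by (simp add: borel_prob_def)
qed (simp add: borel_prob_ball_unif)

lemma AE_axes_law: "AE w in axes_law L. norm w \<le> 1 + real (length L)"
proof (induction L)
  case Nil
  show ?case unfolding axes_law.simps list.size using AE_ball_unif by eventually_elim simp
next
  case (Cons i L)
  note [measurable_cong] = borel_probD(3)[OF borel_prob_axes_law] borel_probD(3)[OF borel_prob_seg_unif]
  interpret U: prob_space seg_unif by (rule borel_probD[OF borel_prob_seg_unif])
  interpret L: prob_space "axes_law L" by (rule borel_probD[OF borel_prob_axes_law])
  interpret UL: pair_prob_space seg_unif "axes_law L" ..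
  have "AE z in seg_unif \<Otimes>\<^sub>M axes_law L. norm (fst z *\<^sub>R axis i 1 + snd z) \<le> 1 + real (length (i # L))"
  proof (rule UL.AE_pair_measure)
    show "{z \<in> space (seg_unif \<Otimes>\<^sub>M axes_law L). norm (fst z *\<^sub>R axis i 1 + snd z) \<le> 1 + real (length (i # L))} \<in> sets (seg_unif \<Otimes>\<^sub>M axes_law L)"
      by measurable
    show "AE t in seg_unif. AE w in axes_law L. norm (fst (t, w) *\<^sub>R axis i 1 + snd (t, w)) \<le> 1 + real (length (i # L))"
      using AE_seg_unif
    proof eventually_elim
      case (elim t)
      show ?case using Cons.IH
      proof eventually_elim
        case (elim w)
        have "norm (t *\<^sub>R axis i 1 + w) \<le> norm (t *\<^sub>R (axis i 1 :: real ^ 'a)) + norm w" by (rule norm_triangle_ineq)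
        also have "\<dots> \<le> 1 + (1 + real (length L))" using elim \<open>t \<in> {0..1}\<close> by (intro add_mono) auto
        finally show ?case by simp
      qed
    qed
  qed
  then show ?case unfolding axes_law.simps by (subst AE_distr_iff) (simp_all add: case_prod_beta)
qed

definition axis_avg :: "real \<Rightarrow> 'n::finite \<Rightarrow> (real ^ 'n \<Rightarrow> real) \<Rightarrow> real ^ 'n \<Rightarrow> real" where
  "axis_avg c i G x = (\<integral>t. G (x + (c * t) *\<^sub>R axis i 1) \<partial>seg_unif)"

lemma conv_axes_law_Cons:
  assumes F: "bdd_cont F"
  shows "conv (axes_law (i # L)) c F = axis_avg c i (conv (axes_law L) c F)"
proof
  fix x
  note [measurable] = bdd_cont_measurable[OF F]
  note [measurable_cong] = borel_probD(3)[OF borel_prob_axes_law] borel_probD(3)[OF borel_prob_seg_unif]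
  interpret U: prob_space seg_unif by (rule borel_probD[OF borel_prob_seg_unif])
  interpret L: prob_space "axes_law L" by (rule borel_probD[OF borel_prob_axes_law])
  interpret UL: pair_prob_space seg_unif "axes_law L" ..
  obtain B where B: "\<And>x. \<bar>F x\<bar> \<le> B" using F by (auto simp: bdd_cont_def)
  have "conv (axes_law (i # L)) c F x = (\<integral>z. F (x + c *\<^sub>R (fst z *\<^sub>R axis i 1 + snd z)) \<partial>(seg_unif \<Otimes>\<^sub>M axes_law L))"
    unfolding conv_def axes_law.simps by (subst integral_distr) (auto simp: case_prod_beta)
  also have "\<dots> = (\<integral>t. (\<integral>w. F (x + c *\<^sub>R (t *\<^sub>R axis i 1 + w)) \<partial>axes_law L) \<partial>seg_unif)"
    by (subst UL.integral_fst'[symmetric])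
       (use B in \<open>auto intro!: UL.P.integrable_const_bound[of _ B]\<close>)
  also have "\<dots> = axis_avg c i (conv (axes_law L) c F) x"
    by (simp add: axis_avg_def conv_def scaleR_add_right add.assoc)
  finally show "conv (axes_law (i # L)) c F x = axis_avg c i (conv (axes_law L) c F) x" .
qed

lemma axis_avg_commute:
  assumes G: "bdd_cont G"
  shows "axis_avg c i (axis_avg c j G) = axis_avg c j (axis_avg c i G)"
proof
  fix x
  note [measurable] = bdd_cont_measurable[OF G]
  note [measurable_cong] = borel_probD(3)[OF borel_prob_seg_unif]
  interpret U: prob_space seg_unif by (rule borel_probD[OF borel_prob_seg_unif])
  interpret UU: pair_prob_space seg_unif seg_unif ..
  obtain B where B: "\<And>x. \<bar>G x\<bar> \<le> B" using G by (auto simp: bdd_cont_def)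
  have "integrable (seg_unif \<Otimes>\<^sub>M seg_unif) (\<lambda>(s, t). G (x + (c * s) *\<^sub>R axis i 1 + (c * t) *\<^sub>R axis j 1))"
    by (rule UU.P.integrable_const_bound[of _ B]) (use B in auto)
  from UU.Fubini_integral[OF this]
  show "axis_avg c i (axis_avg c j G) x = axis_avg c j (axis_avg c i G) x"
    by (simp add: axis_avg_def add_ac)
qed

lemma bdd_cont_conv_axes_law: "bdd_cont F \<Longrightarrow> bdd_cont (conv (axes_law L) c F)"
  by (rule bdd_cont_conv[OF borel_prob_axes_law])

text \<open>Axis averages commute, so an average along \<open>i\<close> may be taken as the
  outermost one, which is where \<open>has_derivative_axis_avg\<close> can differentiate it.\<close>

lemma conv_axes_law_remove1:
  assumes F: "bdd_cont F" and "i \<in> set L"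
  shows "conv (axes_law L) c F = conv (axes_law (i # remove1 i L)) c F"
  using assms(2)
proof (induction L)
  case (Cons j L)
  show ?case
  proof (cases "i = j")
    case False
    then have "conv (axes_law (j # L)) c F = axis_avg c j (conv (axes_law (i # remove1 i L)) c F)"
      using Cons by (simp only: conv_axes_law_Cons[OF F]) auto
    also have "\<dots> = axis_avg c i (axis_avg c j (conv (axes_law (remove1 i L)) c F))"
      unfolding conv_axes_law_Cons[OF F] by (rule axis_avg_commute[OF bdd_cont_conv_axes_law[OF F]])
    finally show ?thesis using False by (simp add: conv_axes_law_Cons[OF F] del: axes_law.simps)
  qed simp
qed simp

text \<open>Disjointness is used for the innermost ball average. Each axis average is a mean over
  shifts common to all points, absorbed by the arbitrary \<open>z\<close>, so the constant is the
  one for the ball, whatever \<open>L\<close> is.\<close>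

lemma conv_axes_law_sum_le:
  fixes F :: "real ^ 'n \<Rightarrow> real"
  assumes p: "1 \<le> p" and F: "bdd_cont F" and A: "finite A"
    and sep: "\<And>a b. a \<in> A \<Longrightarrow> b \<in> A \<Longrightarrow> a \<noteq> b \<Longrightarrow> 2 * \<rho> < norm (a - b)" and c: "0 < c" "c \<le> \<rho>"
  shows "(\<Sum>a\<in>A. ennreal (\<bar>conv (axes_law L) c F (a + z)\<bar> powr p))
    \<le> ennreal (1 / (measure lborel (ball (0 :: real ^ 'n) 1) * c ^ CARD('n))) * (\<integral>\<^sup>+y. ennreal (\<bar>F y\<bar> powr p) \<partial>lborel)"
proof (induction L arbitrary: z)
  case Nil
  show ?case using conv_ball_unif_sum_le[OF p bdd_cont_measurable[OF F] A sep c, of z] by simp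
next
  case (Cons i L)
  note [measurable_cong] = borel_probD(3)[OF borel_prob_seg_unif]
  interpret U: prob_space seg_unif by (rule borel_probD[OF borel_prob_seg_unif])
  let ?D = "ennreal (1 / (measure lborel (ball (0 :: real ^ 'n) 1) * c ^ CARD('n))) * (\<integral>\<^sup>+y. ennreal (\<bar>F y\<bar> powr p) \<partial>lborel)"
  note [measurable] = bdd_cont_measurable[OF bdd_cont_conv_axes_law[OF F]]
  have "(\<Sum>a\<in>A. ennreal (\<bar>conv (axes_law (i # L)) c F (a + z)\<bar> powr p))
      \<le> (\<Sum>a\<in>A. \<integral>\<^sup>+t. ennreal (\<bar>conv (axes_law L) c F (a + z + (c * t) *\<^sub>R axis i 1)\<bar> powr p) \<partial>seg_unif)"
    unfolding conv_axes_law_Cons[OF F] axis_avg_def by (intro sum_mono U.abs_integral_powr_le[OF p]) measurable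
  also have "\<dots> = (\<integral>\<^sup>+t. (\<Sum>a\<in>A. ennreal (\<bar>conv (axes_law L) c F (a + z + (c * t) *\<^sub>R axis i 1)\<bar> powr p)) \<partial>seg_unif)"
    by (subst nn_integral_sum) auto
  also have "\<dots> \<le> (\<integral>\<^sup>+t. ?D \<partial>seg_unif)"
    by (intro nn_integral_mono) (use Cons.IH in \<open>simp add: add.assoc\<close>)
  also have "\<dots> = ?D" by (simp add: U.emeasure_space_1)
  finally show ?case .
qed

section \<open>Derivatives of axis averages\<close>

definition diff_quot :: "real \<Rightarrow> 'n::finite \<Rightarrow> (real ^ 'n \<Rightarrow> real) \<Rightarrow> real ^ 'n \<Rightarrow> real" where
  "diff_quot c i F x = dif (c *\<^sub>R axis i 1) F x / c"

lemma bdd_cont_diff_quot: "bdd_cont F \<Longrightarrow> bdd_cont (diff_quot c i F)"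
  unfolding diff_quot_def[abs_def] using bdd_cont_cmult[OF bdd_cont_dif, of F "1 / c"] by simp

lemma conv_diff_quot:
  assumes F: "bdd_cont F"
  shows "conv (axes_law L) c' (diff_quot c i F) = diff_quot c i (conv (axes_law L) c' F)"
proof
  fix x
  have "conv (axes_law L) c' (diff_quot c i F) x = conv (axes_law L) c' (dif (c *\<^sub>R axis i 1) F) x / c"
    by (simp add: conv_def diff_quot_def)
  then show "conv (axes_law L) c' (diff_quot c i F) x = diff_quot c i (conv (axes_law L) c' F) x"
    by (simp add: diff_quot_def dif_conv[OF bdd_cont_conv_integrable[OF borel_prob_axes_law F]])
qed

text \<open>Along the axis the average is \<open>(\<Gamma> (t + c) - \<Gamma> t) / c\<close> for a
  primitive \<open>\<Gamma>\<close>, so continuity of \<open>G\<close> makes it differentiable, with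
  a difference quotient of \<open>G\<close> as derivative.\<close>

lemma has_derivative_axis_avg:
  fixes G :: "real ^ 'n \<Rightarrow> real"
  assumes G: "bdd_cont G" and c: "0 < c"
  shows "((\<lambda>t. axis_avg c i G (x + t *\<^sub>R axis i 1)) has_real_derivative diff_quot c i G x) (at 0)"
proof -
  define g where "g u = G (x + u *\<^sub>R axis i 1)" for u
  have g: "continuous_on S g" for S
    unfolding g_def[abs_def]
    by (rule continuous_on_compose2[of UNIV G]) (use G in \<open>auto simp: bdd_cont_def intro!: continuous_intros\<close>)
  \<comment> \<open>The lower limit -1 puts both 0 and \<open>c\<close> into the interior of the
    interval on which \<open>\<Gamma>\<close> is differentiated.\<close>
  define \<Gamma> where "\<Gamma> u = integral {-1..u} g" for u
  have \<Gamma>': "(\<Gamma> has_real_derivative g u) (at u)" if "u \<in> {-1<..<c + 1}" for u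
  proof -
    have "(\<Gamma> has_real_derivative g u) (at u within {-1..c + 1})"
      unfolding \<Gamma>_def[abs_def] using that by (intro integral_has_real_derivative g) auto
    moreover have "at u within {-1..c + 1} = at u"
      using that by (intro at_within_interior) (auto simp: interior_atLeastAtMost_real)
    ultimately show ?thesis by simp
  qed
  have axis_avg: "axis_avg c i G (x + t *\<^sub>R axis i 1) = (\<Gamma> (t + c) - \<Gamma> t) / c" if t: "t \<in> {-1<..<1}" for t
  proof -
    have "axis_avg c i G (x + t *\<^sub>R axis i 1) = (\<integral>s. g (t + c * s) \<partial>seg_unif)"
      by (simp add: axis_avg_def g_def scaleR_left.add add.assoc)
    also have "\<dots> = integral {0..1} (\<lambda>s. g (t + c * s))"
      by (rule integral_seg_unif, rule continuous_on_compose2[OF g[of UNIV]]) (auto intro!: continuous_intros)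
    also have "\<dots> = \<Gamma> (t + c * 1) / c - \<Gamma> (t + c * 0) / c"
    proof (rule integral_unique, rule fundamental_theorem_of_calculus)
      fix s :: real assume s: "s \<in> {0..1}"
      have "0 \<le> c * s" "c * s \<le> c" using s c by (auto simp: mult_left_le)
      then have "t + c * s \<in> {-1<..<c + 1}" using t by auto
      then have "(\<Gamma> has_real_derivative g (t + c * s)) (at (t + c * s))" by (rule \<Gamma>')
      moreover have "((\<lambda>s. t + c * s) has_real_derivative c) (at s within {0..1})"
        by (auto intro!: derivative_eq_intros)
      ultimately have "((\<lambda>s. \<Gamma> (t + c * s)) has_real_derivative g (t + c * s) * c) (at s within {0..1})"
        by (rule DERIV_chain2)
      then have "((\<lambda>s. \<Gamma> (t + c * s) / c) has_real_derivative g (t + c * s) * c / c) (at s within {0..1})"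
        by (rule DERIV_cdivide)
      then show "((\<lambda>s. \<Gamma> (t + c * s) / c) has_vector_derivative g (t + c * s)) (at s within {0..1})"
        using c by (simp add: has_real_derivative_iff_has_vector_derivative)
    qed simp
    finally show ?thesis by (simp add: diff_divide_distrib)
  qed
  have d1: "((\<lambda>t. \<Gamma> (t + c)) has_real_derivative g (0 + c) * 1) (at 0)"
  proof (rule DERIV_chain2[where f=\<Gamma> and g="\<lambda>t. t + c"])
    show "(\<Gamma> has_real_derivative g (0 + c)) (at (0 + c))" using c by (intro \<Gamma>') auto
    show "((\<lambda>t. t + c) has_real_derivative 1) (at 0)" by (auto intro!: derivative_eq_intros)
  qed
  have d2: "(\<Gamma> has_real_derivative g 0) (at 0)" using c by (intro \<Gamma>') auto
  have "((\<lambda>t. (\<Gamma> (t + c) - \<Gamma> t) / c) has_real_derivative (g (0 + c) * 1 - g 0) / c) (at 0)"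
    by (rule DERIV_cdivide[OF DERIV_diff[OF d1 d2]])
  moreover have "\<forall>\<^sub>F t in nhds 0. axis_avg c i G (x + t *\<^sub>R axis i 1) = (\<Gamma> (t + c) - \<Gamma> t) / c"
    using eventually_nhds_in_open[of "{-1<..<1::real}" 0] by (auto elim!: eventually_mono simp: axis_avg)
  ultimately show ?thesis
    by (subst DERIV_cong_ev[OF refl _ refl, of _ "\<lambda>t. (\<Gamma> (t + c) - \<Gamma> t) / c"]) (auto simp: g_def diff_quot_def dif_def)
qed

text \<open>Stated for a linear combination with its own scale in each term, the shape of
  \<open>jackson\<close>, because \<open>deriv\<close> is additive only on differentiable
  functions.\<close>

lemma partial_deriv_sum_conv:
  fixes F :: "'k \<Rightarrow> real ^ 'n \<Rightarrow> real"
  assumes i: "i \<in> set L" and F: "\<And>k. k \<in> I \<Longrightarrow> bdd_cont (F k)" and c: "\<And>k. k \<in> I \<Longrightarrow> 0 < c k"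
  shows "partial_deriv i (\<lambda>x. \<Sum>k\<in>I. a k * conv (axes_law L) (c k) (F k) x)
    = (\<lambda>x. \<Sum>k\<in>I. a k * conv (axes_law (remove1 i L)) (c k) (diff_quot (c k) i (F k)) x)"
proof
  fix x
  have "((\<lambda>t. \<Sum>k\<in>I. a k * conv (axes_law L) (c k) (F k) (x + t *\<^sub>R axis i 1)) has_real_derivative
      (\<Sum>k\<in>I. a k * conv (axes_law (remove1 i L)) (c k) (diff_quot (c k) i (F k)) x)) (at 0)"
  proof (intro DERIV_sum DERIV_cmult)
    fix k assume k: "k \<in> I"
    show "((\<lambda>t. conv (axes_law L) (c k) (F k) (x + t *\<^sub>R axis i 1)) has_real_derivative
        conv (axes_law (remove1 i L)) (c k) (diff_quot (c k) i (F k)) x) (at 0)"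
      unfolding conv_axes_law_remove1[OF F[OF k] i] conv_axes_law_Cons[OF F[OF k]] conv_diff_quot[OF F[OF k]]
      by (rule has_derivative_axis_avg[OF bdd_cont_conv_axes_law[OF F[OF k]] c[OF k]])
  qed
  then show "partial_deriv i (\<lambda>x. \<Sum>k\<in>I. a k * conv (axes_law L) (c k) (F k) x) x
      = (\<Sum>k\<in>I. a k * conv (axes_law (remove1 i L)) (c k) (diff_quot (c k) i (F k)) x)"
    unfolding partial_deriv_def by (rule DERIV_imp_deriv)
qed

text \<open>Every derivative uses up one axis average in its own direction. With \<open>s\<close>
  copies of each axis in \<open>L\<close>, all multi-indices of order \<open>s\<close> are served,
  in any order of differentiation.\<close>

lemma fold_partial_deriv_sum_conv:
  fixes F :: "'k \<Rightarrow> real ^ 'n \<Rightarrow> real"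
  assumes "\<And>i. count_list is i \<le> count_list L i"
    and "\<And>k. k \<in> I \<Longrightarrow> bdd_cont (F k)" and c: "\<And>k. k \<in> I \<Longrightarrow> 0 < c k"
  shows "fold partial_deriv is (\<lambda>x. \<Sum>k\<in>I. a k * conv (axes_law L) (c k) (F k) x)
    = (\<lambda>x. \<Sum>k\<in>I. a k * conv (axes_law (fold remove1 is L)) (c k) (fold (diff_quot (c k)) is (F k)) x)"
  using assms(1,2)
proof (induction "is" arbitrary: L F)
  case (Cons i "is")
  have "0 < count_list L i" using Cons.prems(1)[of i] by simp
  then have i: "i \<in> set L" by (metis count_list_0_iff less_numeral_extra(3))
  have sample_measure: "count_list is j \<le> count_list (remove1 i L) j" for j
  proof -
    have "count_list (remove1 i L) j = count_list L j - (if i = j then 1 else 0)"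
      by (simp add: count_mset[symmetric])
    then show ?thesis using Cons.prems(1)[of j] by (auto split: if_splits)
  qed
  show ?case
    using Cons.IH[of "remove1 i L" "\<lambda>k. diff_quot (c k) i (F k)"] sample_measure Cons.prems(2) i c
    by (simp add: partial_deriv_sum_conv bdd_cont_diff_quot)
qed simp

lemma mixed_diff_cong: "(\<And>j. j < n \<Longrightarrow> V j = W j) \<Longrightarrow> mixed_diff V n F = mixed_diff W n F"
  by (induction n) auto

text \<open>Brings iterated quotients into the form to which \<open>nrm_mixed_diff_le\<close>
  applies; the power of \<open>c\<close> in the denominator later yields
  \<open>\<sigma> ^ s\<close>.\<close>

lemma fold_diff_quot: "fold (diff_quot c) is F x = mixed_diff (\<lambda>j. c *\<^sub>R axis (is ! j) 1) (length is) F x / c ^ length is"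
proof (induction "is" arbitrary: x rule: rev_induct)
  case (snoc i "is")
  let ?V = "\<lambda>j. c *\<^sub>R axis (is ! j) (1::real)" and ?W = "\<lambda>j. c *\<^sub>R axis ((is @ [i]) ! j) (1::real)"
  have eq: "mixed_diff ?W (length is) F = mixed_diff ?V (length is) F"
    by (rule mixed_diff_cong) (simp add: nth_append)
  have "fold (diff_quot c) (is @ [i]) F x = diff_quot c i (fold (diff_quot c) is F) x" by simp
  also have "\<dots> = (mixed_diff ?V (length is) F (x + c *\<^sub>R axis i 1) / c ^ length is - mixed_diff ?V (length is) F x / c ^ length is) / c"
    by (simp only: diff_quot_def[of c i "fold (diff_quot c) is F"] dif_def snoc.IH)
  also have "\<dots> = (mixed_diff ?W (length is) F (x + ?W (length is)) - mixed_diff ?W (length is) F x) / c ^ length (is @ [i])"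
    unfolding eq by (simp add: diff_divide_distrib mult.commute)
  finally show ?case by (simp add: dif_def)
qed simp

lemma bdd_cont_fold_diff_quot: "bdd_cont F \<Longrightarrow> bdd_cont (fold (diff_quot c) is F)"
  by (induction "is" arbitrary: F) (auto simp: bdd_cont_diff_quot)

lemma ex_list_counts: "\<exists>is. \<forall>i::'n::finite. count_list is i = \<alpha> i"
proof -
  obtain "is" where "mset is = (\<Sum>i\<in>UNIV. replicate_mset (\<alpha> i) i)" using ex_mset by blast
  then have "count_list is i = \<alpha> i" for i by (simp add: count_mset[symmetric] count_sum)
  then show ?thesis by blast
qed

lemma length_eq_sum_counts: "length is = (\<Sum>i\<in>UNIV. count_list is (i::'n::finite))"
proof -
  have "length is = (\<Sum>i\<in>set is. count_list is i)" by (rule sum_count_set[symmetric]) auto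
  also have "\<dots> = (\<Sum>i\<in>UNIV. count_list is i)" by (rule sum.mono_neutral_left) (auto simp: count_list_0_iff)
  finally show ?thesis .
qed

text \<open>Replaces the choice in \<open>multi_deriv\<close> by a list of which the counts and the
  length are known.\<close>

lemma multi_deriv_list:
  obtains "is" where "multi_deriv \<alpha> f = fold partial_deriv is f" "\<And>i::'n::finite. count_list is i = \<alpha> i"
    "length is = (\<Sum>i\<in>UNIV. \<alpha> i)"
proof -
  let ?is = "SOME is. \<forall>i. count_list is i = \<alpha> i"
  have "\<forall>i. count_list ?is i = \<alpha> i" by (rule someI_ex[OF ex_list_counts])
  then show ?thesis using that[of ?is] by (simp add: multi_deriv_def length_eq_sum_counts)
qed

section \<open>Sampled norms\<close>

text \<open>With this weighted counting measure the sampled norm is an instance of \<open>nrm\<close>.\<close>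

definition sample_measure :: "real \<Rightarrow> (real ^ 'n) set \<Rightarrow> (real ^ 'n) measure" where
  "sample_measure \<sigma> A = scale_measure (ennreal (1 / \<sigma> ^ CARD('n))) (count_space A)"

lemma borel_measurable_sample_measure: "f \<in> borel_measurable (sample_measure \<sigma> A)"
  unfolding sample_measure_def by (subst measurable_cong_sets[OF sets_scale_measure refl]) simp

lemma nn_integral_sample_measure:
  fixes A :: "(real ^ 'n) set"
  assumes "finite A"
  shows "(\<integral>\<^sup>+a. f a \<partial>sample_measure \<sigma> A) = ennreal (1 / \<sigma> ^ CARD('n)) * (\<Sum>a\<in>A. f a)"
  unfolding sample_measure_def using assms
  by (subst nn_integral_scale_measure) (auto simp: nn_integral_count_space_finite)

lemma sigma_finite_sample_measure: "finite A \<Longrightarrow> sigma_finite_measure (sample_measure \<sigma> A)"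
proof -
  assume A: "finite A"
  have "finite_measure (sample_measure \<sigma> A)"
    by (rule finite_measureI) (use A in \<open>auto simp: sample_measure_def space_scale_measure ennreal_mult_eq_top_iff of_nat_less_top\<close>)
  then show ?thesis by (simp add: finite_measure_def)
qed

lemma lp_norm_finite: "finite A \<Longrightarrow> lp_norm p \<sigma> A f = nrm p (sample_measure \<sigma> A) f"
  by (simp add: lp_norm_def nrm_def nn_integral_sample_measure)

lemma lp_norm_mono:
  assumes p: "0 < p" and A: "finite A" "A \<subseteq> X"
  shows "lp_norm p \<sigma> A f \<le> lp_norm p \<sigma> X f"
  unfolding lp_norm_def
proof (intro enn_root_mono p mult_left_mono)
  show "(\<Sum>\<^sub>\<infinity>\<xi>\<in>A. ennreal (\<bar>f \<xi>\<bar> powr p)) \<le> (\<Sum>\<^sub>\<infinity>\<xi>\<in>X. ennreal (\<bar>f \<xi>\<bar> powr p))"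
    unfolding nonneg_infsum_complete[of X "\<lambda>\<xi>. ennreal (\<bar>f \<xi>\<bar> powr p)", OF zero_le] using A
    by (auto intro!: SUP_upper)
qed simp

text \<open>An infinite sum of nonnegative terms is the supremum of its finite partial sums. Hence
  bounds uniform in finite \<open>A\<close> suffice, and for finite \<open>A\<close> the measure is
  sigma-finite, as \<open>nrm_integral_le\<close> requires.\<close>

lemma lp_norm_leI:
  assumes p: "0 < p" and A: "\<And>A. finite A \<Longrightarrow> A \<subseteq> X \<Longrightarrow> nrm p (sample_measure \<sigma> A) f \<le> b"
  shows "lp_norm p \<sigma> X f \<le> b"
proof (rule ennreal_le_real_boundI)
  fix c assume c: "0 \<le> c" "b \<le> ennreal c"
  have *: "ennreal (1 / \<sigma> ^ CARD('a)) * (\<Sum>a\<in>A. ennreal (\<bar>f a\<bar> powr p)) \<le> ennreal (c powr p)"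
    if "finite A" "A \<subseteq> X" for A
    using order_trans[OF A[OF that] c(2)] p c(1) that by (simp add: nrm_le_iff nn_integral_sample_measure)
  have "ennreal (1 / \<sigma> ^ CARD('a)) * (\<Sum>\<^sub>\<infinity>\<xi>\<in>X. ennreal (\<bar>f \<xi>\<bar> powr p)) \<le> ennreal (c powr p)"
    unfolding nonneg_infsum_complete[of X "\<lambda>\<xi>. ennreal (\<bar>f \<xi>\<bar> powr p)", OF zero_le]
    unfolding SUP_mult_left_ennreal using * by (intro SUP_least) blast
  then show "lp_norm p \<sigma> X f \<le> ennreal c" unfolding lp_norm_def using p c by (simp add: enn_root_le_iff)
qed

lemma lp_norm_add:
  assumes p: "1 \<le> p"
  shows "lp_norm p \<sigma> X (\<lambda>\<xi>. f \<xi> + g \<xi>) \<le> lp_norm p \<sigma> X f + lp_norm p \<sigma> X g"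
proof (rule lp_norm_leI)
  fix A assume A: "finite A" "A \<subseteq> X"
  have "nrm p (sample_measure \<sigma> A) (\<lambda>\<xi>. f \<xi> + g \<xi>) \<le> nrm p (sample_measure \<sigma> A) f + nrm p (sample_measure \<sigma> A) g"
    by (rule nrm_add[OF p borel_measurable_sample_measure borel_measurable_sample_measure])
  also have "\<dots> \<le> lp_norm p \<sigma> X f + lp_norm p \<sigma> X g"
    using p A unfolding lp_norm_finite[OF A(1), symmetric] by (intro add_mono lp_norm_mono) auto
  finally show "nrm p (sample_measure \<sigma> A) (\<lambda>\<xi>. f \<xi> + g \<xi>) \<le> lp_norm p \<sigma> X f + lp_norm p \<sigma> X g" .
qed (use p in auto)

lemma lp_norm_minus: "lp_norm p \<sigma> X (\<lambda>\<xi>. - f \<xi>) = lp_norm p \<sigma> X f"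
  by (simp add: lp_norm_def)

lemma lp_norm_diff:
  assumes p: "1 \<le> p"
  shows "lp_norm p \<sigma> X (\<lambda>\<xi>. f \<xi> - g \<xi>) \<le> lp_norm p \<sigma> X f + lp_norm p \<sigma> X g"
  using lp_norm_add[OF p, of \<sigma> X f "\<lambda>\<xi>. - g \<xi>"] by (simp add: lp_norm_minus)

definition sep_finite :: "real \<Rightarrow> (real ^ 'n) set \<Rightarrow> bool" where
  "sep_finite \<rho> A \<longleftrightarrow> finite A \<and> (\<forall>a\<in>A. \<forall>b\<in>A. a \<noteq> b \<longrightarrow> 2 * \<rho> < norm (a - b))"

text \<open>The weight \<open>1 / \<sigma> ^ d\<close> of a sampling point divided by the volume of
  a ball of radius \<open>\<theta> / \<sigma>\<close>, raised to \<open>1 / p\<close>, with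
  \<open>d\<close> the dimension. Here \<open>\<sigma>\<close> cancels, which makes the constants
  independent of it. The type argument carries the dimension.\<close>

definition samp_const :: "'n::finite itself \<Rightarrow> real \<Rightarrow> real \<Rightarrow> real" where
  "samp_const _ p \<theta> = (1 / (measure lborel (ball (0 :: real ^ 'n) 1) * \<theta> ^ CARD('n))) powr (1 / p)"

lemma samp_const_nonneg [simp]: "0 \<le> samp_const TYPE('n::finite) p \<theta>"
  by (simp add: samp_const_def)

lemma samp_const_antimono:
  assumes "1 \<le> p" "0 < a" "a \<le> b"
  shows "samp_const TYPE('n::finite) p b \<le> samp_const TYPE('n) p a"
  unfolding samp_const_def using assms measure_unit_ball_pos[where 'a="real ^ 'n"]
  by (intro powr_mono2 divide_left_mono mult_left_mono power_mono mult_pos_pos) auto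

lemma nrm_sample_measure_leI:
  fixes G :: "real ^ 'n \<Rightarrow> real"
  assumes p: "1 \<le> p" and A: "finite A" and sg: "0 < \<sigma>" and \<theta>: "0 < \<theta>" and w: "0 \<le> w" "nrm p lborel F \<le> ennreal w"
    and le: "(\<Sum>a\<in>A. ennreal (\<bar>G a\<bar> powr p))
      \<le> ennreal (1 / (measure lborel (ball (0 :: real ^ 'n) 1) * (\<theta> / \<sigma>) ^ CARD('n))) * (\<integral>\<^sup>+y. ennreal (\<bar>F y\<bar> powr p) \<partial>lborel)"
  shows "nrm p (sample_measure \<sigma> A) G \<le> ennreal (samp_const TYPE('n) p \<theta> * w)"
proof -
  define v where "v = measure lborel (ball (0 :: real ^ 'n) 1)"
  have v: "0 < v" unfolding v_def by (rule measure_unit_ball_pos)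
  have "(\<integral>\<^sup>+a. ennreal (\<bar>G a\<bar> powr p) \<partial>sample_measure \<sigma> A) = ennreal (1 / \<sigma> ^ CARD('n)) * (\<Sum>a\<in>A. ennreal (\<bar>G a\<bar> powr p))"
    using A by (rule nn_integral_sample_measure)
  also have "\<dots> \<le> ennreal (1 / \<sigma> ^ CARD('n)) * (ennreal (1 / (v * (\<theta> / \<sigma>) ^ CARD('n))) * ennreal (w powr p))"
    using w p by (intro mult_left_mono order_trans[OF le]) (auto simp: nrm_le_iff v_def intro!: mult_left_mono)
  also have "\<dots> = ennreal (1 / \<sigma> ^ CARD('n) * (1 / (v * (\<theta> / \<sigma>) ^ CARD('n)) * w powr p))"
    using v \<theta> sg by (simp add: ennreal_mult[symmetric])
  also have "1 / \<sigma> ^ CARD('n) * (1 / (v * (\<theta> / \<sigma>) ^ CARD('n)) * w powr p) = 1 / (v * \<theta> ^ CARD('n)) * w powr p"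
    using sg \<theta> by (simp add: power_divide)
  also have "\<dots> = (samp_const TYPE('n) p \<theta> * w) powr p"
    using v \<theta> p w by (simp add: samp_const_def v_def[symmetric] powr_mult powr_powr)
  finally show ?thesis using p w by (subst nrm_le_iff) auto
qed

lemma nrm_sample_measure_conv_ball_unif_le:
  fixes F :: "real ^ 'n \<Rightarrow> real"
  assumes p: "1 \<le> p" and F: "F \<in> borel_measurable borel" and sg: "0 < \<sigma>" and \<theta>: "0 < \<theta>" "\<theta> \<le> \<gamma>"
    and A: "sep_finite (\<gamma> / \<sigma>) A" and w: "0 \<le> w" "nrm p lborel F \<le> ennreal w"
  shows "nrm p (sample_measure \<sigma> A) (\<lambda>a. conv ball_unif (\<theta> / \<sigma>) F (a + z)) \<le> ennreal (samp_const TYPE('n) p \<theta> * w)"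
proof (rule nrm_sample_measure_leI[OF p _ sg \<theta>(1) w])
  have "\<theta> / \<sigma> \<le> \<gamma> / \<sigma>" using sg \<theta> by (simp add: divide_right_mono)
  then show "(\<Sum>a\<in>A. ennreal (\<bar>conv ball_unif (\<theta> / \<sigma>) F (a + z)\<bar> powr p))
      \<le> ennreal (1 / (measure lborel (ball (0 :: real ^ 'n) 1) * (\<theta> / \<sigma>) ^ CARD('n))) * (\<integral>\<^sup>+y. ennreal (\<bar>F y\<bar> powr p) \<partial>lborel)"
    using conv_ball_unif_sum_le[OF p F, of A "\<gamma> / \<sigma>" "\<theta> / \<sigma>" z] A sg \<theta> by (simp add: sep_finite_def)
qed (use A in \<open>simp add: sep_finite_def\<close>)

text \<open>The radii are \<open>k * \<theta> / \<sigma>\<close> with \<open>k \<le> s\<close>, so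
  \<open>s * \<theta> \<le> \<gamma>\<close> keeps the balls disjoint. Smaller balls have larger
  constants, whence the constant of \<open>k = 1\<close>.\<close>

lemma nrm_sample_measure_jackson_le:
  fixes F :: "real ^ 'n \<Rightarrow> real"
  assumes p: "1 \<le> p" and F: "bdd_cont F" and sg: "0 < \<sigma>" and \<theta>: "0 < \<theta>" "real s * \<theta> \<le> \<gamma>"
    and A: "sep_finite (\<gamma> / \<sigma>) A" and w: "0 \<le> w" "nrm p lborel F \<le> ennreal w"
  shows "nrm p (sample_measure \<sigma> A) (\<lambda>a. jackson (axes_law L) (\<theta> / \<sigma>) s F (a + z)) \<le> ennreal (2 ^ s * samp_const TYPE('n) p \<theta> * w)"
proof -
  let ?D = "samp_const TYPE('n) p \<theta>"
  have one: "nrm p (sample_measure \<sigma> A) (\<lambda>a. conv (axes_law L) (real k * (\<theta> / \<sigma>)) F (a + z)) \<le> ennreal (?D * w)" if k: "k \<in> {1..s}" for k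
  proof -
    have "real k * \<theta> \<le> real s * \<theta>" using k \<theta> by (intro mult_right_mono) auto
    from order_trans[OF this \<theta>(2)] have k\<theta>: "0 < real k * \<theta>" "real k * \<theta> \<le> \<gamma>" "\<theta> \<le> real k * \<theta>" using k \<theta> by auto
    have le: "real k * \<theta> / \<sigma> \<le> \<gamma> / \<sigma>" using k\<theta> sg by (simp add: divide_right_mono)
    have "nrm p (sample_measure \<sigma> A) (\<lambda>a. conv (axes_law L) (real k * \<theta> / \<sigma>) F (a + z)) \<le> ennreal (samp_const TYPE('n) p (real k * \<theta>) * w)"
    proof (rule nrm_sample_measure_leI[OF p _ sg k\<theta>(1) w])
      show "(\<Sum>a\<in>A. ennreal (\<bar>conv (axes_law L) (real k * \<theta> / \<sigma>) F (a + z)\<bar> powr p))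
          \<le> ennreal (1 / (measure lborel (ball (0 :: real ^ 'n) 1) * (real k * \<theta> / \<sigma>) ^ CARD('n))) * (\<integral>\<^sup>+y. ennreal (\<bar>F y\<bar> powr p) \<partial>lborel)"
        by (rule conv_axes_law_sum_le[OF p F, where \<rho>="\<gamma> / \<sigma>"]) (use A k\<theta> le sg in \<open>auto simp: sep_finite_def\<close>)
    qed (use A in \<open>simp add: sep_finite_def\<close>)
    also have "\<dots> \<le> ennreal (?D * w)"
      using samp_const_antimono[OF p \<theta>(1) k\<theta>(3)] w by (intro ennreal_leI mult_right_mono) auto
    finally show ?thesis by simp
  qed
  have "nrm p (sample_measure \<sigma> A) (\<lambda>a. jackson (axes_law L) (\<theta> / \<sigma>) s F (a + z)) \<le> ennreal (\<Sum>k=1..s. \<bar>(-1) ^ Suc k * real (s choose k)\<bar> * (?D * w))"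
    unfolding jackson_def using w one
    by (intro nrm_sum_le nrm_cmult_le p borel_measurable_sample_measure) auto
  also have "\<dots> \<le> ennreal (2 ^ s * ?D * w)"
    unfolding sum_distrib_right[symmetric] mult.assoc
    using w by (intro ennreal_leI mult_right_mono sum_abs_binomial_le) auto
  finally show ?thesis .
qed

section \<open>The averaged operator on sampling points\<close>

lemma sum_symmetric_nat:
  fixes h :: "nat \<Rightarrow> real"
  assumes "k \<le> r"
  shows "(\<Sum>\<nu>=r-k..r+k. h \<nu>) = h r + (\<Sum>j=1..k. h (r - j) + h (r + j))"
  using assms
proof (induction k)
  case (Suc k)
  have "{r - Suc k..r + Suc k} = insert (r - Suc k) (insert (r + Suc k) {r - k..r + k})"
    using Suc.prems by auto
  then have "(\<Sum>\<nu>=r-Suc k..r+Suc k. h \<nu>) = h (r - Suc k) + (h (r + Suc k) + (\<Sum>\<nu>=r-k..r+k. h \<nu>))"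
    using Suc.prems by (simp only:) (subst sum.insert, simp, force, subst sum.insert, auto)
  then show ?case using Suc by simp
qed simp

text \<open>The weights of \<open>averaged\<close> come from the central difference of order
  \<open>2 * r\<close> with step \<open>\<delta> u / r\<close>. Integration over the symmetric ball
  pairs the terms \<open>\<nu>\<close> and \<open>2 * r - \<nu>\<close>, and the middle term is a
  multiple of \<open>g x\<close> itself.\<close>

lemma diff_averaged_eq:
  fixes g :: "real ^ 'n \<Rightarrow> real"
  assumes r: "1 \<le> r" and [measurable]: "g \<in> borel_measurable borel" and c: "\<And>c. conv_integrable ball_unif c g" and \<delta>: "0 < \<delta>"
  shows "averaged \<delta> r g x - g x = (- ((-1) ^ r) / real (2 * r choose r)) *
    (\<integral>u. fin_diff (2 * r) ((\<delta> / real r) *\<^sub>R u) g (x + (- \<delta>) *\<^sub>R u) \<partial>ball_unif)"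
proof -
  interpret U: prob_space "ball_unif :: (real ^ 'n) measure" by (rule borel_probD[OF borel_prob_ball_unif])
  define e where "e m = conv ball_unif (\<delta> * m / real r) g x" for m
  have e_minus: "e (- m) = e m" for m using conv_ball_unif_minus[of g "\<delta> * m / real r" x] by (simp add: e_def)
  have e0: "e 0 = g x" by (simp add: e_def conv_def U.prob_space)
  \<comment> \<open>Starting at \<open>x - \<delta> u\<close>, that is \<open>r\<close> steps before
    \<open>x\<close>, turns the forward difference into the central one.\<close>
  have pt: "fin_diff (2 * r) ((\<delta> / real r) *\<^sub>R u) g (x + (- \<delta>) *\<^sub>R u)
      = (\<Sum>\<nu>=0..2*r. real (2 * r choose \<nu>) * (-1) ^ \<nu> * g (x + (\<delta> * (real r - real \<nu>) / real r) *\<^sub>R u))" for u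
    unfolding fin_diff_def
  proof (intro sum.cong refl)
    fix \<nu> assume "\<nu> \<in> {0..2*r}"
    then have "real (2 * r - \<nu>) = 2 * real r - real \<nu>" by auto
    then have "- \<delta> + real (2 * r - \<nu>) * (\<delta> / real r) = \<delta> * (real r - real \<nu>) / real r"
      using r by (simp add: field_simps)
    then have "x + (- \<delta>) *\<^sub>R u + real (2 * r - \<nu>) *\<^sub>R (\<delta> / real r) *\<^sub>R u = x + (\<delta> * (real r - real \<nu>) / real r) *\<^sub>R u"
      by (metis add.assoc scaleR_left.add scaleR_scaleR)
    then show "real (2 * r choose \<nu>) * (- 1) ^ \<nu> * g (x + (- \<delta>) *\<^sub>R u + real (2 * r - \<nu>) *\<^sub>R (\<delta> / real r) *\<^sub>R u)
        = real (2 * r choose \<nu>) * (- 1) ^ \<nu> * g (x + (\<delta> * (real r - real \<nu>) / real r) *\<^sub>R u)"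
      by (simp only:)
  qed
  have "(\<integral>u. fin_diff (2 * r) ((\<delta> / real r) *\<^sub>R u) g (x + (- \<delta>) *\<^sub>R u) \<partial>ball_unif)
      = (\<Sum>\<nu>=0..2*r. real (2 * r choose \<nu>) * (-1) ^ \<nu> * e (real r - real \<nu>))"
    unfolding pt e_def conv_def using c unfolding conv_integrable_def
    by (subst Bochner_Integration.integral_sum) auto
  also have "\<dots> = (\<Sum>\<nu>=r-r..r+r. real (2 * r choose \<nu>) * (-1) ^ \<nu> * e (real r - real \<nu>))" by (simp add: mult_2)
  also have "\<dots> = real (2 * r choose r) * (-1) ^ r * e 0
      + (\<Sum>j=1..r. 2 * ((-1) ^ r * ((-1) ^ j * real (2 * r choose (r - j)) * e (real j))))"
  proof (subst sum_symmetric_nat[OF order_refl], intro arg_cong2[of _ _ _ _ "(+)"] sum.cong refl)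
    fix j assume j: "j \<in> {1..r}"
    have "(2 * r choose (r + j)) = (2 * r choose (r - j))"
      using j binomial_symmetric[of "r + j" "2 * r"] by (simp add: mult_2)
    moreover have "e (real r - real (r + j)) = e (real j)" using e_minus[of "real j"] by simp
    moreover have "(-1::real) ^ (r - j) = (-1) ^ r * (-1) ^ j"
    proof -
      obtain m where "r = j + m" using j le_Suc_ex by auto
      then show ?thesis by (simp add: power_add mult_ac flip: power_mult_distrib mult.assoc)
    qed
    ultimately show "real (2 * r choose (r - j)) * (- 1) ^ (r - j) * e (real r - real (r - j))
        + real (2 * r choose (r + j)) * (- 1) ^ (r + j) * e (real r - real (r + j))
        = 2 * ((- 1) ^ r * ((- 1) ^ j * real (2 * r choose (r - j)) * e (real j)))"
      using j by (simp add: power_add of_nat_diff)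
  qed simp
  also have "\<dots> = (-1) ^ r * (real (2 * r choose r) * g x
      + 2 * (\<Sum>j=1..r. (-1) ^ j * real (2 * r choose (r - j)) * e (real j)))"
    by (simp add: e0 sum_distrib_left algebra_simps)
  also have "(\<Sum>j=1..r. (-1) ^ j * real (2 * r choose (r - j)) * e (real j))
      = (\<Sum>j=1..r. (-1) ^ j * real (2 * r choose (r - j)) * ball_avg (\<delta> * real j / real r) g x)"
    using \<delta> r by (intro sum.cong refl) (simp add: e_def ball_avg_eq_conv)
  also have "2 * \<dots> = - real (2 * r choose r) * averaged \<delta> r g x"
    by (simp add: averaged_def)
  finally have "(\<integral>u. fin_diff (2 * r) ((\<delta> / real r) *\<^sub>R u) g (x + (- \<delta>) *\<^sub>R u) \<partial>ball_unif)
      = (-1) ^ r * real (2 * r choose r) * (g x - averaged \<delta> r g x)"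
    by (simp add: algebra_simps)
  then show ?thesis by (simp add: power_add[symmetric] mult_2[symmetric] flip: mult.assoc)
qed

text \<open>By \<open>diff_averaged_eq\<close> the error is an average of differences of order
  \<open>2 * r\<close>, whose steps are shorter than \<open>1 / \<sigma>\<close> since
  \<open>\<gamma> \<le> 1 \<le> r\<close>. They commute with \<open>jackson\<close>, so the sampled
  estimate applies to the differences of \<open>\<Phi>\<close>; the displacement by
  \<open>- (\<gamma> / \<sigma>) u\<close> is common to all points.\<close>

lemma nrm_sample_measure_averaged_diff_le:
  fixes \<Phi> :: "real ^ 'n \<Rightarrow> real" and L :: "'n list"
  assumes p: "1 \<le> p" and r: "1 \<le> r" and s: "s \<le> 2 * r" and \<Phi>: "bdd_cont \<Phi>" and sg: "0 < \<sigma>"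
    and \<gamma>: "0 < \<gamma>" "\<gamma> \<le> 1" and \<theta>: "0 < \<theta>" "real t * \<theta> \<le> \<gamma>"
    and A: "sep_finite (\<gamma> / \<sigma>) A" and W: "0 \<le> W"
    and small: "\<And>v. norm v < 1 / \<sigma> \<Longrightarrow> nrm p lborel (fin_diff s v \<Phi>) \<le> ennreal W"
  defines "g \<equiv> jackson (axes_law L) (\<theta> / \<sigma>) t \<Phi>"
  shows "nrm p (sample_measure \<sigma> A) (\<lambda>\<xi>. averaged (\<gamma> / \<sigma>) r g \<xi> - g \<xi>)
    \<le> ennreal (2 ^ t * samp_const TYPE('n) p \<theta> * (2 ^ (2 * r) * W))"
proof -
  have finA: "finite A" using A by (simp add: sep_finite_def)
  have g: "bdd_cont g" unfolding g_def by (rule bdd_cont_jackson[OF borel_prob_axes_law \<Phi>])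
  note [measurable] = bdd_cont_measurable[OF g]
  let ?D = "2 ^ t * samp_const TYPE('n) p \<theta> * (2 ^ (2 * r) * W)"
  let ?b = "real (2 * r choose r)"
  have b: "1 \<le> ?b" by (simp add: Suc_le_eq)
  define H where "H \<xi> u = fin_diff (2 * r) (((\<gamma> / \<sigma>) / real r) *\<^sub>R u) g (\<xi> + (- (\<gamma> / \<sigma>)) *\<^sub>R u)" for \<xi> u
  have eq: "averaged (\<gamma> / \<sigma>) r g \<xi> - g \<xi> = (- ((-1) ^ r) / ?b) * (\<integral>u. H \<xi> u \<partial>ball_unif)" for \<xi>
    unfolding H_def using \<gamma> sg by (intro diff_averaged_eq r bdd_cont_conv_integrable[OF borel_prob_ball_unif g]) auto
  have H: "nrm p (sample_measure \<sigma> A) (\<lambda>\<xi>. H \<xi> u) \<le> ennreal ?D" if u: "norm u < 1" for u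
  proof -
    define v where "v = ((\<gamma> / \<sigma>) / real r) *\<^sub>R u"
    have "norm v = (\<gamma> / real r) * norm u / \<sigma>" using \<gamma> sg by (simp add: v_def)
    also have "\<dots> < 1 / \<sigma>"
    proof (rule divide_strict_right_mono[OF _ sg])
      have "(\<gamma> / real r) * norm u \<le> 1 * norm u" using \<gamma> r by (intro mult_right_mono) (auto simp: divide_le_eq)
      then show "(\<gamma> / real r) * norm u < 1" using u by simp
    qed
    finally have v: "norm v < 1 / \<sigma>" .
    have "nrm p lborel (fin_diff ((2 * r - s) + s) v \<Phi>) \<le> ennreal (2 ^ (2 * r - s) * W)"
      by (rule nrm_fin_diff_add_le[OF p bdd_cont_measurable[OF \<Phi>] small[OF v] W])
    also have "\<dots> \<le> ennreal (2 ^ (2 * r) * W)"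
      using W by (intro ennreal_leI mult_right_mono power_increasing) auto
    finally have "nrm p lborel (fin_diff (2 * r) v \<Phi>) \<le> ennreal (2 ^ (2 * r) * W)" using s by simp
    then have "nrm p (sample_measure \<sigma> A) (\<lambda>\<xi>. jackson (axes_law L) (\<theta> / \<sigma>) t (fin_diff (2 * r) v \<Phi>) (\<xi> + (- (\<gamma> / \<sigma>)) *\<^sub>R u)) \<le> ennreal ?D"
      using W by (intro nrm_sample_measure_jackson_le[OF p bdd_cont_fin_diff[OF \<Phi>] sg \<theta> A]) auto
    moreover have "fin_diff (2 * r) v g = jackson (axes_law L) (\<theta> / \<sigma>) t (fin_diff (2 * r) v \<Phi>)"
      unfolding g_def by (rule fin_diff_jackson) (rule bdd_cont_conv_integrable[OF borel_prob_axes_law \<Phi>])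
    ultimately show ?thesis by (simp add: H_def v_def)
  qed
  have D: "0 \<le> ?D" using W by simp
  have int: "nrm p (sample_measure \<sigma> A) (\<lambda>\<xi>. \<integral>u. H \<xi> u \<partial>ball_unif) \<le> ennreal ?D"
  proof (rule nrm_integral_le[OF p borel_probD(1)[OF borel_prob_ball_unif] sigma_finite_sample_measure[OF finA], where w="\<lambda>_. ?D"])
    \<comment> \<open>The first factor has the sigma-algebra of a countable discrete space, so joint
      measurability reduces to that of the sections.\<close>
    have sets: "sets (sample_measure \<sigma> A \<Otimes>\<^sub>M (ball_unif :: (real ^ 'n) measure)) = sets (count_space A \<Otimes>\<^sub>M borel)"
      by (intro sets_pair_measure_cong borel_probD(3)[OF borel_prob_ball_unif]) (simp add: sample_measure_def)
    have "case_prod H \<in> borel_measurable (count_space A \<Otimes>\<^sub>M borel)"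
    proof (rule measurable_pair_measure_countable1)
      show "countable A" using finA by (rule countable_finite)
      show "(\<lambda>u. case_prod H (\<xi>, u)) \<in> borel_measurable borel" for \<xi>
        unfolding H_def case_prod_conv fin_diff_def by measurable
    qed
    then show "case_prod H \<in> borel_measurable (sample_measure \<sigma> A \<Otimes>\<^sub>M ball_unif)"
      unfolding measurable_cong_sets[OF sets refl] .
    show "AE u in ball_unif. nrm p (sample_measure \<sigma> A) (\<lambda>\<xi>. H \<xi> u) \<le> ennreal ?D"
      using AE_ball_unif by eventually_elim (rule H)
    interpret U: prob_space "ball_unif :: (real ^ 'n) measure" by (rule borel_probD[OF borel_prob_ball_unif])
    show "(\<integral>\<^sup>+ u. ennreal (?D powr p) \<partial>(ball_unif :: (real ^ 'n) measure)) \<le> ennreal (?D powr p)" by (simp add: U.emeasure_space_1)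
  qed (use D in auto)
  have "nrm p (sample_measure \<sigma> A) (\<lambda>\<xi>. averaged (\<gamma> / \<sigma>) r g \<xi> - g \<xi>) \<le> ennreal (\<bar>- ((-1) ^ r) / ?b\<bar> * ?D)"
    unfolding eq by (rule nrm_cmult_le[OF p borel_measurable_sample_measure int])
  also have "\<dots> \<le> ennreal (1 * ?D)"
    using D b by (intro ennreal_leI mult_right_mono) (auto simp: abs_divide power_abs divide_le_eq)
  finally show ?thesis by simp
qed

text \<open>Meant for \<open>f - g\<close>, which is controlled in norm only. The radii
  \<open>\<gamma> j / (r \<sigma>)\<close> do not exceed \<open>\<gamma> / \<sigma>\<close>, so each
  ball average obeys the disjoint-ball estimate.\<close>

lemma nrm_sample_measure_averaged_le:
  fixes F :: "real ^ 'n \<Rightarrow> real"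
  assumes p: "1 \<le> p" and r: "1 \<le> r" and F[measurable]: "F \<in> borel_measurable borel" and sg: "0 < \<sigma>"
    and \<gamma>: "0 < \<gamma>" and A: "sep_finite (\<gamma> / \<sigma>) A" and w: "0 \<le> w" "nrm p lborel F \<le> ennreal w"
  shows "nrm p (sample_measure \<sigma> A) (averaged (\<gamma> / \<sigma>) r F)
    \<le> ennreal (2 / real (2 * r choose r) * (\<Sum>j=1..r. real (2 * r choose (r - j)) * samp_const TYPE('n) p (\<gamma> * real j / real r)) * w)"
proof -
  let ?S = "\<lambda>j. samp_const TYPE('n) p (\<gamma> * real j / real r)"
  have one: "nrm p (sample_measure \<sigma> A) (\<lambda>a. conv ball_unif (\<gamma> * real j / real r / \<sigma>) F (a + 0)) \<le> ennreal (?S j * w)" if "j \<in> {1..r}" for j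
  proof (rule nrm_sample_measure_conv_ball_unif_le[OF p F sg _ _ A w])
    show "0 < \<gamma> * real j / real r" using that \<gamma> by auto
    have "\<gamma> * real j \<le> \<gamma> * real r" using that \<gamma> by (intro mult_left_mono) auto
    then show "\<gamma> * real j / real r \<le> \<gamma>" using that by (subst pos_divide_le_eq) auto
  qed
  have avg: "(\<Sum>j=1..r. (-1) ^ j * real (2 * r choose (r - j)) * ball_avg (\<gamma> / \<sigma> * real j / real r) F x)
      = (\<Sum>j=1..r. ((-1) ^ j * real (2 * r choose (r - j))) * conv ball_unif (\<gamma> * real j / real r / \<sigma>) F (x + 0))" for x
  proof (rule sum.cong[OF refl])
    fix j assume "j \<in> {1..r}"
    then have b: "ball_avg (\<gamma> * real j / real r / \<sigma>) F x = conv ball_unif (\<gamma> * real j / real r / \<sigma>) F x"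
      using \<gamma> sg r by (intro ball_avg_eq_conv) auto
    have e: "\<gamma> / \<sigma> * real j / real r = \<gamma> * real j / real r / \<sigma>"
      by (metis divide_divide_eq_left mult.commute times_divide_eq_left)
    show "(-1) ^ j * real (2 * r choose (r - j)) * ball_avg (\<gamma> / \<sigma> * real j / real r) F x
        = ((-1) ^ j * real (2 * r choose (r - j))) * conv ball_unif (\<gamma> * real j / real r / \<sigma>) F (x + 0)"
      by (simp only: e b add_0_right)
  qed
  have eq: "averaged (\<gamma> / \<sigma>) r F = (\<lambda>x. - 2 / real (2 * r choose r) *
      (\<Sum>j=1..r. ((-1) ^ j * real (2 * r choose (r - j))) * conv ball_unif (\<gamma> * real j / real r / \<sigma>) F (x + 0)))"
    by (rule ext) (simp only: averaged_def avg)
  have "nrm p (sample_measure \<sigma> A) (averaged (\<gamma> / \<sigma>) r F) \<le> ennreal (\<bar>- 2 / real (2 * r choose r)\<bar> *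
      (\<Sum>j=1..r. \<bar>(-1) ^ j * real (2 * r choose (r - j))\<bar> * (?S j * w)))"
    unfolding eq
  proof (rule nrm_cmult_le[OF p borel_measurable_sample_measure], rule nrm_sum_le[OF p borel_measurable_sample_measure])
    fix j assume j: "j \<in> {1..r}"
    show "nrm p (sample_measure \<sigma> A) (\<lambda>x. (-1) ^ j * real (2 * r choose (r - j)) * conv ball_unif (\<gamma> * real j / real r / \<sigma>) F (x + 0))
        \<le> ennreal (\<bar>(-1) ^ j * real (2 * r choose (r - j))\<bar> * (?S j * w))"
      by (rule nrm_cmult_le[OF p borel_measurable_sample_measure one[OF j]])
    show "0 \<le> \<bar>(-1) ^ j * real (2 * r choose (r - j))\<bar> * (?S j * w)"
      using w(1) by (intro mult_nonneg_nonneg) auto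
  qed
  moreover have "(\<Sum>j=1..r. \<bar>(-1) ^ j * real (2 * r choose (r - j))\<bar> * (?S j * w))
      = (\<Sum>j=1..r. real (2 * r choose (r - j)) * ?S j) * w"
    unfolding sum_distrib_right by (intro sum.cong refl) (simp add: abs_mult power_abs)
  moreover have "\<bar>- 2 / real (2 * r choose r)\<bar> = 2 / real (2 * r choose r)" by (simp add: abs_divide)
  ultimately show ?thesis by (simp only: mult.assoc)
qed

text \<open>Valid for every \<open>f\<close>, as completion leaves nonnegative integrals unchanged;
  functions that are merely Lebesgue measurable can thus be handled over
  \<open>lborel\<close>.\<close>

lemma Lp_norm_eq: "Lp_norm p f = nrm p lborel f"
  by (simp add: Lp_norm_def nrm_def nn_integral_completion)

text \<open>A derivative of order \<open>s\<close> leaves averages, which do not increase the norm,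
  of \<open>s\<close>-fold mixed differences divided by
  \<open>(k * \<theta> / \<sigma>) ^ s\<close>; hence the factor \<open>\<sigma> ^ s\<close>. Among
  the scales, \<open>k = 1\<close> has the smallest denominator and \<open>k = t\<close> the longest
  steps.\<close>

lemma sobolev_jackson_le:
  fixes \<Phi> :: "real ^ 'n \<Rightarrow> real"
  assumes p: "1 \<le> p" and \<Phi>: "bdd_cont \<Phi>" and sg: "0 < \<sigma>" and \<theta>: "0 < \<theta>" and W: "0 \<le> W"
    and small: "\<And>v. norm v < 1 / \<sigma> \<Longrightarrow> nrm p lborel (fin_diff s v \<Phi>) \<le> ennreal W"
    and L: "\<And>i. count_list L i = s"
  shows "sobolev_seminorm p s (jackson (axes_law L) (\<theta> / \<sigma>) t \<Phi>)
    \<le> ennreal (real (card {\<alpha> :: 'n \<Rightarrow> nat. (\<Sum>i\<in>UNIV. \<alpha> i) = s}) *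
        (2 ^ t * (2 ^ s * (1 + real s * (real t * \<theta>)) ^ s / \<theta> ^ s)) * \<sigma> ^ s * W)"
proof -
  let ?h = "\<theta> / \<sigma>"
  let ?B = "2 ^ s * (1 + real s * (real t * \<theta>)) ^ s / \<theta> ^ s * \<sigma> ^ s * W"
  have B0: "0 \<le> ?B" using \<theta> sg W by simp
  have bound: "Lp_norm p (multi_deriv \<alpha> (jackson (axes_law L) ?h t \<Phi>)) \<le> ennreal (2 ^ t * ?B)" if \<alpha>: "(\<Sum>i\<in>UNIV. \<alpha> i) = s" for \<alpha> :: "'n \<Rightarrow> nat"
  proof -
    obtain "is" where eq: "multi_deriv \<alpha> (jackson (axes_law L) ?h t \<Phi>) = fold partial_deriv is (jackson (axes_law L) ?h t \<Phi>)"
      and sample_measure: "\<And>i. count_list is i = \<alpha> i" and len: "length is = s"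
      using multi_deriv_list[of \<alpha> "jackson (axes_law L) ?h t \<Phi>"] \<alpha> by metis
    have le: "count_list is i \<le> count_list L i" for i
    proof -
      have "\<alpha> i \<le> (\<Sum>i\<in>UNIV. \<alpha> i)" by (rule member_le_sum) auto
      then show ?thesis using \<alpha> L[of i] sample_measure[of i] by simp
    qed
    have d: "multi_deriv \<alpha> (jackson (axes_law L) ?h t \<Phi>) = (\<lambda>x. \<Sum>k=1..t. (-1) ^ Suc k * real (t choose k) *
        conv (axes_law (fold remove1 is L)) (real k * ?h) (fold (diff_quot (real k * ?h)) is \<Phi>) x)"
      unfolding eq unfolding jackson_def[abs_def]
      by (rule fold_partial_deriv_sum_conv[where F="\<lambda>_. \<Phi>" and c="\<lambda>k. real k * ?h"]) (use le \<Phi> \<theta> sg in auto)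
    have one: "nrm p lborel (fold (diff_quot (real k * ?h)) is \<Phi>) \<le> ennreal ?B" if k: "k \<in> {1..t}" for k
    proof -
      let ?c = "real k * ?h"
      have "1 * ?h \<le> ?c" using k \<theta> sg by (intro mult_right_mono) auto
      then have h: "0 < ?h" "?h \<le> ?c" using \<theta> sg by auto
      have "nrm p lborel (fold (diff_quot ?c) is \<Phi>) = nrm p lborel (\<lambda>x. (1 / ?c ^ s) * mixed_diff (\<lambda>j. ?c *\<^sub>R axis (is ! j) 1) s \<Phi> x)"
        by (rule nrm_cong) (simp add: fold_diff_quot len)
      also have "\<dots> \<le> ennreal (\<bar>1 / ?c ^ s\<bar> * (2 ^ s * (1 + real s * ?c * \<sigma>) ^ s * W))"
      proof (rule nrm_cmult_le[OF p])
        show "nrm p lborel (mixed_diff (\<lambda>j. ?c *\<^sub>R axis (is ! j) 1) s \<Phi>) \<le> ennreal (2 ^ s * (1 + real s * ?c * \<sigma>) ^ s * W)"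
          using h \<theta> sg by (intro nrm_mixed_diff_le p bdd_cont_measurable[OF \<Phi>] sg W small) auto
        have "bdd_cont (mixed_diff V n \<Phi>)" for V n by (induction n) (auto intro: \<Phi> bdd_cont_dif)
        then show "mixed_diff (\<lambda>j. ?c *\<^sub>R axis (is ! j) 1) s \<Phi> \<in> borel_measurable lborel"
          by (simp add: bdd_cont_measurable)
      qed
      also have "\<dots> \<le> ennreal (1 / ?h ^ s * (2 ^ s * (1 + real s * (real t * \<theta>)) ^ s * W))"
      proof (rule ennreal_leI, rule mult_mono)
        show "\<bar>1 / ?c ^ s\<bar> \<le> 1 / ?h ^ s" 
        proof -
          have "1 / ?c ^ s \<le> 1 / ?h ^ s" using h k by (intro divide_left_mono power_mono mult_pos_pos zero_less_power) auto
          then show ?thesis using h by simp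
        qed
        have "real k * \<theta> \<le> real t * \<theta>" using k \<theta> by (intro mult_right_mono) auto
        then have "real s * (real k * \<theta>) \<le> real s * (real t * \<theta>)" by (rule mult_left_mono) simp
        moreover have "real s * ?c * \<sigma> = real s * (real k * \<theta>)" using sg by simp
        moreover have "0 \<le> real s * (real k * \<theta>)" using \<theta> by simp
        ultimately show "2 ^ s * (1 + real s * ?c * \<sigma>) ^ s * W \<le> 2 ^ s * (1 + real s * (real t * \<theta>)) ^ s * W"
          using W by (intro mult_right_mono mult_left_mono power_mono) (linarith | simp)+
        show "0 \<le> 2 ^ s * (1 + real s * ?c * \<sigma>) ^ s * W" using W \<theta> sg by simp
      qed (use h in simp)
      also have "1 / ?h ^ s * (2 ^ s * (1 + real s * (real t * \<theta>)) ^ s * W) = ?B"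
        using sg \<theta> by (simp add: power_divide)
      finally show ?thesis .
    qed
    have "Lp_norm p (multi_deriv \<alpha> (jackson (axes_law L) ?h t \<Phi>))
        \<le> ennreal (\<Sum>k=1..t. \<bar>(-1) ^ Suc k * real (t choose k)\<bar> * ?B)"
      unfolding Lp_norm_eq d
    proof (intro nrm_sum_le nrm_cmult_le nrm_conv_le p borel_prob_axes_law one B0)
      fix k
      have M: "bdd_cont (fold (diff_quot (real k * ?h)) is \<Phi>)" by (rule bdd_cont_fold_diff_quot[OF \<Phi>])
      show "fold (diff_quot (real k * ?h)) is \<Phi> \<in> borel_measurable borel" by (rule bdd_cont_measurable[OF M])
      show "conv (axes_law (fold remove1 is L)) (real k * ?h) (fold (diff_quot (real k * ?h)) is \<Phi>) \<in> borel_measurable lborel"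
        using bdd_cont_measurable[OF bdd_cont_conv_axes_law[OF M]] by simp
      then show "(\<lambda>x. (-1) ^ Suc k * real (t choose k) * conv (axes_law (fold remove1 is L)) (real k * ?h) (fold (diff_quot (real k * ?h)) is \<Phi>) x) \<in> borel_measurable lborel"
        by measurable
      show "0 \<le> \<bar>(-1) ^ Suc k * real (t choose k)\<bar> * ?B" by (rule mult_nonneg_nonneg[OF abs_ge_zero B0])
    qed auto
    also have "\<dots> \<le> ennreal (2 ^ t * ?B)"
      unfolding sum_distrib_right[symmetric] using B0
      by (intro ennreal_leI mult_right_mono sum_abs_binomial_le) auto
    finally show ?thesis .
  qed
  have "sobolev_seminorm p s (jackson (axes_law L) ?h t \<Phi>) \<le> of_nat (card {\<alpha> :: 'n \<Rightarrow> nat. (\<Sum>i\<in>UNIV. \<alpha> i) = s}) * ennreal (2 ^ t * ?B)"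
    unfolding sobolev_seminorm_def by (rule sum_bounded_above) (use bound in auto)
  also have "\<dots> = ennreal (real (card {\<alpha> :: 'n \<Rightarrow> nat. (\<Sum>i\<in>UNIV. \<alpha> i) = s}) * (2 ^ t * ?B))"
    unfolding ennreal_of_nat_eq_real_of_nat
    by (rule ennreal_mult[symmetric], simp, rule mult_nonneg_nonneg, simp, rule B0)
  also have "real (card {\<alpha> :: 'n \<Rightarrow> nat. (\<Sum>i\<in>UNIV. \<alpha> i) = s}) * (2 ^ t * ?B) = real (card {\<alpha> :: 'n \<Rightarrow> nat. (\<Sum>i\<in>UNIV. \<alpha> i) = s}) *
        (2 ^ t * (2 ^ s * (1 + real s * (real t * \<theta>)) ^ s / \<theta> ^ s)) * \<sigma> ^ s * W" by simp
  finally show ?thesis .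
qed

section \<open>Band-limited approximation\<close>

lemma ex_powr_bound:
  assumes "1 \<le> p" "J < (\<infinity>::ennreal)"
  shows "\<exists>M\<ge>0. J \<le> ennreal (M powr p)"
proof (cases J)
  case (real x)
  then show ?thesis using assms by (intro exI[of _ "x powr (1 / p)"]) (simp add: powr_powr)
qed (use assms in auto)

lemma nn_integral_moment_finite:
  assumes p: "1 \<le> p" "p \<le> real n" and \<tau>: "0 \<le> \<tau>"
    and sets: "sets P = sets borel"
    and fin: "(\<integral>\<^sup>+u. ennreal ((1 + norm u) ^ (s * n)) \<partial>P) < \<infinity>"
  shows "(\<integral>\<^sup>+u. ennreal (((1 + norm (u::'a::euclidean_space) * \<tau>) ^ s) powr p) \<partial>P) < \<infinity>"
proof -
  note [measurable_cong] = sets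
  define m where "m = max 1 \<tau>"
  have pt: "((1 + norm u * \<tau>) ^ s) powr p \<le> m ^ (s * n) * (1 + norm u) ^ (s * n)" for u :: 'a
  proof -
    have "1 + norm u * \<tau> \<le> m + norm u * m" unfolding m_def by (intro add_mono mult_left_mono) auto
    then have le: "1 + norm u * \<tau> \<le> m * (1 + norm u)" by (simp add: algebra_simps)
    have ge: "1 \<le> 1 + norm u * \<tau>" using \<tau> by simp
    have "((1 + norm u * \<tau>) ^ s) powr p \<le> ((1 + norm u * \<tau>) ^ s) powr real n"
      using ge p by (intro powr_mono) (auto intro: one_le_power)
    also have "\<dots> = ((1 + norm u * \<tau>) ^ s) ^ n"
      using ge by (intro powr_realpow zero_less_power) auto
    also have "\<dots> \<le> ((m * (1 + norm u)) ^ s) ^ n"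
      using le ge by (intro power_mono zero_le_power) auto
    finally show ?thesis by (simp add: power_mult_distrib power_mult)
  qed
  have "(\<integral>\<^sup>+u. ennreal (((1 + norm (u::'a) * \<tau>) ^ s) powr p) \<partial>P) \<le> (\<integral>\<^sup>+u. ennreal (m ^ (s * n)) * ennreal ((1 + norm u) ^ (s * n)) \<partial>P)"
    using pt by (intro nn_integral_mono) (simp add: m_def ennreal_leI flip: ennreal_mult)
  also have "\<dots> = ennreal (m ^ (s * n)) * (\<integral>\<^sup>+u. ennreal ((1 + norm u) ^ (s * n)) \<partial>P)"
    by (rule nn_integral_cmult) measurable
  also have "\<dots> < \<infinity>" using fin by (simp add: ennreal_mult_less_top)
  finally show ?thesis .
qed

text \<open>The bounds by \<open>C * w\<close> in the application put \<open>g\<close> into the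
  function and sequence spaces; those by \<open>C * W\<close>, where \<open>W\<close> bounds the
  modulus, carry the estimate.\<close>

definition jackson_approximant ::
  "real \<Rightarrow> nat \<Rightarrow> nat \<Rightarrow> real \<Rightarrow> real \<Rightarrow> real \<Rightarrow> (real ^ 'n \<Rightarrow> real) \<Rightarrow> real \<Rightarrow> real \<Rightarrow> (real ^ 'n \<Rightarrow> real) \<Rightarrow> bool" where
  "jackson_approximant p s r \<gamma> a \<sigma> F w W g \<longleftrightarrow>
     bdd_cont g \<and> integrable lborel g \<and> (\<forall>x i. a < \<bar>x $ i\<bar> \<longrightarrow> fourier g x = 0)
     \<and> nrm p lborel g \<le> ennreal w
     \<and> nrm p lborel (\<lambda>x. F x - g x) \<le> ennreal W
     \<and> sobolev_seminorm p s g \<le> ennreal (\<sigma> ^ s * W)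
     \<and> (\<forall>A. sep_finite (\<gamma> / \<sigma>) A \<longrightarrow> nrm p (sample_measure \<sigma> A) g \<le> ennreal w
         \<and> nrm p (sample_measure \<sigma> A) (\<lambda>\<xi>. averaged (\<gamma> / \<sigma>) r g \<xi> - g \<xi>) \<le> ennreal W)"

lemma ex_jackson_approximant:
  fixes p l \<gamma> :: real and r s :: nat
  assumes p: "1 \<le> p" and r: "1 \<le> r" and s: "1 \<le> s" "s \<le> 2 * r" and \<gamma>: "0 < \<gamma>" "\<gamma> \<le> 1" and l: "0 < l"
  obtains C where "0 < C"
    "\<And>\<sigma> (F :: real ^ 'n \<Rightarrow> real) W w. 0 < \<sigma> \<Longrightarrow> integrable lborel F \<Longrightarrow> 0 \<le> W
      \<Longrightarrow> (\<forall>v. norm v < 1 / \<sigma> \<longrightarrow> nrm p lborel (fin_diff s v F) \<le> ennreal W)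
      \<Longrightarrow> 0 \<le> w \<Longrightarrow> nrm p lborel F \<le> ennreal w
      \<Longrightarrow> \<exists>g. jackson_approximant p s r \<gamma> (l * \<sigma>) \<sigma> F (C * w) (C * W) g"
proof -
  \<comment> \<open>An integer above \<open>p\<close>, so that the \<open>p\<close>-th power of the
    growth factor of degree \<open>s\<close> is dominated by a polynomial moment of order
    \<open>s * n\<close>.\<close>
  define n where "n = nat \<lceil>p\<rceil>"
  have n: "p \<le> real n" using p by (simp add: n_def)
  obtain PT :: "(real ^ 'n) measure" and K B m where PT: "borel_prob PT" "PT = density lborel (\<lambda>x. ennreal (K x))"
    and K: "continuous_on UNIV K" "\<And>x. 0 \<le> K x" "\<And>x. K x \<le> B" and m: "0 < m"
    and mom: "(\<integral>\<^sup>+u. ennreal ((1 + norm u) ^ (s * n)) \<partial>PT) < \<infinity>"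
    and van: "\<And>y b. b \<in> Basis \<Longrightarrow> m \<le> \<bar>y \<bullet> b\<bar> \<Longrightarrow> chf PT y = 0"
    using ex_bandlimited_kernel[of "s * n"] by metis
  \<comment> \<open>Chosen so that at scale \<open>k * \<tau> / \<sigma>\<close> the transform
    vanishes once a coordinate exceeds \<open>l * \<sigma>\<close>; \<open>k = 1\<close> is the
    critical case.\<close>
  define \<tau> where "\<tau> = m / l"
  have \<tau>: "0 < \<tau>" using m l by (simp add: \<tau>_def)
  obtain MT where MT: "0 \<le> MT" "(\<integral>\<^sup>+u. ennreal (((1 + norm u * \<tau>) ^ s) powr p) \<partial>PT) \<le> ennreal (MT powr p)"
    using ex_powr_bound[OF p nn_integral_moment_finite[OF p n less_imp_le[OF \<tau>] borel_probD(3)[OF PT(1)] mom]] by blast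
  obtain L :: "'n list" where L: "\<And>i. count_list L i = s" using ex_list_counts[of "\<lambda>_. s"] by blast
  \<comment> \<open>The largest scale in the second operator,
    \<open>s * \<theta> / \<sigma>\<close>, is then exactly the radius
    \<open>\<gamma> / \<sigma>\<close> at which the sampling balls are disjoint.\<close>
  define \<theta> where "\<theta> = \<gamma> / real s"
  have \<theta>: "0 < \<theta>" "real s * \<theta> \<le> \<gamma>" using \<gamma> s by (auto simp: \<theta>_def)
  define R where "R = 1 + real (length L)"
  define MS where "MS = (1 + R * \<theta>) ^ s"
  have MS: "0 \<le> MS" "(\<integral>\<^sup>+u. ennreal (((1 + norm u * \<theta>) ^ s) powr p) \<partial>axes_law L) \<le> ennreal (MS powr p)"
  proof -
    interpret axes_law: prob_space "axes_law L" by (rule borel_probD[OF borel_prob_axes_law])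
    show "0 \<le> MS" unfolding MS_def R_def using \<theta> by simp
    have "(\<integral>\<^sup>+u. ennreal (((1 + norm u * \<theta>) ^ s) powr p) \<partial>axes_law L) \<le> (\<integral>\<^sup>+u. ennreal (MS powr p) \<partial>axes_law L)"
    proof (rule nn_integral_mono_AE)
      show "AE u in axes_law L. ennreal (((1 + norm u * \<theta>) ^ s) powr p) \<le> ennreal (MS powr p)"
        using AE_axes_law[of L]
      proof eventually_elim
        case (elim u)
        then show ?case unfolding MS_def R_def using \<theta> p
          by (intro ennreal_leI powr_mono2 power_mono add_left_mono mult_right_mono zero_le_power) auto
      qed
    qed
    then show "(\<integral>\<^sup>+u. ennreal (((1 + norm u * \<theta>) ^ s) powr p) \<partial>axes_law L) \<le> ennreal (MS powr p)"
      by (simp add: axes_law.emeasure_space_1)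
  qed
  let ?D = "samp_const TYPE('n) p \<theta>"
  define C1 where "C1 = real (card {\<alpha> :: 'n \<Rightarrow> nat. (\<Sum>i\<in>UNIV. \<alpha> i) = s}) * (2 ^ s * (2 ^ s * (1 + real s * (real s * \<theta>)) ^ s / \<theta> ^ s))"
  have C1: "0 \<le> C1" unfolding C1_def using \<theta> by simp
  \<comment> \<open>One summand for each estimate. The last factor \<open>2 ^ s\<close> in the terms
    from the second operator is the loss in the first: norm and modulus of \<open>\<Phi>\<close> are
    bounded by \<open>2 ^ s\<close> times the bounds for \<open>F\<close>.\<close>
  define C where "C = 1 + 2 ^ s * 2 ^ s + (MT + MS * 2 ^ s) + C1 * 2 ^ s + 2 ^ s * ?D * 2 ^ s + 2 ^ s * ?D * 2 ^ (2 * r) * 2 ^ s"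
  have Cpos: "0 < C" unfolding C_def using MT MS C1 by (intro add_pos_nonneg) auto
  have Cge: "2 ^ s * 2 ^ s \<le> C" "MT + MS * 2 ^ s \<le> C" "C1 * 2 ^ s \<le> C" "2 ^ s * ?D * 2 ^ s \<le> C"
    "2 ^ s * ?D * 2 ^ (2 * r) * 2 ^ s \<le> C"
  proof -
    have nn: "(0::real) \<le> 2 ^ s * 2 ^ s" "0 \<le> MT + MS * 2 ^ s" "0 \<le> C1 * 2 ^ s" "0 \<le> 2 ^ s * ?D * 2 ^ s"
      "0 \<le> 2 ^ s * ?D * 2 ^ (2 * r) * 2 ^ s" using MT MS C1 by auto
    show "2 ^ s * 2 ^ s \<le> C" "MT + MS * 2 ^ s \<le> C" "C1 * 2 ^ s \<le> C" "2 ^ s * ?D * 2 ^ s \<le> C"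
      "2 ^ s * ?D * 2 ^ (2 * r) * 2 ^ s \<le> C" unfolding C_def using nn by linarith+
  qed
  have up: "ennreal (c * x) \<le> ennreal (C * x)" if "c \<le> C" "0 \<le> x" for c x
    using that by (intro ennreal_leI mult_right_mono) auto
  show ?thesis
  proof (rule that[OF Cpos])
    fix \<sigma> W w and F :: "real ^ 'n \<Rightarrow> real"
    assume sg: "0 < \<sigma>" and F: "integrable lborel F" and W: "0 \<le> W"
      and small_all: "\<forall>v. norm v < 1 / \<sigma> \<longrightarrow> nrm p lborel (fin_diff s v F) \<le> ennreal W"
      and w: "0 \<le> w" "nrm p lborel F \<le> ennreal w"
    have small: "nrm p lborel (fin_diff s v F) \<le> ennreal W" if "norm v < 1 / \<sigma>" for v
      using small_all that by blast
    have FM[measurable]: "F \<in> borel_measurable borel" using F by (simp add: borel_measurable_integrable)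
    define \<Phi> where "\<Phi> = jackson PT (\<tau> / \<sigma>) s F"
    define g where "g = jackson (axes_law L) (\<theta> / \<sigma>) s \<Phi>"
    have KM: "K \<in> borel_measurable borel" by (rule borel_measurable_continuous_onI[OF K(1)])
    have ci: "conv_integrable PT (real k * (\<tau> / \<sigma>)) F" if "k \<in> {1..s}" for k
      using that \<tau> sg by (intro conv_integrable_density[OF PT(2) KM K(2,3) F]) auto
    have \<Phi>: "bdd_cont \<Phi>" unfolding \<Phi>_def jackson_def[abs_def]
    proof (rule bdd_cont_sum)
      fix k assume k: "k \<in> {1..s}"
      show "bdd_cont (\<lambda>x. (-1) ^ Suc k * real (s choose k) * conv PT (real k * (\<tau> / \<sigma>)) F x)"
        using k \<tau> sg by (intro bdd_cont_cmult bdd_cont_conv_density[OF PT(2) K(1,2,3) F]) auto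
    qed
    have \<Phi>M[measurable]: "\<Phi> \<in> borel_measurable borel" by (rule bdd_cont_measurable[OF \<Phi>])
    have g: "bdd_cont g" unfolding g_def by (rule bdd_cont_jackson[OF borel_prob_axes_law \<Phi>])
    have gM[measurable]: "g \<in> borel_measurable borel" by (rule bdd_cont_measurable[OF g])
    have \<Phi>int: "integrable lborel \<Phi>" unfolding \<Phi>_def by (rule integrable_jackson[OF PT(1) F])
    have gint: "integrable lborel g" unfolding g_def by (rule integrable_jackson[OF borel_prob_axes_law \<Phi>int])
    have four: "fourier g x = 0" if i: "l * \<sigma> < \<bar>x $ i\<bar>" for x :: "real ^ 'n" and i
    proof -
      have "chf PT ((real k * (\<tau> / \<sigma>)) *\<^sub>R x) = 0" if k: "k \<in> {1..s}" for k
      proof (rule van)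
        show "axis i 1 \<in> (Basis :: (real ^ 'n) set)" by (simp add: axis_in_Basis_iff)
        have "m = 1 * (\<tau> / \<sigma>) * (l * \<sigma>)" using sg l by (simp add: \<tau>_def)
        also have "\<dots> \<le> real k * (\<tau> / \<sigma>) * \<bar>x $ i\<bar>"
          using k i \<tau> sg l by (intro mult_mono) auto
        also have "\<dots> = \<bar>((real k * (\<tau> / \<sigma>)) *\<^sub>R x) \<bullet> axis i 1\<bar>"
          using \<tau> sg by (simp add: inner_axis abs_mult)
        finally show "m \<le> \<bar>((real k * (\<tau> / \<sigma>)) *\<^sub>R x) \<bullet> axis i 1\<bar>" .
      qed
      then have "fourier \<Phi> x = 0" unfolding \<Phi>_def fourier_jackson[OF PT(1) F] by (intro sum.neutral) auto
      then show ?thesis unfolding g_def fourier_jackson[OF borel_prob_axes_law \<Phi>int] by simp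
    qed
    have n\<Phi>: "nrm p lborel \<Phi> \<le> ennreal (2 ^ s * w)" unfolding \<Phi>_def by (rule nrm_jackson_le[OF p PT(1) FM w(2,1)])
    have w2: "0 \<le> 2 ^ s * w" using w by simp
    have "nrm p lborel g \<le> ennreal (2 ^ s * (2 ^ s * w))" unfolding g_def by (rule nrm_jackson_le[OF p borel_prob_axes_law \<Phi>M n\<Phi> w2])
    then have ng: "nrm p lborel g \<le> ennreal (C * w)" using up[OF Cge(1) w(1)] by (simp add: mult.assoc)
    have W2: "0 \<le> 2 ^ s * W" using W by simp
    have small\<Phi>: "nrm p lborel (fin_diff s v \<Phi>) \<le> ennreal (2 ^ s * W)" if v: "norm v < 1 / \<sigma>" for v
    proof -
      have "fin_diff s v \<Phi> = jackson PT (\<tau> / \<sigma>) s (fin_diff s v F)" unfolding \<Phi>_def by (rule fin_diff_jackson) (rule ci)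
      then show ?thesis using nrm_jackson_le[OF p PT(1) _ small[OF v] W, of "\<tau> / \<sigma>" s] by simp
    qed
    have d1: "nrm p lborel (\<lambda>x. F x - \<Phi> x) \<le> ennreal (MT * W)"
      unfolding \<Phi>_def using \<tau> sg MT by (intro nrm_diff_jackson_le[OF p PT(1) FM ci _ sg W small]) auto
    have d2: "nrm p lborel (\<lambda>x. \<Phi> x - g x) \<le> ennreal (MS * (2 ^ s * W))"
      unfolding g_def using \<theta> sg MS
      by (intro nrm_diff_jackson_le[OF p borel_prob_axes_law \<Phi>M bdd_cont_conv_integrable[OF borel_prob_axes_law \<Phi>] _ sg W2 small\<Phi>]) auto
    have dist: "nrm p lborel (\<lambda>x. F x - g x) \<le> ennreal (C * W)"
    proof -
      have "nrm p lborel (\<lambda>x. (F x - \<Phi> x) + (\<Phi> x - g x)) \<le> nrm p lborel (\<lambda>x. F x - \<Phi> x) + nrm p lborel (\<lambda>x. \<Phi> x - g x)"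
        by (rule nrm_add[OF p]) measurable
      also have "\<dots> \<le> ennreal (MT * W) + ennreal (MS * (2 ^ s * W))" by (rule add_mono[OF d1 d2])
      also have "\<dots> = ennreal ((MT + MS * 2 ^ s) * W)" using MT MS W by (simp add: distrib_right mult.assoc flip: ennreal_plus)
      also have "\<dots> \<le> ennreal (C * W)" by (rule up[OF Cge(2) W])
      finally show ?thesis by simp
    qed
    have sob: "sobolev_seminorm p s g \<le> ennreal (\<sigma> ^ s * (C * W))"
    proof -
      have "sobolev_seminorm p s g \<le> ennreal (C1 * \<sigma> ^ s * (2 ^ s * W))"
        unfolding g_def C1_def by (rule sobolev_jackson_le[OF p \<Phi> sg \<theta>(1) W2 small\<Phi> L])
      also have "C1 * \<sigma> ^ s * (2 ^ s * W) = (C1 * 2 ^ s) * (\<sigma> ^ s * W)" by (simp add: mult_ac)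
      also have "ennreal \<dots> \<le> ennreal (C * (\<sigma> ^ s * W))" using W sg by (intro up Cge) auto
      finally show ?thesis by (simp add: mult_ac)
    qed
    have samp: "nrm p (sample_measure \<sigma> A) g \<le> ennreal (C * w)" if A: "sep_finite (\<gamma> / \<sigma>) A" for A
    proof -
      have "nrm p (sample_measure \<sigma> A) (\<lambda>a. jackson (axes_law L) (\<theta> / \<sigma>) s \<Phi> (a + 0)) \<le> ennreal (2 ^ s * ?D * (2 ^ s * w))"
        by (rule nrm_sample_measure_jackson_le[OF p \<Phi> sg \<theta> A w2 n\<Phi>])
      also have "\<dots> \<le> ennreal (C * w)" using up[OF Cge(4) w(1)] by (simp add: mult.assoc)
      finally show ?thesis by (simp add: g_def)
    qed
    have avg: "nrm p (sample_measure \<sigma> A) (\<lambda>\<xi>. averaged (\<gamma> / \<sigma>) r g \<xi> - g \<xi>) \<le> ennreal (C * W)" if A: "sep_finite (\<gamma> / \<sigma>) A" for A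
    proof -
      have "nrm p (sample_measure \<sigma> A) (\<lambda>\<xi>. averaged (\<gamma> / \<sigma>) r g \<xi> - g \<xi>) \<le> ennreal (2 ^ s * ?D * (2 ^ (2 * r) * (2 ^ s * W)))"
        unfolding g_def by (rule nrm_sample_measure_averaged_diff_le[OF p r s(2) \<Phi> sg \<gamma> \<theta> A W2 small\<Phi>])
      also have "\<dots> \<le> ennreal (C * W)" using up[OF Cge(5) W] by (simp add: mult.assoc)
      finally show ?thesis .
    qed
    show "\<exists>g. jackson_approximant p s r \<gamma> (l * \<sigma>) \<sigma> F (C * w) (C * W) g"
      unfolding jackson_approximant_def using g gint four ng dist sob samp avg by blast
  qed
qed

section \<open>Truncation and null sets\<close>

lemma AE_lborel_translate:
  fixes v :: "'a::euclidean_space"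
  assumes "AE x in lborel. P x"
  shows "AE x in lborel. P (x + v)"
proof -
  obtain N where N: "N \<in> null_sets lborel" "{x \<in> space lborel. \<not> P x} \<subseteq> N"
    using assms by (auto simp: eventually_ae_filter)
  then have [measurable]: "N \<in> sets borel" by (auto simp: null_sets_def)
  have "AE x in lborel. x \<notin> N" using N(1) by (rule AE_not_in)
  then have "AE x in distr lborel borel ((+) v). x \<notin> N" by (subst lborel_distr_plus)
  then have "AE x in lborel. v + x \<notin> N" by (subst (asm) AE_distr_iff) auto
  then show ?thesis using N(2) by (auto simp: add.commute elim!: eventually_mono)
qed

text \<open>Since \<open>\<bar>y\<bar> \<le> 1 + \<bar>y\<bar> powr p\<close>, functions in
  \<open>L_p\<close> are integrable over balls. This serves the cut-off as well as the existence of
  ball averages.\<close>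

lemma integrable_truncate:
  fixes f :: "'a::euclidean_space \<Rightarrow> real"
  assumes p: "1 \<le> p" and [measurable]: "f \<in> borel_measurable borel" and f: "integrable lborel (\<lambda>x. \<bar>f x\<bar> powr p)"
  shows "integrable lborel (\<lambda>x. indicator (ball a R) x * f x)"
proof (rule Bochner_Integration.integrable_bound)
  show "integrable lborel (\<lambda>x. indicator (ball a R) x + \<bar>f x\<bar> powr p)"
    using f emeasure_lborel_ball_finite[of a R] by (intro Bochner_Integration.integrable_add integrable_real_indicator) auto
  have pt: "\<bar>y\<bar> \<le> 1 + \<bar>y\<bar> powr p" for y :: real
  proof (cases "\<bar>y\<bar> \<le> 1")
    case True
    then show ?thesis using powr_ge_zero[of "\<bar>y\<bar>" p] by linarith
  next
    case False
    then have "\<bar>y\<bar> powr 1 \<le> \<bar>y\<bar> powr p" using p by (intro powr_mono) auto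
    then show ?thesis using False by simp
  qed
  show "AE x in lborel. norm (indicator (ball a R) x * f x) \<le> norm (indicator (ball a R) x + \<bar>f x\<bar> powr p)"
    using pt by (intro AE_I2) (auto simp: indicator_def)
qed measurable

lemma conv_integrable_ball_unif:
  fixes f :: "'a::euclidean_space \<Rightarrow> real"
  assumes p: "1 \<le> p" and [measurable]: "f \<in> borel_measurable borel" and f: "integrable lborel (\<lambda>x. \<bar>f x\<bar> powr p)"
    and c: "0 < c"
  shows "conv_integrable ball_unif c f"
  unfolding conv_integrable_def
proof
  fix x
  have "integrable lborel (\<lambda>w. indicator (ball x c) (x + c *\<^sub>R w) * f (x + c *\<^sub>R w))"
    using integrable_lborel_affine[of c "\<lambda>y. indicator (ball x c) y * f y" x] integrable_truncate[OF p _ f, of x c] c by simp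
  also have "(\<lambda>w. indicator (ball x c) (x + c *\<^sub>R w) * f (x + c *\<^sub>R w)) = (\<lambda>w. indicator (ball 0 1) w * f (x + c *\<^sub>R w))"
    using c by (auto simp: fun_eq_iff indicator_def dist_norm)
  finally have "integrable lborel (\<lambda>w. (1 / measure lborel (ball (0::'a) 1)) * (indicator (ball 0 1) w * f (x + c *\<^sub>R w)))"
    by (rule integrable_mult_right)
  then show "integrable ball_unif (\<lambda>w. f (x + c *\<^sub>R w))"
    unfolding ball_unif_def by (subst integrable_density) auto
qed

lemma averaged_diff:
  fixes f g :: "real ^ 'n \<Rightarrow> real"
  assumes [measurable]: "f \<in> borel_measurable borel" "g \<in> borel_measurable borel"
    and c: "\<And>c. 0 < c \<Longrightarrow> conv_integrable ball_unif c f" "\<And>c. 0 < c \<Longrightarrow> conv_integrable ball_unif c g" and d: "0 < \<delta>"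
  shows "averaged \<delta> r (\<lambda>x. f x - g x) x = averaged \<delta> r f x - averaged \<delta> r g x"
proof -
  have "(-1) ^ j * real (2 * r choose (r - j)) * ball_avg (\<delta> * real j / real r) (\<lambda>x. f x - g x) x
      = (-1) ^ j * real (2 * r choose (r - j)) * ball_avg (\<delta> * real j / real r) f x
      - (-1) ^ j * real (2 * r choose (r - j)) * ball_avg (\<delta> * real j / real r) g x" if j: "j \<in> {1..r}" for j
  proof -
    have pos: "0 < \<delta> * real j / real r" using j d by auto
    have "ball_avg (\<delta> * real j / real r) (\<lambda>x. f x - g x) x = ball_avg (\<delta> * real j / real r) f x - ball_avg (\<delta> * real j / real r) g x"
      using c[OF pos] pos unfolding conv_integrable_def
      by (simp add: ball_avg_eq_conv conv_def)
    then show ?thesis by (simp add: right_diff_distrib)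
  qed
  then show ?thesis unfolding averaged_def by (simp add: sum_subtractf right_diff_distrib)
qed

lemma ex_truncation:
  fixes f :: "real ^ 'n \<Rightarrow> real"
  assumes p: "1 \<le> p" and [measurable]: "f \<in> borel_measurable borel" and f: "integrable lborel (\<lambda>x. \<bar>f x\<bar> powr p)" and e: "0 < e"
  shows "\<exists>R. nrm p lborel (\<lambda>x. f x - indicator (ball 0 R) x * f x) \<le> ennreal e"
proof -
  let ?h = "\<lambda>k x. \<bar>f x - indicator (ball 0 (real k)) x * f x\<bar> powr p"
  have "(\<lambda>k. \<integral>x. ?h k x \<partial>lborel) \<longlonglongrightarrow> (\<integral>x. 0 \<partial>(lborel :: (real ^ 'n) measure))"
  proof (rule integral_dominated_convergence[where w="\<lambda>x. \<bar>f x\<bar> powr p"])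
    show "AE x in lborel. (\<lambda>k. ?h k x) \<longlonglongrightarrow> 0"
    proof (rule AE_I2, rule tendsto_eventually)
      fix x :: "real ^ 'n"
      obtain N where N: "norm x < real N" using reals_Archimedean2 by blast
      show "\<forall>\<^sub>F k in sequentially. ?h k x = 0"
        using eventually_ge_at_top[of N]
      proof eventually_elim
        case (elim k)
        then have "norm x < real k" using N by linarith
        then show ?case by (simp add: indicator_def)
      qed
    qed
    show "AE x in lborel. norm (?h k x) \<le> \<bar>f x\<bar> powr p" for k by (intro AE_I2) (auto simp: indicator_def)
  qed (use f in auto)
  then have "\<forall>\<^sub>F k in sequentially. (\<integral>x. ?h k x \<partial>lborel) < e powr p"
    using e by (intro order_tendstoD(2)) auto
  then obtain k where k: "(\<integral>x. ?h k x \<partial>lborel) < e powr p" by (auto simp: eventually_sequentially)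
  have i: "integrable lborel (?h k)"
    by (rule Bochner_Integration.integrable_bound[OF f]) (auto simp: indicator_def)
  have "(\<integral>\<^sup>+x. ennreal (?h k x) \<partial>lborel) = ennreal (\<integral>x. ?h k x \<partial>lborel)"
    by (rule nn_integral_eq_integral[OF i]) auto
  also have "\<dots> \<le> ennreal (e powr p)" using k by (intro ennreal_leI) auto
  finally have "nrm p lborel (\<lambda>x. f x - indicator (ball 0 (real k)) x * f x) \<le> ennreal e"
    using p e by (subst nrm_le_iff) auto
  then show ?thesis by blast
qed

lemma closed_cube: "closed {x :: real ^ 'n. \<forall>i. x $ i \<in> {- a..a}}"
proof -
  have "{x :: real ^ 'n. \<forall>i. x $ i \<in> {- a..a}} = cbox (\<chi> i. - a) (\<chi> i. a)"
    by (auto simp: mem_box_cart)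
  then show ?thesis by (simp add: closed_cbox)
qed

lemma integrable_powr_iff:
  assumes p: "1 \<le> p" and [measurable]: "f \<in> borel_measurable M"
  shows "integrable M (\<lambda>x. \<bar>f x\<bar> powr p) \<longleftrightarrow> nrm p M f < \<infinity>"
  by (simp add: nrm_def enn_root_top_iff[unfolded infinity_ennreal_def] integrable_iff_bounded)

definition approximant ::
  "real \<Rightarrow> nat \<Rightarrow> real \<Rightarrow> real \<Rightarrow> (real ^ 'n) set \<Rightarrow> (real ^ 'n \<Rightarrow> real) \<Rightarrow> ennreal \<Rightarrow> (real ^ 'n \<Rightarrow> real) \<Rightarrow> bool" where
  "approximant p r \<delta> \<sigma> Y f b g \<longleftrightarrow> g \<in> Lp p \<inter> lp p \<sigma> Y
     \<and> Lp_norm p (\<lambda>x. f x - g x) \<le> b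
     \<and> lp_norm p \<sigma> Y (\<lambda>\<xi>. averaged \<delta> r g \<xi> - g \<xi>) \<le> b
     \<and> lp_norm p \<sigma> Y (\<lambda>\<xi>. averaged \<delta> r f \<xi> - averaged \<delta> r g \<xi>) \<le> b"

text \<open>The slack \<open>e\<close> pays for the truncation. As \<open>C\<close> is fixed before
  \<open>e\<close>, letting \<open>e\<close> tend to 0 removes it in the final estimates.\<close>

lemma ex_bandlimited_approximant:
  fixes p l \<gamma> :: real and r s :: nat and X :: "real \<Rightarrow> (real ^ 'n) set"
  assumes p: "1 \<le> p" and r: "1 \<le> r" and s: "1 \<le> s" "s \<le> 2 * r" and \<gamma>: "0 < \<gamma>" "\<gamma> \<le> 1" and l: "0 < l"
    and X: "separated \<gamma> X"
  obtains C where "0 < C" "\<And>\<sigma> f e. 0 < \<sigma> \<Longrightarrow> f \<in> Lp p \<Longrightarrow> 0 < e \<Longrightarrow>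
    modulus p s f (1 / \<sigma>) < \<infinity> \<and> (\<exists>g\<in>bandlimited p (l * \<sigma>).
      approximant p r (\<gamma> / \<sigma>) \<sigma> (X \<sigma>) f (ennreal C * (modulus p s f (1 / \<sigma>) + ennreal e)) g
      \<and> sobolev_seminorm p s g \<le> ennreal (\<sigma> ^ s) * (ennreal C * (modulus p s f (1 / \<sigma>) + ennreal e)))"
proof -
  obtain C where C: "0 < C" and approx: "\<And>\<sigma> (F :: real ^ 'n \<Rightarrow> real) W w. 0 < \<sigma> \<Longrightarrow> integrable lborel F \<Longrightarrow> 0 \<le> W
      \<Longrightarrow> (\<forall>v. norm v < 1 / \<sigma> \<longrightarrow> nrm p lborel (fin_diff s v F) \<le> ennreal W)
      \<Longrightarrow> 0 \<le> w \<Longrightarrow> nrm p lborel F \<le> ennreal w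
      \<Longrightarrow> \<exists>g. jackson_approximant p s r \<gamma> (l * \<sigma>) \<sigma> F (C * w) (C * W) g"
    by (rule ex_jackson_approximant[OF p r s \<gamma> l, where 'n='n], rule that)
  define D where "D = 2 / real (2 * r choose r) * (\<Sum>j=1..r. real (2 * r choose (r - j)) * samp_const TYPE('n) p (\<gamma> * real j / real r))"
  have D: "0 \<le> D" unfolding D_def by (intro mult_nonneg_nonneg sum_nonneg) auto
  \<comment> \<open>Collects \<open>C\<close> for the Sobolev seminorm and for the average of
    \<open>g\<close> minus \<open>g\<close>, \<open>C + 1\<close> for \<open>f - g\<close>, where
    the one is the truncation error, and \<open>D * (C + 1)\<close> for the sampled average of
    \<open>f - g\<close>.\<close>
  define C' where "C' = C + (1 + D) * (C + 1)"
  have C': "0 < C'" "C \<le> C'" "C + 1 \<le> C'" "D * (C + 1) \<le> C'"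
  proof -
    have "0 \<le> D * (C + 1)" using C D by simp
    moreover have "C' = C + (C + 1) + D * (C + 1)" by (simp add: C'_def algebra_simps)
    ultimately show "0 < C'" "C \<le> C'" "C + 1 \<le> C'" "D * (C + 1) \<le> C'" using C by linarith+
  qed
  show ?thesis
  proof (rule that[OF C'(1)])
    fix \<sigma> e :: real and f :: "real ^ 'n \<Rightarrow> real"
    assume sg: "0 < \<sigma>" and f: "f \<in> Lp p" and e: "0 < e"
    \<comment> \<open>Norms, differences and averages of \<open>f\<close> may be computed from the
      Borel function \<open>f'\<close>, as they ignore null sets. The sampled values of
      \<open>f\<close> itself are not replaced by those of \<open>f'\<close>.\<close>
    obtain f' where f'[measurable]: "f' \<in> borel_measurable borel" and ae: "AE x in lborel. f x = f' x"
      using completion_ex_borel_measurable_real[of f lborel] f by (auto simp: Lp_def)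
    have ae': "AE x in lebesgue. f x = f' x" using ae by (rule AE_completion)
    have nf: "nrm p lborel f' = Lp_norm p f"
      unfolding Lp_norm_eq using ae by (intro nrm_cong_AE) (auto elim!: eventually_mono)
    have fin: "nrm p lborel f' < \<infinity>" using f by (simp add: nf Lp_def)
    then have int: "integrable lborel (\<lambda>x. \<bar>f' x\<bar> powr p)" using integrable_powr_iff[OF p, of f' lborel] by simp
    have df: "nrm p lborel (fin_diff s v f') = Lp_norm p (fin_diff s v f)" for v
    proof -
      have "AE x in lborel. f (x + u) = f' (x + u)" for u by (rule AE_lborel_translate[OF ae])
      then have "AE x in lborel. \<forall>\<nu>\<in>{0..s}. f (x + real (s - \<nu>) *\<^sub>R v) = f' (x + real (s - \<nu>) *\<^sub>R v)"
        by (intro AE_finite_allI) auto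
      then have "AE x in lborel. \<bar>fin_diff s v f' x\<bar> = \<bar>fin_diff s v f x\<bar>"
        by (rule eventually_mono) (simp add: fin_diff_def)
      then show ?thesis unfolding Lp_norm_eq by (rule nrm_cong_AE)
    qed
    obtain w0 where w0: "0 \<le> w0" "nrm p lborel f' = ennreal w0" using fin by (cases "nrm p lborel f'") auto
    have "modulus p s f (1 / \<sigma>) \<le> ennreal (2 ^ s * w0)"
      unfolding modulus_def
    proof (rule SUP_least)
      fix v :: "real ^ 'n"
      have "nrm p lborel (fin_diff (s + 0) v f') \<le> ennreal (2 ^ s * w0)"
        using w0 by (intro nrm_fin_diff_add_le p f') (auto simp: fin_diff_eq_funpow)
      then show "Lp_norm p (fin_diff s v f) \<le> ennreal (2 ^ s * w0)" by (simp add: df)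
    qed
    then have modfin: "modulus p s f (1 / \<sigma>) < \<infinity>" by (auto simp: less_top[symmetric] top_unique)
    then obtain \<omega> where \<omega>: "0 \<le> \<omega>" "modulus p s f (1 / \<sigma>) = ennreal \<omega>"
      by (cases "modulus p s f (1 / \<sigma>)") auto
    \<comment> \<open>A difference of order \<open>s\<close> may enlarge the truncation error
      \<open>2 ^ s\<close> times, which then amounts to \<open>e\<close>.\<close>
    define \<epsilon> where "\<epsilon> = e / 2 ^ s"
    have \<epsilon>: "0 < \<epsilon>" "2 ^ s * \<epsilon> = e" "\<epsilon> \<le> e"
    proof -
      show "0 < \<epsilon>" "2 ^ s * \<epsilon> = e" using e by (auto simp: \<epsilon>_def)
      have "1 * \<epsilon> \<le> 2 ^ s * \<epsilon>" using \<open>0 < \<epsilon>\<close> by (intro mult_right_mono) auto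
      then show "\<epsilon> \<le> e" using \<open>2 ^ s * \<epsilon> = e\<close> by simp
    qed
    obtain R where R: "nrm p lborel (\<lambda>x. f' x - indicator (ball 0 R) x * f' x) \<le> ennreal \<epsilon>"
      using ex_truncation[OF p f' int \<epsilon>(1)] by blast
    define F where "F x = indicator (ball 0 R) x * f' x" for x
    have F: "integrable lborel F" unfolding F_def[abs_def] by (rule integrable_truncate[OF p f' int])
    have FM[measurable]: "F \<in> borel_measurable borel" using F by (simp add: borel_measurable_integrable)
    define W where "W = \<omega> + e"
    have W: "0 \<le> W" "e \<le> W" using \<omega> e by (auto simp: W_def)
    have small: "nrm p lborel (fin_diff s v F) \<le> ennreal W" if v: "norm v < 1 / \<sigma>" for v
    proof -
      have 1: "nrm p lborel (fin_diff s v f') \<le> ennreal \<omega>"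
        unfolding df \<omega>(2)[symmetric] modulus_def using v by (intro SUP_upper) auto
      have "nrm p lborel (fin_diff (s + 0) v (\<lambda>x. f' x - F x)) \<le> ennreal (2 ^ s * \<epsilon>)"
        using R \<epsilon> by (intro nrm_fin_diff_add_le p) (auto simp: fin_diff_eq_funpow F_def)
      then have 2: "nrm p lborel (fin_diff s v (\<lambda>x. f' x - F x)) \<le> ennreal e" by (simp add: \<epsilon>(2))
      have "fin_diff s v F = (\<lambda>x. fin_diff s v f' x - fin_diff s v (\<lambda>x. f' x - F x) x)"
        by (simp add: fun_eq_iff fin_diff_def right_diff_distrib sum_subtractf)
      then have "nrm p lborel (fin_diff s v F) = nrm p lborel (\<lambda>x. fin_diff s v f' x - fin_diff s v (\<lambda>x. f' x - F x) x)"
        by (rule arg_cong)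
      also have "\<dots> \<le> nrm p lborel (fin_diff s v f') + nrm p lborel (fin_diff s v (\<lambda>x. f' x - F x))"
        by (rule nrm_diff[OF p]) auto
      also have "\<dots> \<le> ennreal \<omega> + ennreal e" by (rule add_mono[OF 1 2])
      finally show ?thesis using \<omega> e by (simp add: W_def)
    qed
    have nF: "nrm p lborel F \<le> ennreal w0"
    proof -
      have "nrm p lborel F \<le> nrm p lborel f'"
        unfolding nrm_def F_def using p
        by (intro enn_root_mono nn_integral_mono ennreal_leI) (auto simp: indicator_def)
      then show ?thesis using w0 by simp
    qed
    obtain g where g: "bdd_cont g" "integrable lborel g" "\<And>x i. l * \<sigma> < \<bar>x $ i\<bar> \<Longrightarrow> fourier g x = 0"
      "nrm p lborel g \<le> ennreal (C * w0)" "nrm p lborel (\<lambda>x. F x - g x) \<le> ennreal (C * W)"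
      "sobolev_seminorm p s g \<le> ennreal (\<sigma> ^ s * (C * W))"
      "\<And>A. sep_finite (\<gamma> / \<sigma>) A \<Longrightarrow> nrm p (sample_measure \<sigma> A) g \<le> ennreal (C * w0)"
      "\<And>A. sep_finite (\<gamma> / \<sigma>) A \<Longrightarrow> nrm p (sample_measure \<sigma> A) (\<lambda>\<xi>. averaged (\<gamma> / \<sigma>) r g \<xi> - g \<xi>) \<le> ennreal (C * W)"
      using approx[OF sg F W(1) _ w0(1) nF] small unfolding jackson_approximant_def by blast
    have gM[measurable]: "g \<in> borel_measurable borel" by (rule bdd_cont_measurable[OF g(1)])
    have gfin: "nrm p lborel g < \<infinity>" using g(4) by (auto simp: less_top[symmetric] top_unique)
    have sepX: "sep_finite (\<gamma> / \<sigma>) A" if "finite A" "A \<subseteq> X \<sigma>" for A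
      using X sg that unfolding sep_finite_def separated_def times_divide_eq_right by blast
    have band: "g \<in> bandlimited p (l * \<sigma>)"
    proof -
      have "g \<in> Lp p" using gfin by (simp add: Lp_def Lp_norm_eq measurable_completion)
      moreover have "nrm 1 lborel g < \<infinity>"
        using integrable_powr_iff[of 1 g lborel] integrable_abs[OF g(2)] by simp
      then have "g \<in> Lp 1" by (simp add: Lp_def Lp_norm_eq measurable_completion)
      moreover have "closure {x. fourier g x \<noteq> 0} \<subseteq> {x. \<forall>i. x $ i \<in> {- (l * \<sigma>)..l * \<sigma>}}"
      proof (rule closure_minimal[OF _ closed_cube], safe)
        fix x :: "real ^ 'n" and i
        assume "fourier g x \<noteq> 0"
        then have "\<bar>x $ i\<bar> \<le> l * \<sigma>" using g(3)[of x i] by fastforce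
        then show "x $ i \<in> {- (l * \<sigma>)..l * \<sigma>}" by auto
      qed
      ultimately show ?thesis using g(1) by (simp add: bandlimited_def bdd_cont_def)
    qed
    have total: "ennreal C' * (modulus p s f (1 / \<sigma>) + ennreal e) = ennreal (C' * W)"
      using \<omega> e C' by (simp add: W_def ennreal_mult)
    have up: "ennreal (c * W) \<le> ennreal (C' * W)" if "c \<le> C'" for c
      using that W by (intro ennreal_leI mult_right_mono) auto
    have dist: "nrm p lborel (\<lambda>x. f' x - g x) \<le> ennreal ((C + 1) * W)"
    proof -
      have "nrm p lborel (\<lambda>x. (f' x - F x) + (F x - g x)) \<le> nrm p lborel (\<lambda>x. f' x - F x) + nrm p lborel (\<lambda>x. F x - g x)"
        by (rule nrm_add[OF p]) measurable
      also have "\<dots> \<le> ennreal W + ennreal (C * W)"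
        using R \<epsilon> W by (intro add_mono g(5)) (auto simp: F_def intro: order_trans ennreal_leI)
      also have "\<dots> = ennreal ((C + 1) * W)" using W C by (simp add: algebra_simps flip: ennreal_plus)
      finally show ?thesis by simp
    qed
    have cf: "conv_integrable ball_unif c f'" if "0 < c" for c using conv_integrable_ball_unif[OF p f' int that] .
    have cg: "conv_integrable ball_unif c g" for c by (rule bdd_cont_conv_integrable[OF borel_prob_ball_unif g(1)])
    have avf: "averaged (\<gamma> / \<sigma>) r f \<xi> = averaged (\<gamma> / \<sigma>) r f' \<xi>" for \<xi>
    proof -
      have "ball_avg d f \<xi> = ball_avg d f' \<xi>" for d
        unfolding ball_avg_def set_lebesgue_integral_def
      proof (rule arg_cong2[of _ _ _ _ "(*)"], rule refl, rule integral_cong_AE)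
        have "f \<in> borel_measurable lebesgue" "f' \<in> borel_measurable lebesgue"
          using f by (auto simp: Lp_def intro: measurable_completion)
        then show "(\<lambda>x. indicator (ball \<xi> d) x *\<^sub>R f x) \<in> borel_measurable lebesgue"
          "(\<lambda>x. indicator (ball \<xi> d) x *\<^sub>R f' x) \<in> borel_measurable lebesgue"
          by (auto intro!: borel_measurable_times borel_measurable_indicator)
        show "AE x in lebesgue. indicator (ball \<xi> d) x *\<^sub>R f x = indicator (ball \<xi> d) x *\<^sub>R f' x"
          using ae' by eventually_elim simp
      qed
      then show ?thesis by (simp add: averaged_def)
    qed
    have avd: "lp_norm p \<sigma> (X \<sigma>) (\<lambda>\<xi>. averaged (\<gamma> / \<sigma>) r f \<xi> - averaged (\<gamma> / \<sigma>) r g \<xi>) \<le> ennreal (C' * W)"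
    proof (rule lp_norm_leI)
      fix A assume A: "finite A" "A \<subseteq> X \<sigma>"
      have "(\<lambda>\<xi>. averaged (\<gamma> / \<sigma>) r f \<xi> - averaged (\<gamma> / \<sigma>) r g \<xi>) = averaged (\<gamma> / \<sigma>) r (\<lambda>x. f' x - g x)"
        using \<gamma> sg by (intro ext) (simp add: avf averaged_diff[OF f' gM cf cg])
      moreover have "nrm p (sample_measure \<sigma> A) (averaged (\<gamma> / \<sigma>) r (\<lambda>x. f' x - g x)) \<le> ennreal (D * ((C + 1) * W))"
        unfolding D_def by (rule nrm_sample_measure_averaged_le[OF p r _ sg \<gamma>(1) sepX[OF A] _ dist]) (use C W in auto)
      moreover have "ennreal (D * ((C + 1) * W)) \<le> ennreal (C' * W)" using up[OF C'(4)] by (simp add: mult.assoc)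
      ultimately show "nrm p (sample_measure \<sigma> A) (\<lambda>\<xi>. averaged (\<gamma> / \<sigma>) r f \<xi> - averaged (\<gamma> / \<sigma>) r g \<xi>) \<le> ennreal (C' * W)"
        by (metis order_trans)
    qed (use p in auto)
    have avg: "lp_norm p \<sigma> (X \<sigma>) (\<lambda>\<xi>. averaged (\<gamma> / \<sigma>) r g \<xi> - g \<xi>) \<le> ennreal (C' * W)"
      using p by (intro lp_norm_leI order_trans[OF g(8) up[OF C'(2)]] sepX) auto
    have "lp_norm p \<sigma> (X \<sigma>) g \<le> ennreal (C * w0)"
      using p by (intro lp_norm_leI g(7) sepX) auto
    then have gl: "lp_norm p \<sigma> (X \<sigma>) g < \<infinity>" by (auto simp: less_top[symmetric] top_unique)
    have fg: "Lp_norm p (\<lambda>x. f x - g x) \<le> ennreal (C' * W)"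
    proof -
      have "nrm p lborel (\<lambda>x. f x - g x) = nrm p lborel (\<lambda>x. f' x - g x)"
        using ae by (intro nrm_cong_AE) (auto elim!: eventually_mono)
      then show ?thesis using order_trans[OF dist up[OF C'(3)]] by (simp add: Lp_norm_eq)
    qed
    have sob: "sobolev_seminorm p s g \<le> ennreal (\<sigma> ^ s) * ennreal (C' * W)"
    proof -
      have "\<sigma> ^ s * (C * W) \<le> \<sigma> ^ s * (C' * W)" using C' sg W by (intro mult_left_mono mult_right_mono) auto
      then have "sobolev_seminorm p s g \<le> ennreal (\<sigma> ^ s * (C' * W))"
        using order_trans[OF g(6) ennreal_leI] by blast
      then show ?thesis using C' sg W by (simp add: ennreal_mult)
    qed
    have "approximant p r (\<gamma> / \<sigma>) \<sigma> (X \<sigma>) f (ennreal (C' * W)) g"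
      unfolding approximant_def using band gl fg avg avd by (simp add: bandlimited_def lp_def)
    then show "modulus p s f (1 / \<sigma>) < \<infinity> \<and> (\<exists>g\<in>bandlimited p (l * \<sigma>).
      approximant p r (\<gamma> / \<sigma>) \<sigma> (X \<sigma>) f (ennreal C' * (modulus p s f (1 / \<sigma>) + ennreal e)) g
      \<and> sobolev_seminorm p s g \<le> ennreal (\<sigma> ^ s) * (ennreal C' * (modulus p s f (1 / \<sigma>) + ennreal e)))"
      unfolding total by (intro conjI bexI[OF _ band] modfin sob)
  qed
qed

section \<open>The sampling error\<close>

lemma Lp_measurable: "f \<in> Lp p \<Longrightarrow> f \<in> borel_measurable lebesgue"
  by (simp add: Lp_def)

lemma Lp_diff:
  assumes p: "1 \<le> p" and f: "f \<in> Lp p" and g: "g \<in> Lp p"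
  shows "(\<lambda>x. f x - g x) \<in> Lp p"
proof -
  note [measurable] = Lp_measurable[OF f] Lp_measurable[OF g]
  have "nrm p lebesgue (\<lambda>x. f x - g x) \<le> nrm p lebesgue f + nrm p lebesgue g" by (rule nrm_diff[OF p]) measurable
  also have "\<dots> < \<infinity>" using f g by (simp add: Lp_def Lp_norm_def nrm_def)
  finally show ?thesis by (simp add: Lp_def Lp_norm_def nrm_def)
qed

lemma Lp_norm_triangle3:
  assumes p: "1 \<le> p" and "f \<in> borel_measurable lebesgue" "g \<in> borel_measurable lebesgue" "h \<in> borel_measurable lebesgue"
  shows "Lp_norm p (\<lambda>x. f x + g x + h x) \<le> Lp_norm p f + Lp_norm p g + Lp_norm p h"
proof -
  note [measurable] = assms(2-4)
  have "nrm p lebesgue (\<lambda>x. (f x + g x) + h x) \<le> nrm p lebesgue (\<lambda>x. f x + g x) + nrm p lebesgue h"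
    by (rule nrm_add[OF p]) measurable
  also have "\<dots> \<le> nrm p lebesgue f + nrm p lebesgue g + nrm p lebesgue h"
    by (intro add_right_mono nrm_add[OF p]) measurable
  finally show ?thesis by (simp add: Lp_norm_def nrm_def)
qed

text \<open>Additivity holds where both series converge; elsewhere \<open>infsum\<close> takes its
  default value. Convergence almost everywhere is what \<open>sampling_well_defined\<close>
  provides, and it is enough under the norm.\<close>

lemma sampling_op_diff:
  assumes wd: "sampling_well_defined p X \<psi>" and sg: "0 < \<sigma>"
    and f: "f \<in> Lp p \<inter> lp p \<sigma> (X \<sigma>)" and g: "g \<in> Lp p \<inter> lp p \<sigma> (X \<sigma>)"
  shows "AE x in lebesgue. sampling_op X \<psi> \<sigma> (\<lambda>x. f x - g x) x = sampling_op X \<psi> \<sigma> f x - sampling_op X \<psi> \<sigma> g x"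
proof -
  have "AE x in lebesgue. (\<lambda>\<xi>. f \<xi> * \<psi> \<sigma> \<xi> x) summable_on X \<sigma>" "AE x in lebesgue. (\<lambda>\<xi>. g \<xi> * \<psi> \<sigma> \<xi> x) summable_on X \<sigma>"
    using wd sg f g by (auto simp: sampling_well_defined_def)
  then show ?thesis
  proof eventually_elim
    case (elim x)
    have "(\<Sum>\<^sub>\<infinity>\<xi>\<in>X \<sigma>. f \<xi> * \<psi> \<sigma> \<xi> x + - (g \<xi> * \<psi> \<sigma> \<xi> x))
        = (\<Sum>\<^sub>\<infinity>\<xi>\<in>X \<sigma>. f \<xi> * \<psi> \<sigma> \<xi> x) + (\<Sum>\<^sub>\<infinity>\<xi>\<in>X \<sigma>. - (g \<xi> * \<psi> \<sigma> \<xi> x))"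
      using elim by (intro infsum_add) (simp_all only: summable_on_uminus)
    then show ?case by (simp add: sampling_op_def left_diff_distrib infsum_uminus)
  qed
qed

lemma sampling_op_Lp:
  "sampling_well_defined p X \<psi> \<Longrightarrow> 0 < \<sigma> \<Longrightarrow> f \<in> Lp p \<inter> lp p \<sigma> (X \<sigma>) \<Longrightarrow> sampling_op X \<psi> \<sigma> f \<in> Lp p"
  by (simp add: sampling_well_defined_def)

lemma ennreal_le_scaled_epsilon:
  fixes a b c :: ennreal
  assumes K: "0 < K" and le: "\<And>e. 0 < e \<Longrightarrow> a \<le> b + ennreal K * (c + ennreal e)"
  shows "a \<le> b + ennreal K * c"
proof (rule ennreal_le_epsilon)
  fix e :: real assume e: "0 < e"
  have "a \<le> b + ennreal K * (c + ennreal (e / K))" using K e by (intro le) auto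
  also have "\<dots> = b + ennreal K * c + ennreal e"
    using K e by (simp add: distrib_left add.assoc flip: ennreal_mult)
  finally show "a \<le> b + ennreal K * c + ennreal e" .
qed

text \<open>Membership of \<open>f\<close> in \<open>lp\<close> is derived: finiteness of the
  sampled norm in \<open>N\<close> makes \<open>g - f\<close> summable, and
  \<open>f = g - (g - f)\<close>. The two terms \<open>b\<close> beside that norm are the sampled
  errors of the averages of \<open>f - g\<close> and of \<open>g\<close>.\<close>

lemma approximant_upper:
  assumes p: "1 \<le> p" and wd: "sampling_well_defined p X \<psi>" and A1: "sampling_A1 p X \<psi> \<kappa>" and sg: "0 < \<sigma>"
    and f: "f \<in> Lp p" and app: "approximant p r \<delta> \<sigma> (X \<sigma>) f b g" and b: "b < \<infinity>"
    and N: "lp_norm p \<sigma> (X \<sigma>) (\<lambda>\<xi>. averaged \<delta> r f \<xi> - f \<xi>) < \<infinity>"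
  shows "Lp_norm p (\<lambda>x. f x - sampling_op X \<psi> \<sigma> f x) \<le> b + Lp_norm p (\<lambda>x. g x - sampling_op X \<psi> \<sigma> g x)
    + ennreal \<kappa> * (lp_norm p \<sigma> (X \<sigma>) (\<lambda>\<xi>. averaged \<delta> r f \<xi> - f \<xi>) + b + b)"
proof -
  let ?G = "sampling_op X \<psi> \<sigma>" and ?n = "lp_norm p \<sigma> (X \<sigma>)" and ?axis_avg = "averaged \<delta> r"
  let ?N = "?n (\<lambda>\<xi>. ?axis_avg f \<xi> - f \<xi>)"
  have g: "g \<in> Lp p \<inter> lp p \<sigma> (X \<sigma>)" "Lp_norm p (\<lambda>x. f x - g x) \<le> b"
    "?n (\<lambda>\<xi>. ?axis_avg g \<xi> - g \<xi>) \<le> b" "?n (\<lambda>\<xi>. ?axis_avg f \<xi> - ?axis_avg g \<xi>) \<le> b"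
    using app by (auto simp: approximant_def)
  have "?n (\<lambda>\<xi>. (?axis_avg f \<xi> - f \<xi>) - (?axis_avg f \<xi> - ?axis_avg g \<xi>) - (?axis_avg g \<xi> - g \<xi>))
      \<le> ?n (\<lambda>\<xi>. (?axis_avg f \<xi> - f \<xi>) - (?axis_avg f \<xi> - ?axis_avg g \<xi>)) + ?n (\<lambda>\<xi>. ?axis_avg g \<xi> - g \<xi>)"
    by (rule lp_norm_diff[OF p])
  also have "\<dots> \<le> ?N + ?n (\<lambda>\<xi>. ?axis_avg f \<xi> - ?axis_avg g \<xi>) + ?n (\<lambda>\<xi>. ?axis_avg g \<xi> - g \<xi>)"
    by (intro add_right_mono lp_norm_diff[OF p])
  also have "\<dots> \<le> ?N + b + b" by (intro add_mono order_refl g(3,4))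
  finally have gf: "?n (\<lambda>\<xi>. g \<xi> - f \<xi>) \<le> ?N + b + b" by simp
  then have "?n (\<lambda>\<xi>. g \<xi> - f \<xi>) < \<infinity>" using le_less_trans[OF gf] N b by simp
  then have gfX: "(\<lambda>x. g x - f x) \<in> Lp p \<inter> lp p \<sigma> (X \<sigma>)" using Lp_diff[OF p IntD1[OF g(1)] f] by (simp add: lp_def)
  have "?n (\<lambda>\<xi>. g \<xi> - (g \<xi> - f \<xi>)) \<le> ?n g + ?n (\<lambda>\<xi>. g \<xi> - f \<xi>)" by (rule lp_norm_diff[OF p])
  also have "\<dots> < \<infinity>" using g(1) gfX by (simp add: lp_def)
  finally have fX: "f \<in> Lp p \<inter> lp p \<sigma> (X \<sigma>)" using f by (simp add: lp_def)
  note ms = Lp_measurable[OF f] Lp_measurable[OF IntD1[OF g(1)]]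
    Lp_measurable[OF sampling_op_Lp[OF wd sg g(1)]] Lp_measurable[OF sampling_op_Lp[OF wd sg gfX]]
  have "AE x in lebesgue. \<bar>f x - ?G f x\<bar> = \<bar>(f x - g x) + (g x - ?G g x) + ?G (\<lambda>x. g x - f x) x\<bar>"
    using sampling_op_diff[OF wd sg g(1) fX] by eventually_elim simp
  then have "Lp_norm p (\<lambda>x. f x - ?G f x) = Lp_norm p (\<lambda>x. (f x - g x) + (g x - ?G g x) + ?G (\<lambda>x. g x - f x) x)"
    unfolding Lp_norm_def nrm_def[symmetric] by (rule nrm_cong_AE)
  also have "\<dots> \<le> Lp_norm p (\<lambda>x. f x - g x) + Lp_norm p (\<lambda>x. g x - ?G g x) + Lp_norm p (?G (\<lambda>x. g x - f x))"
    using ms by (intro Lp_norm_triangle3[OF p]) auto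
  also have "\<dots> \<le> b + Lp_norm p (\<lambda>x. g x - ?G g x) + ennreal \<kappa> * (?N + b + b)"
  proof (intro add_mono g(2) order_refl)
    have "Lp_norm p (?G (\<lambda>x. g x - f x)) \<le> ennreal \<kappa> * ?n (\<lambda>\<xi>. g \<xi> - f \<xi>)"
      using A1 sg gfX unfolding sampling_A1_def by blast
    also have "\<dots> \<le> ennreal \<kappa> * (?N + b + b)" by (rule mult_left_mono[OF gf]) simp
    finally show "Lp_norm p (?G (\<lambda>x. g x - f x)) \<le> ennreal \<kappa> * (?N + b + b)" .
  qed
  finally show ?thesis .
qed

text \<open>The same splitting, solved for the image of \<open>g - f\<close>:
  \<open>sampling_A2\<close> bounds the samples of \<open>g - f\<close> by the norm of that image,
  and adding the two small sampled errors recovers the average of \<open>f\<close> minus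
  \<open>f\<close>.\<close>

lemma approximant_lower:
  assumes p: "1 \<le> p" and wd: "sampling_well_defined p X \<psi>" and A2: "sampling_A2 p X \<psi> \<kappa>" and sg: "0 < \<sigma>"
    and fX: "f \<in> Lp p \<inter> lp p \<sigma> (X \<sigma>)" and app: "approximant p r \<delta> \<sigma> (X \<sigma>) f b g"
  shows "ennreal \<kappa> * lp_norm p \<sigma> (X \<sigma>) (\<lambda>\<xi>. averaged \<delta> r f \<xi> - f \<xi>) \<le> Lp_norm p (\<lambda>x. f x - sampling_op X \<psi> \<sigma> f x)
    + (b + Lp_norm p (\<lambda>x. g x - sampling_op X \<psi> \<sigma> g x) + ennreal \<kappa> * (b + b))"
proof -
  let ?G = "sampling_op X \<psi> \<sigma>" and ?n = "lp_norm p \<sigma> (X \<sigma>)" and ?axis_avg = "averaged \<delta> r"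
  let ?E = "Lp_norm p (\<lambda>x. f x - ?G f x)" and ?H = "Lp_norm p (\<lambda>x. g x - ?G g x)"
  have g: "g \<in> Lp p \<inter> lp p \<sigma> (X \<sigma>)" "Lp_norm p (\<lambda>x. f x - g x) \<le> b"
    "?n (\<lambda>\<xi>. ?axis_avg g \<xi> - g \<xi>) \<le> b" "?n (\<lambda>\<xi>. ?axis_avg f \<xi> - ?axis_avg g \<xi>) \<le> b"
    using app by (auto simp: approximant_def)
  have "?n (\<lambda>\<xi>. g \<xi> - f \<xi>) \<le> ?n g + ?n f" by (rule lp_norm_diff[OF p])
  also have "\<dots> < \<infinity>" using g(1) fX by (simp add: lp_def)
  finally have gfX: "(\<lambda>x. g x - f x) \<in> Lp p \<inter> lp p \<sigma> (X \<sigma>)" using Lp_diff[OF p IntD1[OF g(1)] IntD1[OF fX]] by (simp add: lp_def)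
  note ms = Lp_measurable[OF IntD1[OF fX]] Lp_measurable[OF IntD1[OF g(1)]]
    Lp_measurable[OF sampling_op_Lp[OF wd sg g(1)]] Lp_measurable[OF sampling_op_Lp[OF wd sg fX]]
  have ae: "AE x in lebesgue. \<bar>?G (\<lambda>x. g x - f x) x\<bar> = \<bar>(f x - ?G f x) + - (f x - g x) + - (g x - ?G g x)\<bar>"
    using sampling_op_diff[OF wd sg g(1) fX] by eventually_elim simp
  have "ennreal \<kappa> * ?n (\<lambda>\<xi>. g \<xi> - f \<xi>) \<le> Lp_norm p (?G (\<lambda>x. g x - f x))"
    using A2 sg gfX unfolding sampling_A2_def by blast
  also have "\<dots> = Lp_norm p (\<lambda>x. (f x - ?G f x) + - (f x - g x) + - (g x - ?G g x))"
    unfolding Lp_norm_def nrm_def[symmetric] by (rule nrm_cong_AE[OF ae])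
  also have "\<dots> \<le> ?E + Lp_norm p (\<lambda>x. - (f x - g x)) + Lp_norm p (\<lambda>x. - (g x - ?G g x))"
    using ms by (intro Lp_norm_triangle3[OF p]) auto
  also have "\<dots> \<le> ?E + b + ?H"
    using g(2) by (intro add_mono) (auto simp: Lp_norm_def abs_minus_commute)
  finally have 1: "ennreal \<kappa> * ?n (\<lambda>\<xi>. g \<xi> - f \<xi>) \<le> ?E + b + ?H" .
  have "?n (\<lambda>\<xi>. (?axis_avg f \<xi> - ?axis_avg g \<xi>) + (?axis_avg g \<xi> - g \<xi>) + (g \<xi> - f \<xi>))
      \<le> ?n (\<lambda>\<xi>. (?axis_avg f \<xi> - ?axis_avg g \<xi>) + (?axis_avg g \<xi> - g \<xi>)) + ?n (\<lambda>\<xi>. g \<xi> - f \<xi>)"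
    by (rule lp_norm_add[OF p])
  also have "\<dots> \<le> ?n (\<lambda>\<xi>. ?axis_avg f \<xi> - ?axis_avg g \<xi>) + ?n (\<lambda>\<xi>. ?axis_avg g \<xi> - g \<xi>) + ?n (\<lambda>\<xi>. g \<xi> - f \<xi>)"
    by (intro add_right_mono lp_norm_add[OF p])
  also have "\<dots> \<le> b + b + ?n (\<lambda>\<xi>. g \<xi> - f \<xi>)" by (intro add_right_mono add_mono g(3,4))
  finally have "?n (\<lambda>\<xi>. ?axis_avg f \<xi> - f \<xi>) \<le> b + b + ?n (\<lambda>\<xi>. g \<xi> - f \<xi>)" by simp
  then have "ennreal \<kappa> * ?n (\<lambda>\<xi>. ?axis_avg f \<xi> - f \<xi>) \<le> ennreal \<kappa> * (b + b + ?n (\<lambda>\<xi>. g \<xi> - f \<xi>))"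
    by (rule mult_left_mono) simp
  also have "\<dots> = ennreal \<kappa> * (b + b) + ennreal \<kappa> * ?n (\<lambda>\<xi>. g \<xi> - f \<xi>)" by (rule distrib_left)
  also have "\<dots> \<le> ennreal \<kappa> * (b + b) + (?E + b + ?H)" by (rule add_left_mono[OF 1])
  finally show ?thesis by (simp only: add_ac)
qed

theorem theorem4p1:
  fixes p \<gamma> \<kappa>\<^sub>1 \<kappa>\<^sub>3 :: real
    and r s :: nat
    and X :: "real \<Rightarrow> (real ^ 'n) set"
    and \<psi> :: "real \<Rightarrow> real ^ 'n \<Rightarrow> real ^ 'n \<Rightarrow> real"
  assumes "1 \<le> p"
    and "1 \<le> r" and "1 \<le> s" and "s \<le> 2 * r"
    and "0 < \<gamma>" and "\<gamma> \<le> 1"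
    and "separated \<gamma> X"
    and "sampling_well_defined p X \<psi>"
    and "0 < \<kappa>\<^sub>1" and "sampling_A1 p X \<psi> \<kappa>\<^sub>1"
    and "0 < \<kappa>\<^sub>3" and "sampling_A3 p s X \<psi> \<kappa>\<^sub>3"
  shows "(\<exists>C\<^sub>1>0. \<forall>\<sigma>>0. \<forall>f \<in> Lp p.
            Lp_norm p (\<lambda>x. f x - sampling_op X \<psi> \<sigma> f x)
              \<le> ennreal \<kappa>\<^sub>1 * lp_norm p \<sigma> (X \<sigma>) (\<lambda>\<xi>. averaged (\<gamma> / \<sigma>) r f \<xi> - f \<xi>)
                + ennreal C\<^sub>1 * modulus p s f (1 / \<sigma>))
       \<and> (\<forall>\<kappa>\<^sub>2>0. sampling_A2 p X \<psi> \<kappa>\<^sub>2 \<longrightarrow>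
            (\<exists>C\<^sub>2>0. \<forall>\<sigma>>0. \<forall>f \<in> Lp p \<inter> lp p \<sigma> (X \<sigma>).
               ennreal \<kappa>\<^sub>2 * lp_norm p \<sigma> (X \<sigma>) (\<lambda>\<xi>. averaged (\<gamma> / \<sigma>) r f \<xi> - f \<xi>)
                 - ennreal C\<^sub>2 * modulus p s f (1 / \<sigma>)
                 \<le> Lp_norm p (\<lambda>x. f x - sampling_op X \<psi> \<sigma> f x)))"
proof -
  note p = assms(1) and wd = assms(8)
  let ?G = "sampling_op X \<psi>"
  obtain l where l: "0 < l" and A3: "\<And>\<sigma> g. 0 < \<sigma> \<Longrightarrow> g \<in> bandlimited p (l * \<sigma>) \<Longrightarrow>
      Lp_norm p (\<lambda>x. g x - ?G \<sigma> g x) \<le> ennreal (\<kappa>\<^sub>3 * (1 / \<sigma> ^ s)) * sobolev_seminorm p s g"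
    using assms(12) unfolding sampling_A3_def by auto
  obtain C where C: "0 < C" and main: "\<And>\<sigma> f e. 0 < \<sigma> \<Longrightarrow> f \<in> Lp p \<Longrightarrow> 0 < e \<Longrightarrow>
    modulus p s f (1 / \<sigma>) < \<infinity> \<and> (\<exists>g\<in>bandlimited p (l * \<sigma>).
      approximant p r (\<gamma> / \<sigma>) \<sigma> (X \<sigma>) f (ennreal C * (modulus p s f (1 / \<sigma>) + ennreal e)) g
      \<and> sobolev_seminorm p s g \<le> ennreal (\<sigma> ^ s) * (ennreal C * (modulus p s f (1 / \<sigma>) + ennreal e)))"
    by (rule ex_bandlimited_approximant[OF assms(1-6) l assms(7)], rule that)
  \<comment> \<open>The summands stem from \<open>f - g\<close>, from \<open>sampling_A3\<close>,
    where \<open>\<sigma> ^ s\<close> cancels, and from the two sampled errors, each multiplied by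
    \<open>\<kappa>\<close>.\<close>
  let ?K = "\<lambda>\<kappa>. C + \<kappa>\<^sub>3 * C + 2 * \<kappa> * C"
  have K: "0 < ?K \<kappa>" if "0 < \<kappa>" for \<kappa>
    using that C assms(11) by (intro add_pos_pos mult_pos_pos) auto
  have key: "\<exists>b g. approximant p r (\<gamma> / \<sigma>) \<sigma> (X \<sigma>) f b g \<and> b < \<infinity>
      \<and> b + Lp_norm p (\<lambda>x. g x - ?G \<sigma> g x) + ennreal \<kappa> * (b + b) \<le> ennreal (?K \<kappa>) * (modulus p s f (1 / \<sigma>) + ennreal e)"
    if sg: "0 < \<sigma>" and f: "f \<in> Lp p" and e: "0 < e" and k: "0 < \<kappa>" for \<sigma> e \<kappa> and f :: "real ^ 'n \<Rightarrow> real"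
  proof -
    let ?m = "modulus p s f (1 / \<sigma>) + ennreal e"
    let ?b = "ennreal C * ?m"
    obtain g where g: "g \<in> bandlimited p (l * \<sigma>)" "approximant p r (\<gamma> / \<sigma>) \<sigma> (X \<sigma>) f ?b g"
      "sobolev_seminorm p s g \<le> ennreal (\<sigma> ^ s) * ?b"
      using main[OF sg f e] by blast
    have "Lp_norm p (\<lambda>x. g x - ?G \<sigma> g x) \<le> ennreal (\<kappa>\<^sub>3 * (1 / \<sigma> ^ s)) * (ennreal (\<sigma> ^ s) * ?b)"
      by (rule order_trans[OF A3[OF sg g(1)] mult_left_mono[OF g(3)]]) simp
    also have "\<dots> = ennreal (\<kappa>\<^sub>3 * (1 / \<sigma> ^ s) * \<sigma> ^ s) * ?b"
      using assms(11) sg by (subst ennreal_mult) (auto simp: mult.assoc)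
    also have "\<kappa>\<^sub>3 * (1 / \<sigma> ^ s) * \<sigma> ^ s = \<kappa>\<^sub>3" using sg by simp
    finally have "?b + Lp_norm p (\<lambda>x. g x - ?G \<sigma> g x) + ennreal \<kappa> * (?b + ?b) \<le> ?b + ennreal \<kappa>\<^sub>3 * ?b + ennreal \<kappa> * (?b + ?b)"
      by (intro add_mono order_refl)
    also have "\<dots> = ennreal (?K \<kappa>) * ?m"
    proof -
      have "ennreal (?K \<kappa>) = ennreal C + ennreal \<kappa>\<^sub>3 * ennreal C + (ennreal \<kappa> * ennreal C + ennreal \<kappa> * ennreal C)"
        using k C assms(11) by (simp flip: ennreal_plus ennreal_mult)
      then show ?thesis by (simp add: distrib_left distrib_right mult.assoc)
    qed
    finally have le: "?b + Lp_norm p (\<lambda>x. g x - ?G \<sigma> g x) + ennreal \<kappa> * (?b + ?b) \<le> ennreal (?K \<kappa>) * ?m" .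
    have "?b < \<infinity>" using main[OF sg f e] by (simp add: ennreal_mult_less_top)
    then show ?thesis using g(2) le by blast
  qed
  show ?thesis
  proof (intro conjI allI impI)
    show "\<exists>C\<^sub>1>0. \<forall>\<sigma>>0. \<forall>f \<in> Lp p. Lp_norm p (\<lambda>x. f x - ?G \<sigma> f x)
        \<le> ennreal \<kappa>\<^sub>1 * lp_norm p \<sigma> (X \<sigma>) (\<lambda>\<xi>. averaged (\<gamma> / \<sigma>) r f \<xi> - f \<xi>) + ennreal C\<^sub>1 * modulus p s f (1 / \<sigma>)"
    proof (intro exI conjI allI impI ballI)
      show "0 < ?K \<kappa>\<^sub>1" by (rule K[OF assms(9)])
      fix \<sigma> :: real and f :: "real ^ 'n \<Rightarrow> real" assume sg: "0 < \<sigma>" and f: "f \<in> Lp p"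
      let ?N = "lp_norm p \<sigma> (X \<sigma>) (\<lambda>\<xi>. averaged (\<gamma> / \<sigma>) r f \<xi> - f \<xi>)"
      show "Lp_norm p (\<lambda>x. f x - ?G \<sigma> f x) \<le> ennreal \<kappa>\<^sub>1 * ?N + ennreal (?K \<kappa>\<^sub>1) * modulus p s f (1 / \<sigma>)"
      \<comment> \<open>If \<open>?N\<close> is infinite, so is the right-hand side because
        \<open>\<kappa>\<^sub>1\<close> is positive; otherwise \<open>approximant_upper\<close>
        derives that \<open>f\<close> is in \<open>lp\<close>.\<close>
      proof (cases "?N < \<infinity>")
        case False
        then have "ennreal \<kappa>\<^sub>1 * ?N = \<infinity>" using assms(9) by (simp add: ennreal_mult_top less_top[symmetric])
        then show ?thesis by simp
      next
        case True
        show ?thesis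
        proof (rule ennreal_le_scaled_epsilon[OF K[OF assms(9)]])
          fix e :: real assume e: "0 < e"
          obtain b g where g: "approximant p r (\<gamma> / \<sigma>) \<sigma> (X \<sigma>) f b g" "b < \<infinity>"
            and le: "b + Lp_norm p (\<lambda>x. g x - ?G \<sigma> g x) + ennreal \<kappa>\<^sub>1 * (b + b) \<le> ennreal (?K \<kappa>\<^sub>1) * (modulus p s f (1 / \<sigma>) + ennreal e)"
            using key[OF sg f e assms(9)] by blast
          have "Lp_norm p (\<lambda>x. f x - ?G \<sigma> f x) \<le> b + Lp_norm p (\<lambda>x. g x - ?G \<sigma> g x) + ennreal \<kappa>\<^sub>1 * (?N + b + b)"
            by (rule approximant_upper[OF p wd assms(10) sg f g True])
          also have "\<dots> = ennreal \<kappa>\<^sub>1 * ?N + (b + Lp_norm p (\<lambda>x. g x - ?G \<sigma> g x) + ennreal \<kappa>\<^sub>1 * (b + b))"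
            by (simp only: distrib_left add_ac)
          also have "\<dots> \<le> ennreal \<kappa>\<^sub>1 * ?N + ennreal (?K \<kappa>\<^sub>1) * (modulus p s f (1 / \<sigma>) + ennreal e)"
            by (rule add_left_mono[OF le])
          finally show "Lp_norm p (\<lambda>x. f x - ?G \<sigma> f x) \<le> ennreal \<kappa>\<^sub>1 * ?N + ennreal (?K \<kappa>\<^sub>1) * (modulus p s f (1 / \<sigma>) + ennreal e)" .
        qed
      qed
    qed
  next
    fix \<kappa>\<^sub>2 :: real assume k2: "0 < \<kappa>\<^sub>2" and A2: "sampling_A2 p X \<psi> \<kappa>\<^sub>2"
    show "\<exists>C\<^sub>2>0. \<forall>\<sigma>>0. \<forall>f \<in> Lp p \<inter> lp p \<sigma> (X \<sigma>).
        ennreal \<kappa>\<^sub>2 * lp_norm p \<sigma> (X \<sigma>) (\<lambda>\<xi>. averaged (\<gamma> / \<sigma>) r f \<xi> - f \<xi>) - ennreal C\<^sub>2 * modulus p s f (1 / \<sigma>)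
          \<le> Lp_norm p (\<lambda>x. f x - ?G \<sigma> f x)"
    proof (intro exI conjI allI impI ballI)
      show "0 < ?K \<kappa>\<^sub>2" by (rule K[OF k2])
      fix \<sigma> :: real and f :: "real ^ 'n \<Rightarrow> real" assume sg: "0 < \<sigma>" and fX: "f \<in> Lp p \<inter> lp p \<sigma> (X \<sigma>)"
      then have f: "f \<in> Lp p" by simp
      let ?N = "lp_norm p \<sigma> (X \<sigma>) (\<lambda>\<xi>. averaged (\<gamma> / \<sigma>) r f \<xi> - f \<xi>)"
      let ?E = "Lp_norm p (\<lambda>x. f x - ?G \<sigma> f x)"
      have le: "ennreal \<kappa>\<^sub>2 * ?N \<le> ?E + ennreal (?K \<kappa>\<^sub>2) * modulus p s f (1 / \<sigma>)"
      proof (rule ennreal_le_scaled_epsilon[OF K[OF k2]])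
        fix e :: real assume e: "0 < e"
        show "ennreal \<kappa>\<^sub>2 * ?N \<le> ?E + ennreal (?K \<kappa>\<^sub>2) * (modulus p s f (1 / \<sigma>) + ennreal e)"
          using key[OF sg f e k2] order_trans[OF approximant_lower[OF p wd A2 sg fX] add_left_mono] by blast
      qed
      \<comment> \<open>Subtraction in \<open>ennreal\<close> is truncated at 0; finiteness of the
        subtrahend excludes infinity minus infinity when the term changes sides.\<close>
      have "ennreal (?K \<kappa>\<^sub>2) * modulus p s f (1 / \<sigma>) < \<infinity>"
        using main[OF sg f zero_less_one] by (simp add: ennreal_mult_less_top)
      then show "ennreal \<kappa>\<^sub>2 * ?N - ennreal (?K \<kappa>\<^sub>2) * modulus p s f (1 / \<sigma>) \<le> ?E"
        using le by (subst ennreal_minus_le_iff) (auto simp: add.commute)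
    qed
  qed
qed

end
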